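(* For any $c\ge1$, if one of the following statements is true, then both are: (1) $(1+\varepsilon)$-Approximate Min-Plus Convolution can be solved in strongly polynomial time $\tilde{\mathcal{O}}(n^c/\mathrm{poly}(\varepsilon))$; (2) exact Min-Max Convolution can be solved in strongly polynomial time $\tilde{\mathcal{O}}(n^c)$.
   Context: $\mathbb{R}_+=\{a\in\mathbb{R}:a\ge1\}\cup\{\infty\}$. For sequences $A,B\in\mathbb{R}_+^n$ indexed $0,\dots,n-1$: Min-Plus Convolution is $C[k]=\min_{i+j=k}(A[i]+B[j])$, and its $(1+\varepsilon)$-approximate version outputs $\tilde C$ with $C[k]\le\tilde C[k]\le(1+\varepsilon)C[k]$ for all $k$; Min-Max Convolution is $C[k]=\min_{i+j=k}\max\{A[i],B[j]\}$. Input convention: for the approximate problem input numbers are in floating-point representation, for the exact problem input numbers are integers in standard bit representation; arithmetic on input numbers has unit cost. "Strongly polynomial time $T$" means at most $T$ arithmetic operations, independent of the largest input value $W$. $\tilde{\mathcal{O}}$ hides polylogarithmic factors in $n$ and $1/\varepsilon$, never $\log W$. *)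

theory Defs
  imports Complex_Main "HOL-Library.Extended_Real"
begin

definition Rplus :: "ereal set" where
  "Rplus = ereal ` {a. 1 \<le> a} \<union> {\<infinity>}"

text \<open>For sequences of length \<open>n\<close> the index \<open>k\<close> ranges over \<open>0, \<dots>, 2n - 2\<close>, i.e. over all
  indices for which the minimum is taken over a nonempty set.\<close>

definition min_plus_conv :: "ereal list \<Rightarrow> ereal list \<Rightarrow> nat \<Rightarrow> ereal" where
  "min_plus_conv A B k =
     Min {A ! i + B ! j | i j. i < length A \<and> j < length B \<and> i + j = k}"

definition min_max_conv :: "ereal list \<Rightarrow> ereal list \<Rightarrow> nat \<Rightarrow> ereal" where
  "min_max_conv A B k =
     Min {max (A ! i) (B ! j) | i j. i < length A \<and> j < length B \<and> i + j = k}"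

text \<open>A random access machine in structured form: finitely many integer registers and integer
  arrays per program, unit-cost arithmetic on machine words. Every intermediate result has to be
  bounded in absolute value by the largest word \<open>M\<close>; overflow, division by zero, negative shift
  distances and out-of-range array accesses are errors, and an erroneous run has no final state.
  Without the bound on words, unit-cost arithmetic on integers of unlimited length would make
  the model unreasonably powerful.\<close>

datatype binop = Plus | Minus | Times | Div | Mod | Shl | Shr

datatype aexp = N int | V nat | Get nat aexp | Bin binop aexp aexp

datatype bexp = Less aexp aexp | Not bexp | And bexp bexp

datatype com =
    Skip
  | Assign nat aexp
  | Store nat aexp aexp
  | Alloc nat aexp
  | Seq com com
  | If bexp com com
  | While bexp com

type_synonym state = "(nat \<Rightarrow> int) \<times> (nat \<Rightarrow> int list)"

fun arith :: "binop \<Rightarrow> int \<Rightarrow> int \<Rightarrow> int option" where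
  "arith Plus x y = Some (x + y)"
| "arith Minus x y = Some (x - y)"
| "arith Times x y = Some (x * y)"
| "arith Div x y = (if y = 0 then None else Some (x div y))"
| "arith Mod x y = (if y = 0 then None else Some (x mod y))"
| "arith Shl x y = (if y < 0 then None else Some (x * 2 ^ nat y))"
| "arith Shr x y = (if y < 0 then None else Some (x div 2 ^ nat y))"

definition fit :: "int \<Rightarrow> int \<Rightarrow> int option" where
  "fit M v = (if \<bar>v\<bar> \<le> M then Some v else None)"

fun aval :: "int \<Rightarrow> aexp \<Rightarrow> state \<Rightarrow> int option" where
  "aval M (N v) s = fit M v"
| "aval M (V x) s = Some (fst s x)"
| "aval M (Get a e) s =
     (case aval M e s of
        None \<Rightarrow> None
      | Some i \<Rightarrow> if 0 \<le> i \<and> nat i < length (snd s a) then Some (snd s a ! nat i) else None)"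
| "aval M (Bin f e1 e2) s =
     (case (aval M e1 s, aval M e2 s) of
        (Some x, Some y) \<Rightarrow> Option.bind (arith f x y) (fit M)
      | _ \<Rightarrow> None)"

fun bval :: "int \<Rightarrow> bexp \<Rightarrow> state \<Rightarrow> bool option" where
  "bval M (Less e1 e2) s =
     (case (aval M e1 s, aval M e2 s) of (Some x, Some y) \<Rightarrow> Some (x < y) | _ \<Rightarrow> None)"
| "bval M (Not b) s = map_option HOL.Not (bval M b s)"
| "bval M (And b1 b2) s =
     (case bval M b1 s of
        None \<Rightarrow> None
      | Some v \<Rightarrow> if v then bval M b2 s else Some False)"

fun acost :: "aexp \<Rightarrow> nat" where
  "acost (N v) = 1"
| "acost (V x) = 1"
| "acost (Get a e) = acost e + 1"
| "acost (Bin f e1 e2) = acost e1 + acost e2 + 1"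

fun bcost :: "bexp \<Rightarrow> nat" where
  "bcost (Less e1 e2) = acost e1 + acost e2 + 1"
| "bcost (Not b) = bcost b + 1"
| "bcost (And b1 b2) = bcost b1 + bcost b2 + 1"

text \<open>\<open>exec M P s t s'\<close>: with largest word \<open>M\<close>, program \<open>P\<close> started in \<open>s\<close> terminates without
  error in \<open>s'\<close> after \<open>t\<close> operations. Allocating (and zeroing) an array costs its length.\<close>

inductive exec :: "int \<Rightarrow> com \<Rightarrow> state \<Rightarrow> nat \<Rightarrow> state \<Rightarrow> bool" for M :: int where
  Skip: "exec M Skip s 1 s"
| Assign: "aval M e s = Some v \<Longrightarrow>
    exec M (Assign x e) s (acost e + 1) ((fst s)(x := v), snd s)"
| Store: "aval M e1 s = Some i \<Longrightarrow> 0 \<le> i \<Longrightarrow> nat i < length (snd s a) \<Longrightarrow>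
    aval M e2 s = Some v \<Longrightarrow>
    exec M (Store a e1 e2) s (acost e1 + acost e2 + 1)
      (fst s, (snd s)(a := (snd s a)[nat i := v]))"
| Alloc: "aval M e s = Some l \<Longrightarrow> 0 \<le> l \<Longrightarrow>
    exec M (Alloc a e) s (acost e + nat l + 1) (fst s, (snd s)(a := replicate (nat l) 0))"
| Seq: "exec M P1 s t1 s' \<Longrightarrow> exec M P2 s' t2 s'' \<Longrightarrow> exec M (Seq P1 P2) s (t1 + t2) s''"
| IfTrue: "bval M b s = Some True \<Longrightarrow> exec M P1 s t s' \<Longrightarrow>
    exec M (If b P1 P2) s (bcost b + t + 1) s'"
| IfFalse: "bval M b s = Some False \<Longrightarrow> exec M P2 s t s' \<Longrightarrow>
    exec M (If b P1 P2) s (bcost b + t + 1) s'"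
| WhileFalse: "bval M b s = Some False \<Longrightarrow> exec M (While b P) s (bcost b + 1) s"
| WhileTrue: "bval M b s = Some True \<Longrightarrow> exec M P s t1 s' \<Longrightarrow>
    exec M (While b P) s' t2 s'' \<Longrightarrow> exec M (While b P) s (bcost b + t1 + t2 + 1) s''"

text \<open>Words have \<open>O(log n + log W)\<close> bits, where \<open>W\<close> is the largest integer in the list \<open>xs\<close> of
  integers making up the input; the constant \<open>w\<close> in front may depend on the program.\<close>

definition max_word :: "nat \<Rightarrow> nat \<Rightarrow> int list \<Rightarrow> int" where
  "max_word w n xs = (int n + 2 + Max (insert 0 (abs ` set xs))) ^ w"

text \<open>Since \<open>0\<close> does not belong to \<^term>\<open>Rplus\<close>, the integer \<open>0\<close> (respectively the mantissa \<open>0\<close>)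
  is used to represent \<open>\<infinity>\<close>. Floating-point numbers are pairs of mantissa and exponent.\<close>

definition int_value :: "int \<Rightarrow> ereal" where
  "int_value a = (if a = 0 then \<infinity> else ereal (of_int a))"

definition fp_real :: "int \<times> int \<Rightarrow> real" where
  "fp_real x = of_int (fst x) * 2 powi (snd x)"

definition fp_value :: "int \<times> int \<Rightarrow> ereal" where
  "fp_value x = (if fst x = 0 then \<infinity> else ereal (fp_real x))"

text \<open>Input: \<open>n\<close> in register 0, \<open>\<epsilon>\<close> (as a floating-point number) in registers 1 and 2, mantissas
  and exponents of \<open>A\<close> in arrays 0 and 1, of \<open>B\<close> in arrays 2 and 3. Output: mantissas and
  exponents in arrays 4 and 5. All other registers are initially 0, all other arrays empty.\<close>

definition approx_input ::
  "(int \<times> int) list \<Rightarrow> (int \<times> int) list \<Rightarrow> int \<times> int \<Rightarrow> state" where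
  "approx_input A B \<epsilon> =
     ((\<lambda>_. 0)(0 := int (length A), 1 := fst \<epsilon>, 2 := snd \<epsilon>),
      (\<lambda>_. [])(0 := map fst A, 1 := map snd A, 2 := map fst B, 3 := map snd B))"

text \<open>Machine words are also long enough to hold \<open>1/\<epsilon>\<close>, as running times may be polynomial in it.\<close>

definition approx_max_word ::
  "nat \<Rightarrow> (int \<times> int) list \<Rightarrow> (int \<times> int) list \<Rightarrow> int \<times> int \<Rightarrow> int" where
  "approx_max_word w A B \<epsilon> =
     max_word w (length A)
       (map fst A @ map snd A @ map fst B @ map snd B @ [fst \<epsilon>, snd \<epsilon>, \<lceil>1 / fp_real \<epsilon>\<rceil>])"

definition is_approx_min_plus_conv ::
  "real \<Rightarrow> ereal list \<Rightarrow> ereal list \<Rightarrow> ereal list \<Rightarrow> bool" where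
  "is_approx_min_plus_conv \<epsilon> A B C \<longleftrightarrow>
     length C = length A + length B - 1 \<and>
     (\<forall>k < length C. min_plus_conv A B k \<le> C ! k \<and>
                     C ! k \<le> ereal (1 + \<epsilon>) * min_plus_conv A B k)"

text \<open>A single program has to handle all \<open>n\<close>, \<open>\<epsilon>\<close> and inputs; the time bound \<open>T\<close> depends on
  \<open>n\<close> and \<open>\<epsilon>\<close> only.\<close>

definition approx_min_plus_solvable_in :: "(nat \<Rightarrow> real \<Rightarrow> real) \<Rightarrow> bool" where
  "approx_min_plus_solvable_in T \<longleftrightarrow>
     (\<exists>P w. \<forall>n A B \<epsilon>.
        1 \<le> n \<and> length A = n \<and> length B = n \<and>
        fp_value ` set A \<subseteq> Rplus \<and> fp_value ` set B \<subseteq> Rplus \<and> 0 < fp_real \<epsilon> \<longrightarrow>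
        (\<exists>t regs arrs.
           exec (approx_max_word w A B \<epsilon>) P (approx_input A B \<epsilon>) t (regs, arrs) \<and>
           real t \<le> T n (fp_real \<epsilon>) \<and>
           length (arrs 4) = length (arrs 5) \<and>
           is_approx_min_plus_conv (fp_real \<epsilon>) (map fp_value A) (map fp_value B)
             (map fp_value (zip (arrs 4) (arrs 5)))))"

text \<open>Input: \<open>n\<close> in register 0, \<open>A\<close> and \<open>B\<close> in arrays 0 and 1. Output: array 2.\<close>

definition exact_input :: "int list \<Rightarrow> int list \<Rightarrow> state" where
  "exact_input A B =
     ((\<lambda>_. 0)(0 := int (length A)), (\<lambda>_. [])(0 := A, 1 := B))"

definition is_min_max_conv :: "ereal list \<Rightarrow> ereal list \<Rightarrow> ereal list \<Rightarrow> bool" where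
  "is_min_max_conv A B C \<longleftrightarrow>
     length C = length A + length B - 1 \<and> (\<forall>k < length C. C ! k = min_max_conv A B k)"

definition min_max_solvable_in :: "(nat \<Rightarrow> real) \<Rightarrow> bool" where
  "min_max_solvable_in T \<longleftrightarrow>
     (\<exists>P w. \<forall>n A B.
        1 \<le> n \<and> length A = n \<and> length B = n \<and>
        int_value ` set A \<subseteq> Rplus \<and> int_value ` set B \<subseteq> Rplus \<longrightarrow>
        (\<exists>t regs arrs.
           exec (max_word w n (A @ B)) P (exact_input A B) t (regs, arrs) \<and>
           real t \<le> T n \<and>
           is_min_max_conv (map int_value A) (map int_value B) (map int_value (arrs 2))))"

text \<open>The additive constant 2 keeps the logarithms at least 1.\<close>

definition soft_O :: "(nat \<Rightarrow> real) \<Rightarrow> (nat \<Rightarrow> real) \<Rightarrow> bool" where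
  "soft_O f g \<longleftrightarrow>
     (\<exists>K l :: nat. \<forall>n \<ge> 1. f n \<le> real K * g n * log 2 (real n + 2) ^ l)"

definition soft_O_eps :: "(nat \<Rightarrow> real \<Rightarrow> real) \<Rightarrow> (nat \<Rightarrow> real \<Rightarrow> real) \<Rightarrow> bool" where
  "soft_O_eps f g \<longleftrightarrow>
     (\<exists>K l :: nat. \<forall>n \<ge> 1. \<forall>\<epsilon> > 0.
        f n \<epsilon> \<le> real K * g n \<epsilon> * (log 2 (real n + 2) * log 2 (1 / \<epsilon> + 2)) ^ l)"

end

theory Submission
  imports Defs
begin

text \<open>From min-max to approximate min-plus: for positive \<open>x, y\<close> the sum \<open>x + y\<close> is the minimum of
  \<open>max (x / t) (y / (1 - t))\<close> over \<open>0 < t < 1\<close>, and every such maximum is an upper bound for it. A grid of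
  \<open>O(1 / \<epsilon>)\<close> values \<open>t = l / G\<close> attains the minimum up to a factor \<open>1 + \<epsilon>\<close>. All grid values are handled
  by one convolution: the scaled copies of \<open>A\<close> and of \<open>B\<close> are laid out in blocks of length \<open>2n\<close>, those of \<open>B\<close>
  in reverse order, so that exactly the matching copies meet in one window of the output. The
  floating-point numbers are replaced by their ranks, computed by a tournament sort, which keeps
  the number of operations independent of their size.

  From approximate min-plus to min-max: replace \<open>a\<close> by \<open>2 ^ (c * a)\<close>, which as a floating-point number
  has mantissa 1 and exponent \<open>c * a\<close>, and use \<open>\<epsilon> = 1\<close>. For a spread \<open>c\<close> larger than the word length the
  result can be read off the exponents of the output.\<close>

section \<open>Reasoning about programs\<close>

text \<open>Each reduction calls the given program as a subroutine, and the obstacle is its word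
  limit. Towards min-plus, ranks are monotone in the values, which is all that a min-max convolution
  depends on, and they are at most the number of items. So the subroutine works with words
  polynomial in \<open>n\<close> and \<open>1 / \<epsilon>\<close>, whatever the exponents in the
  input. The factors \<open>1 / t\<close> are rounded up to multiples of \<open>1 / F\<close>, where
  \<open>F\<close> is a power of two: rounding up keeps every maximum an upper bound for the sum,
  and dividing by \<open>F\<close> at the end only changes an exponent. Towards min-max, the choice
  of the spread looks circular: it must exceed the bit length of all words the subroutine may
  output, while these words grow with the spread, which is part of its input. The words are only
  polynomial in the spread, so their bit length is logarithmic in it. A spread linear in
  \<open>n\<close> plus the largest input number therefore suffices, with a constant factor
  depending on the program. The result must be decoded from exponents because an output mantissa can
  be any positive word and is not normalised.\<close>

fun opv :: "binop \<Rightarrow> int \<Rightarrow> int \<Rightarrow> int" where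
  "opv Plus x y = x + y"
| "opv Minus x y = x - y"
| "opv Times x y = x * y"
| "opv Div x y = x div y"
| "opv Mod x y = x mod y"
| "opv Shl x y = x * 2 ^ nat y"
| "opv Shr x y = x div 2 ^ nat y"

fun opok :: "binop \<Rightarrow> int \<Rightarrow> bool" where
  "opok Plus y = True"
| "opok Minus y = True"
| "opok Times y = True"
| "opok Div y = (y \<noteq> 0)"
| "opok Mod y = (y \<noteq> 0)"
| "opok Shl y = (0 \<le> y)"
| "opok Shr y = (0 \<le> y)"

lemma arith_eq: "arith f x y = (if opok f y then Some (opv f x y) else None)"
  by (cases f) auto

text \<open>Evaluation is split into a total function and the predicate \<open>ok\<close>, which
  collects all error conditions. Verification conditions then contain no \<open>option\<close> and
  can be discharged by rewriting and arithmetic.\<close>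

fun ev :: "aexp \<Rightarrow> state \<Rightarrow> int" where
  "ev (N v) s = v"
| "ev (V x) s = fst s x"
| "ev (Get a e) s = snd s a ! nat (ev e s)"
| "ev (Bin f e1 e2) s = opv f (ev e1 s) (ev e2 s)"

fun ok :: "int \<Rightarrow> aexp \<Rightarrow> state \<Rightarrow> bool" where
  "ok M (N v) s = (\<bar>v\<bar> \<le> M)"
| "ok M (V x) s = True"
| "ok M (Get a e) s = (ok M e s \<and> 0 \<le> ev e s \<and> nat (ev e s) < length (snd s a))"
| "ok M (Bin f e1 e2) s =
     (ok M e1 s \<and> ok M e2 s \<and> opok f (ev e2 s) \<and> \<bar>opv f (ev e1 s) (ev e2 s)\<bar> \<le> M)"

lemma aval_eq: "aval M e s = (if ok M e s then Some (ev e s) else None)"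
  by (induction e) (auto simp: fit_def arith_eq)

fun bev :: "bexp \<Rightarrow> state \<Rightarrow> bool" where
  "bev (Less e1 e2) s = (ev e1 s < ev e2 s)"
| "bev (Not b) s = (\<not> bev b s)"
| "bev (And b1 b2) s = (bev b1 s \<and> bev b2 s)"

fun bok :: "int \<Rightarrow> bexp \<Rightarrow> state \<Rightarrow> bool" where
  "bok M (Less e1 e2) s = (ok M e1 s \<and> ok M e2 s)"
| "bok M (Not b) s = bok M b s"
| "bok M (And b1 b2) s = (bok M b1 s \<and> (bev b1 s \<longrightarrow> bok M b2 s))"

lemma bval_eq: "bval M b s = (if bok M b s then Some (bev b s) else None)"
  by (induction b) (auto simp: aval_eq)

definition runs :: "int \<Rightarrow> com \<Rightarrow> state \<Rightarrow> nat \<Rightarrow> (state \<Rightarrow> bool) \<Rightarrow> bool" where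
  "runs M P s T Q \<longleftrightarrow> (\<exists>t s'. exec M P s t s' \<and> t \<le> T \<and> Q s')"

fun wregs :: "com \<Rightarrow> nat set" where
  "wregs Skip = {}"
| "wregs (Assign x e) = {x}"
| "wregs (Store a e1 e2) = {}"
| "wregs (Alloc a e) = {}"
| "wregs (Seq P1 P2) = wregs P1 \<union> wregs P2"
| "wregs (If b P1 P2) = wregs P1 \<union> wregs P2"
| "wregs (While b P) = wregs P"

fun warrs :: "com \<Rightarrow> nat set" where
  "warrs Skip = {}"
| "warrs (Assign x e) = {}"
| "warrs (Store a e1 e2) = {a}"
| "warrs (Alloc a e) = {a}"
| "warrs (Seq P1 P2) = warrs P1 \<union> warrs P2"
| "warrs (If b P1 P2) = warrs P1 \<union> warrs P2"
| "warrs (While b P) = warrs P"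

definition frame :: "com \<Rightarrow> state \<Rightarrow> state \<Rightarrow> bool" where
  "frame P s s' \<longleftrightarrow>
     (\<forall>x. x \<notin> wregs P \<longrightarrow> fst s' x = fst s x) \<and> (\<forall>a. a \<notin> warrs P \<longrightarrow> snd s' a = snd s a)"

lemma exec_frame: "exec M P s t s' \<Longrightarrow> frame P s s'"
  by (induction rule: exec.induct) (auto simp: frame_def)

lemma frame_reg: "frame P s s' \<Longrightarrow> x \<notin> wregs P \<Longrightarrow> fst s' x = fst s x"
  and frame_arr: "frame P s s' \<Longrightarrow> a \<notin> warrs P \<Longrightarrow> snd s' a = snd s a"
  by (auto simp: frame_def)

text \<open>The frame of the run is handed to the premise, so postconditions list only what a
  program changes. The rest is recovered from the sets of written registers and arrays.\<close>

lemma runs_mono: "runs M P s T Q \<Longrightarrow> T \<le> T' \<Longrightarrow> (\<And>s'. Q s' \<Longrightarrow> frame P s s' \<Longrightarrow> Q' s') \<Longrightarrow> runs M P s T' Q'"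
  unfolding runs_def by (meson exec_frame le_trans)

lemma runs_Seq:
  assumes "runs M P1 s T1 R" "\<And>s'. R s' \<Longrightarrow> frame P1 s s' \<Longrightarrow> runs M P2 s' T2 Q"
  shows "runs M (Seq P1 P2) s (T1 + T2) Q"
  using assms unfolding runs_def by (meson add_mono exec.Seq exec_frame)

lemma runs_Alloc:
  assumes "ok M e s" "0 \<le> ev e s" "acost e + nat (ev e s) + 1 \<le> T"
    "Q (fst s, (snd s)(a := replicate (nat (ev e s)) 0))"
  shows "runs M (Alloc a e) s T Q"
proof -
  have "exec M (Alloc a e) s (acost e + nat (ev e s) + 1) (fst s, (snd s)(a := replicate (nat (ev e s)) 0))"
    by (rule exec.Alloc) (use assms in \<open>auto simp: aval_eq\<close>)
  then show ?thesis unfolding runs_def using assms by blast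
qed

text \<open>Only for commands without loops and allocations: \<open>wp\<close> is false on all others, so that the
  value 0 of \<open>scost\<close> on them is never used.\<close>

fun wp :: "int \<Rightarrow> com \<Rightarrow> (state \<Rightarrow> bool) \<Rightarrow> state \<Rightarrow> bool" where
  "wp M Skip Q s = Q s"
| "wp M (Assign x e) Q s = (ok M e s \<and> Q ((fst s)(x := ev e s), snd s))"
| "wp M (Store a e1 e2) Q s =
     (ok M e1 s \<and> 0 \<le> ev e1 s \<and> nat (ev e1 s) < length (snd s a) \<and> ok M e2 s \<and>
      Q (fst s, (snd s)(a := (snd s a)[nat (ev e1 s) := ev e2 s])))"
| "wp M (Alloc a e) Q s = False"
| "wp M (Seq P1 P2) Q s = wp M P1 (wp M P2 Q) s"
| "wp M (If b P1 P2) Q s = (bok M b s \<and> (if bev b s then wp M P1 Q s else wp M P2 Q s))"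
| "wp M (While b P) Q s = False"

fun scost :: "com \<Rightarrow> nat" where
  "scost Skip = 1"
| "scost (Assign x e) = acost e + 1"
| "scost (Store a e1 e2) = acost e1 + acost e2 + 1"
| "scost (Alloc a e) = 0"
| "scost (Seq P1 P2) = scost P1 + scost P2"
| "scost (If b P1 P2) = bcost b + scost P1 + scost P2 + 1"
| "scost (While b P) = 0"

lemma runs_scost: "wp M P Q s \<Longrightarrow> runs M P s (scost P) Q"
proof (induction P arbitrary: s Q)
  case Skip
  then show ?case unfolding runs_def by (intro exI[of _ 1] exI[of _ s]) (simp add: exec.Skip[simplified])
next
  case (Assign x e)
  then show ?case unfolding runs_def
    using exec.Assign[of M e s "ev e s" x]
    by (intro exI[of _ "acost e + 1"] exI[of _ "((fst s)(x := ev e s), snd s)"]) (simp add: aval_eq)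
next
  case (Store a e1 e2)
  then show ?case unfolding runs_def
    using exec.Store[of M e1 s "ev e1 s" a e2 "ev e2 s"]
    by (intro exI[of _ "acost e1 + acost e2 + 1"]
        exI[of _ "(fst s, (snd s)(a := (snd s a)[nat (ev e1 s) := ev e2 s]))"]) (simp add: aval_eq)
next
  case (Seq P1 P2)
  from Seq.prems have "wp M P1 (wp M P2 Q) s" by simp
  from Seq.IH(1)[OF this] show ?case using Seq.IH(2) by (simp, blast intro: runs_Seq)
next
  case (If b P1 P2)
  show ?case
  proof (cases "bev b s")
    case True
    then have "runs M P1 s (scost P1) Q" using If.prems by (intro If.IH) simp
    then obtain t s' where "exec M P1 s t s'" "t \<le> scost P1" "Q s'" unfolding runs_def by blast
    moreover have "bval M b s = Some True" using True If by (simp add: bval_eq)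
    ultimately have "exec M (If b P1 P2) s (bcost b + t + 1) s'" by (intro exec.IfTrue)
    then show ?thesis unfolding runs_def
      using \<open>t \<le> scost P1\<close> \<open>Q s'\<close> by (intro exI[of _ "bcost b + t + 1"] exI[of _ s']) simp
  next
    case False
    then have "runs M P2 s (scost P2) Q" using If.prems by (intro If.IH) simp
    then obtain t s' where "exec M P2 s t s'" "t \<le> scost P2" "Q s'" unfolding runs_def by blast
    moreover have "bval M b s = Some False" using False If by (simp add: bval_eq)
    ultimately have "exec M (If b P1 P2) s (bcost b + t + 1) s'" by (intro exec.IfFalse)
    then show ?thesis unfolding runs_def
      using \<open>t \<le> scost P2\<close> \<open>Q s'\<close> by (intro exI[of _ "bcost b + t + 1"] exI[of _ s']) simp
  qed
qed auto

lemma runs_wp: "wp M P Q s \<Longrightarrow> scost P \<le> T \<Longrightarrow> runs M P s T Q"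
  by (rule runs_mono[OF runs_scost]) auto

text \<open>The invariant carries a ghost iteration count \<open>i\<close>. As the guard can hold
  only while \<open>i < m\<close>, this count gives termination and the time bound at once without
  being stored by the program.\<close>

lemma runs_While:
  assumes step: "\<And>i s. I i s \<Longrightarrow> bok M b s \<and> (if bev b s then i < m \<and> runs M P s T (I (Suc i)) else Q s)"
    and init: "I 0 s"
  shows "runs M (While b P) s (m * (T + bcost b + 1) + bcost b + 1) Q"
proof -
  have "I i s \<Longrightarrow> i \<le> m \<Longrightarrow> runs M (While b P) s ((m - i) * (T + bcost b + 1) + bcost b + 1) Q" for i s
  proof (induction "m - i" arbitrary: i s)
    case 0
    then have "bval M b s = Some False" "Q s" using step[of i s] by (auto simp: bval_eq split: if_splits)
    then show ?case unfolding runs_def by (intro exI conjI, rule_tac exec.WhileFalse) auto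
  next
    case (Suc k)
    show ?case
    proof (cases "bev b s")
      case False
      then have "bval M b s = Some False" "Q s" using step[of i s] Suc by (auto simp: bval_eq)
      then show ?thesis unfolding runs_def by (intro exI conjI, rule_tac exec.WhileFalse) auto
    next
      case True
      then have b: "bval M b s = Some True" and "i < m" and "runs M P s T (I (Suc i))"
        using step[of i s] Suc by (auto simp: bval_eq)
      then obtain t1 s1 where 1: "exec M P s t1 s1" "t1 \<le> T" "I (Suc i) s1" by (auto simp: runs_def)
      have "k = m - Suc i" "Suc i \<le> m" using Suc \<open>i < m\<close> by auto
      from Suc.hyps(1)[OF this(1) 1(3) this(2)] obtain t2 s2 where
        2: "exec M (While b P) s1 t2 s2" "t2 \<le> (m - Suc i) * (T + bcost b + 1) + bcost b + 1" "Q s2"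
        by (auto simp: runs_def)
      have "m - i = Suc (m - Suc i)" using \<open>i < m\<close> by simp
      then have "bcost b + t1 + t2 + 1 \<le> (m - i) * (T + bcost b + 1) + bcost b + 1"
        using 1(2) 2(2) by simp
      then show ?thesis unfolding runs_def using exec.WhileTrue[OF b 1(1) 2(1)] 2(3) by blast
    qed
  qed
  from this[of 0 s] init show ?thesis by simp
qed

definition For :: "nat \<Rightarrow> nat \<Rightarrow> com \<Rightarrow> com" where
  "For x y P = Seq (Assign x (N 0))
     (While (Less (V x) (V y)) (Seq P (Assign x (Bin Plus (V x) (N 1)))))"

lemma wr_For [simp]: "wregs (For x y P) = insert x (wregs P)"
  and wa_For [simp]: "warrs (For x y P) = warrs P"
  by (auto simp: For_def)

text \<open>\<open>I\<close> has to ignore the counter because the loop control overwrites it. The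
  step receives the frame from the very start of the loop, so facts about data that the body never
  writes can stay out of \<open>I\<close>.\<close>

lemma runs_For:
  assumes init: "I 0 s" and y: "fst s y = int m" "x \<noteq> y" "x \<notin> wregs P" "y \<notin> wregs P"
    and M: "int m \<le> M" "1 \<le> M"
    and inv: "\<And>i s v. I i s \<Longrightarrow> I i ((fst s)(x := v), snd s)"
    and step: "\<And>i s'. i < m \<Longrightarrow> I i s' \<Longrightarrow> fst s' x = int i \<Longrightarrow> frame (For x y P) s s' \<Longrightarrow>
      runs M P s' T (I (Suc i))"
  shows "runs M (For x y P) s (m * (T + 8) + 8) (I m)"
proof -
  define J where "J i s' \<longleftrightarrow> i \<le> m \<and> I i s' \<and> fst s' x = int i \<and> frame (For x y P) s s'" for i s'
  have "runs M (While (Less (V x) (V y)) (Seq P (Assign x (Bin Plus (V x) (N 1)))))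
     ((fst s)(x := 0), snd s) (m * ((T + 4) + bcost (Less (V x) (V y)) + 1) + bcost (Less (V x) (V y)) + 1) (I m)"
  proof (rule runs_While[of J])
    show "J 0 ((fst s)(x := 0), snd s)" using init inv by (auto simp: J_def frame_def)
    fix i s' assume J: "J i s'"
    have y': "fst s' y = int m" using J y by (auto simp: J_def frame_def)
    show "bok M (Less (V x) (V y)) s' \<and>
           (if bev (Less (V x) (V y)) s'
            then i < m \<and> runs M (Seq P (Assign x (Bin Plus (V x) (N 1)))) s' (T + 4) (J (Suc i)) else I m s')"
    proof (cases "i < m")
      case True
      have "runs M P s' T (I (Suc i))" using step[OF True] J by (auto simp: J_def)
      then have "runs M (Seq P (Assign x (Bin Plus (V x) (N 1)))) s' (T + 4) (J (Suc i))"
      proof (rule runs_Seq)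
        fix s'' assume *: "I (Suc i) s''" "frame P s' s''"
        have "fst s'' x = int i" using J * y by (auto simp: J_def frame_def)
        then show "runs M (Assign x (Bin Plus (V x) (N 1))) s'' 4 (J (Suc i))"
          using J * y M True inv by (intro runs_wp) (auto simp: J_def frame_def add.commute)
      qed
      then show ?thesis using True J y' by (auto simp: J_def)
    next
      case False
      then show ?thesis using J y' by (auto simp: J_def)
    qed
  qed
  \<comment> \<open>Each round pays 4 for the increment, 3 for the guard and 1 for the loop rule.
    The initial assignment and the final failing guard cost 2 + 4, rounded up to 8.\<close>
  then have "runs M (For x y P) s (2 + (m * ((T + 4) + 3 + 1) + 3 + 1)) (I m)"
    unfolding For_def
    by (intro runs_Seq[where R = "\<lambda>s'. s' = ((fst s)(x := 0), snd s)"], intro runs_wp)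
      (use M in \<open>auto simp: numeral_eq_Suc\<close>)
  then show ?thesis by (rule runs_mono) (auto simp: algebra_simps)
qed

section \<open>Relocating a program so that it can run as a subroutine\<close>

fun shift_aexp :: "nat \<Rightarrow> aexp \<Rightarrow> aexp" where
  "shift_aexp K (N v) = N v"
| "shift_aexp K (V x) = V (x + K)"
| "shift_aexp K (Get a e) = Get (a + K) (shift_aexp K e)"
| "shift_aexp K (Bin f e1 e2) = Bin f (shift_aexp K e1) (shift_aexp K e2)"

fun shift_bexp :: "nat \<Rightarrow> bexp \<Rightarrow> bexp" where
  "shift_bexp K (Less e1 e2) = Less (shift_aexp K e1) (shift_aexp K e2)"
| "shift_bexp K (Not b) = Not (shift_bexp K b)"
| "shift_bexp K (And b1 b2) = And (shift_bexp K b1) (shift_bexp K b2)"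

fun shift :: "nat \<Rightarrow> com \<Rightarrow> com" where
  "shift K Skip = Skip"
| "shift K (Assign x e) = Assign (x + K) (shift_aexp K e)"
| "shift K (Store a e1 e2) = Store (a + K) (shift_aexp K e1) (shift_aexp K e2)"
| "shift K (Alloc a e) = Alloc (a + K) (shift_aexp K e)"
| "shift K (Seq P1 P2) = Seq (shift K P1) (shift K P2)"
| "shift K (If b P1 P2) = If (shift_bexp K b) (shift K P1) (shift K P2)"
| "shift K (While b P) = While (shift_bexp K b) (shift K P)"

text \<open>Seen from index \<open>K\<close> upwards, the state of the caller is the state of the
  subroutine. Everything below \<open>K\<close> is private memory of the caller, whose contents are
  left open.\<close>

definition embeds :: "nat \<Rightarrow> state \<Rightarrow> state \<Rightarrow> bool" where
  "embeds K s s2 \<longleftrightarrow> (\<forall>x. fst s2 (x + K) = fst s x) \<and> (\<forall>a. snd s2 (a + K) = snd s a)"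

lemma acost_shift_aexp [simp]: "acost (shift_aexp K e) = acost e"
  by (induction e) auto

lemma bcost_shift_bexp [simp]: "bcost (shift_bexp K e) = bcost e"
  by (induction e) auto

lemma ev_shift_aexp: "embeds K s s2 \<Longrightarrow> ev (shift_aexp K e) s2 = ev e s"
  by (induction e) (auto simp: embeds_def)

lemma ok_shift_aexp: "embeds K s s2 \<Longrightarrow> M \<le> M' \<Longrightarrow> ok M e s \<Longrightarrow> ok M' (shift_aexp K e) s2"
proof (induction e)
  case (Get a e)
  then have "ev (shift_aexp K e) s2 = ev e s" "snd s2 (a + K) = snd s a"
    by (auto simp: ev_shift_aexp embeds_def)
  with Get show ?case by simp
next
  case (Bin f e1 e2)
  then have "ev (shift_aexp K e1) s2 = ev e1 s" "ev (shift_aexp K e2) s2 = ev e2 s" by (auto simp: ev_shift_aexp)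
  with Bin show ?case by simp
qed auto

lemma bev_shift_bexp: "embeds K s s2 \<Longrightarrow> bev (shift_bexp K e) s2 = bev e s"
  by (induction e) (auto simp: ev_shift_aexp)

lemma bok_shift_bexp: "embeds K s s2 \<Longrightarrow> M \<le> M' \<Longrightarrow> bok M e s \<Longrightarrow> bok M' (shift_bexp K e) s2"
  by (induction e) (auto simp: ok_shift_aexp bev_shift_bexp)

lemma wr_shift: "wregs (shift K P) \<subseteq> {K..}" and wa_shift: "warrs (shift K P) \<subseteq> {K..}"
  by (induction P) auto

text \<open>The word limit enters a run only through \<open>ok\<close> and \<open>bok\<close>, which
  are monotone in it. So a run that succeeds under \<open>M\<close> is repeated step by step, and at
  the same cost, under any larger limit.\<close>

lemma exec_shift:
  assumes "exec M P s t s'" "embeds K s s2" "M \<le> M'"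
  shows "\<exists>s2'. exec M' (shift K P) s2 t s2' \<and> embeds K s' s2'"
  using assms(1,2)
proof (induction arbitrary: s2 rule: exec.induct)
  case (Skip s)
  then show ?case using exec.Skip[of M' s2] by (intro exI[of _ s2]) simp
next
  case (Assign e s v x)
  then have "aval M' (shift_aexp K e) s2 = Some v"
    using ok_shift_aexp[OF Assign(2) assms(3), of e] by (auto simp: aval_eq ev_shift_aexp split: if_splits)
  from exec.Assign[OF this, of "x + K"] Assign(2) show ?case
    by (intro exI[of _ "((fst s2)(x + K := v), snd s2)"]) (simp add: embeds_def)
next
  case (Store e1 s i a e2 v)
  then have "aval M' (shift_aexp K e1) s2 = Some i" "aval M' (shift_aexp K e2) s2 = Some v"
    using ok_shift_aexp[OF Store(5) assms(3)] by (auto simp: aval_eq ev_shift_aexp split: if_splits)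
  from exec.Store[OF this(1) _ _ this(2), of "a + K"] Store show ?case
    by (intro exI[of _ "(fst s2, (snd s2)(a + K := (snd s2 (a + K))[nat i := v]))"])
      (simp add: embeds_def)
next
  case (Alloc e s l a)
  then have "aval M' (shift_aexp K e) s2 = Some l"
    using ok_shift_aexp[OF Alloc(3) assms(3), of e] by (auto simp: aval_eq ev_shift_aexp split: if_splits)
  from exec.Alloc[OF this, of "a + K"] Alloc show ?case
    by (intro exI[of _ "(fst s2, (snd s2)(a + K := replicate (nat l) 0))"]) (simp add: embeds_def)
next
  case (Seq P1 s t1 s' P2 t2 s'')
  then obtain s3 where 3: "exec M' (shift K P1) s2 t1 s3" "embeds K s' s3" by blast
  with Seq obtain s4 where "exec M' (shift K P2) s3 t2 s4" "embeds K s'' s4" by blast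
  with 3 show ?case using exec.Seq[OF 3(1)] by (intro exI[of _ s4]) simp
next
  case (IfTrue b s P1 t s' P2)
  then have "bval M' (shift_bexp K b) s2 = Some True"
    using bok_shift_bexp[OF IfTrue(4) assms(3), of b] by (auto simp: bval_eq bev_shift_bexp split: if_splits)
  moreover from IfTrue obtain s3 where "exec M' (shift K P1) s2 t s3" "embeds K s' s3" by blast
  ultimately show ?case using exec.IfTrue[of M' "shift_bexp K b" s2 "shift K P1" t s3 "shift K P2"]
    by (intro exI[of _ s3]) simp
next
  case (IfFalse b s P2 t s' P1)
  then have "bval M' (shift_bexp K b) s2 = Some False"
    using bok_shift_bexp[OF IfFalse(4) assms(3), of b] by (auto simp: bval_eq bev_shift_bexp split: if_splits)
  moreover from IfFalse obtain s3 where "exec M' (shift K P2) s2 t s3" "embeds K s' s3" by blast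
  ultimately show ?case using exec.IfFalse[of M' "shift_bexp K b" s2 "shift K P2" t s3 "shift K P1"]
    by (intro exI[of _ s3]) simp
next
  case (WhileFalse b s P)
  then have "bval M' (shift_bexp K b) s2 = Some False"
    using bok_shift_bexp[OF WhileFalse(2) assms(3), of b] by (auto simp: bval_eq bev_shift_bexp split: if_splits)
  with WhileFalse show ?case using exec.WhileFalse[of M' "shift_bexp K b" s2 "shift K P"]
    by (intro exI[of _ s2]) simp
next
  case (WhileTrue b s P t1 s' t2 s'')
  then have "bval M' (shift_bexp K b) s2 = Some True"
    using bok_shift_bexp[OF WhileTrue(6) assms(3), of b] by (auto simp: bval_eq bev_shift_bexp split: if_splits)
  moreover from WhileTrue obtain s3 where 3: "exec M' (shift K P) s2 t1 s3" "embeds K s' s3" by blast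
  moreover from 3 WhileTrue obtain s4 where "exec M' (shift K (While b P)) s3 t2 s4" "embeds K s'' s4"
    by blast
  ultimately show ?case
    using exec.WhileTrue[of M' "shift_bexp K b" s2 "shift K P" t1 s3 t2 s4]
    by (intro exI[of _ s4]) simp
qed

section \<open>Size of the words that a run can leave behind\<close>

definition words_bounded :: "int \<Rightarrow> state \<Rightarrow> bool" where
  "words_bounded M s \<longleftrightarrow> (\<forall>x. \<bar>fst s x\<bar> \<le> M) \<and> (\<forall>a. \<forall>v \<in> set (snd s a). \<bar>v\<bar> \<le> M)"

lemma words_bounded_ev: "words_bounded M' s \<Longrightarrow> ok M e s \<Longrightarrow> M \<le> M' \<Longrightarrow> \<bar>ev e s\<bar> \<le> M'"
  by (cases e) (auto simp: words_bounded_def dest: nth_mem)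

text \<open>Overflow being an error, a completed run says something about its output: every newly
  computed word respects the limit. Words already in memory are read and copied without a check, so
  they may exceed \<open>M\<close>; hence the second bound \<open>M'\<close>.\<close>

lemma exec_words_bounded:
  assumes "exec M P s t s'" "words_bounded M' s" "M \<le> M'"
  shows "words_bounded M' s'"
  using assms(1,2)
proof (induction rule: exec.induct)
  case (Assign e s v x)
  then show ?case using words_bounded_ev[of M' s M e] assms(3)
    by (auto simp: words_bounded_def aval_eq split: if_splits)
next
  case (Store e1 s i a e2 v)
  then have "\<bar>v\<bar> \<le> M'" using words_bounded_ev[of M' s M e2] assms(3) by (auto simp: aval_eq split: if_splits)
  then show ?case using Store set_update_subset_insert[of "snd s a" "nat i" v]
    by (auto simp: words_bounded_def)
next
  case (Alloc e s l a)
  have "0 \<le> M'" using Alloc(3) by (auto simp: words_bounded_def intro: order_trans[OF abs_ge_zero])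
  then show ?case using Alloc by (auto simp: words_bounded_def)
qed auto

section \<open>Sorting floating-point numbers\<close>

lemma le_div_iff_mult_le:
  fixes a b c :: int
  assumes "0 < c"
  shows "a \<le> b div c \<longleftrightarrow> a * c \<le> b"
proof
  assume "a \<le> b div c"
  then have "a * c \<le> b div c * c" using assms by simp
  also have "\<dots> \<le> b" using assms by (simp add: minus_mod_eq_div_mult[symmetric])
  finally show "a * c \<le> b" .
next
  assume "a * c \<le> b"
  then have "a * c div c \<le> b div c" using assms by (rule zdiv_mono1)
  then show "a \<le> b div c" using assms by simp
qed

text \<open>Aligning the exponents would shift \<open>mb\<close> to the left and might overflow, so
  the other mantissa is shifted to the right. Floor division is exact for conditions of the form
  \<open>mb * 2 ^ d \<le> z\<close>, and subtracting 1 is what turns the negation of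
  \<open>ma \<le> mb * 2 ^ d\<close> into this form.\<close>

lemma fp_le_iff_less:
  assumes "ea < eb"
  shows "fp_real (ma, ea) \<le> fp_real (mb, eb) \<longleftrightarrow> (ma - 1) div 2 ^ nat (eb - ea) < mb"
proof -
  define d where "d = nat (eb - ea)"
  have "eb = ea + int d" using assms by (simp add: d_def)
  then have "(2::real) powi eb = 2 powi ea * 2 ^ d" by (simp add: power_int_add)
  then have "fp_real (ma, ea) \<le> fp_real (mb, eb) \<longleftrightarrow> real_of_int ma * 2 powi ea \<le> (of_int mb * 2 ^ d) * 2 powi ea"
    by (simp add: fp_real_def mult_ac)
  also have "\<dots> \<longleftrightarrow> real_of_int ma \<le> real_of_int (mb * 2 ^ d)"
    by (subst mult_le_cancel_right_pos) auto
  also have "\<dots> \<longleftrightarrow> ma - 1 < mb * 2 ^ d" by (subst of_int_le_iff) auto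
  also have "\<dots> \<longleftrightarrow> (ma - 1) div 2 ^ d < mb"
    using le_div_iff_mult_le[of "2 ^ d" mb "ma - 1"] by (simp add: not_le[symmetric])
  finally show ?thesis by (simp add: d_def)
qed

text \<open>Here the inequality has the factor \<open>2 ^ d\<close> on its smaller side, so floor
  division applies without a correction by 1.\<close>

lemma fp_le_iff_ge:
  assumes "eb \<le> ea"
  shows "fp_real (ma, ea) \<le> fp_real (mb, eb) \<longleftrightarrow> ma \<le> mb div 2 ^ nat (ea - eb)"
proof -
  define d where "d = nat (ea - eb)"
  have "ea = eb + int d" using assms by (simp add: d_def)
  then have "(2::real) powi ea = 2 powi eb * 2 ^ d" by (simp add: power_int_add)
  then have "fp_real (ma, ea) \<le> fp_real (mb, eb) \<longleftrightarrow> (real_of_int ma * 2 ^ d) * 2 powi eb \<le> of_int mb * 2 powi eb"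
    by (simp add: fp_real_def mult_ac)
  also have "\<dots> \<longleftrightarrow> real_of_int (ma * 2 ^ d) \<le> real_of_int mb"
    by (subst mult_le_cancel_right_pos) auto
  also have "\<dots> \<longleftrightarrow> ma * 2 ^ d \<le> mb" by (subst of_int_le_iff) auto
  also have "\<dots> \<longleftrightarrow> ma \<le> mb div 2 ^ d"
    by (simp add: le_div_iff_mult_le)
  finally show ?thesis by (simp add: d_def)
qed

lemma abs_div_le_abs:
  fixes x d :: int
  assumes "0 < d"
  shows "\<bar>x div d\<bar> \<le> \<bar>x\<bar>"
proof (cases "0 \<le> x")
  case True
  then show ?thesis using zdiv_mono2[of x 1 d] assms by (simp add: pos_imp_zdiv_nonneg_iff)
next
  case False
  have "x * d \<le> x * 1" using False assms by (intro mult_left_mono_neg) auto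
  then have "x \<le> x div d" using assms by (simp add: le_div_iff_mult_le)
  moreover have "x div d < 0" using False assms le_div_iff_mult_le[of d 0 x] by auto
  ultimately show ?thesis by simp
qed

text \<open>Tournament trees: the leaf of item \<open>p\<close> is node \<open>q + p\<close>, the children of \<open>u\<close> are \<open>2u\<close> and
  \<open>2u + 1\<close>, the root is node 1. An item is removed from the tournament by giving it a positive rank.\<close>

definition item_val :: "int list \<Rightarrow> int list \<Rightarrow> int \<Rightarrow> real" where
  "item_val Zm Ze a = fp_real (Zm ! nat a, Ze ! nat a)"

text \<open>A total preorder: the items still in the tournament are ordered by value, and all
  removed items come last, equivalent to each other.\<close>

definition beats :: "int list \<Rightarrow> int list \<Rightarrow> int list \<Rightarrow> int \<Rightarrow> int \<Rightarrow> bool" where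
  "beats Zm Ze R a b \<longleftrightarrow>
     0 < R ! nat b \<or> \<not> 0 < R ! nat a \<and> item_val Zm Ze a \<le> item_val Zm Ze b"

text \<open>\<open>(q + item) div 2 ^ j = u\<close> says that \<open>u\<close> is an ancestor of the
  leaf of the item, so a node can only hold an item from its own subtree. This confines the effect
  of a removal to one path. \<open>lo\<close> is the smallest node computed so far; the tree is
  filled from the leaves downwards in node number.\<close>

definition tree :: "nat \<Rightarrow> nat \<Rightarrow> int list \<Rightarrow> bool" where
  "tree q lo Tr \<longleftrightarrow> length Tr = 2 * q \<and>
     (\<forall>u \<in> {lo..<2 * q}. 0 \<le> Tr ! u \<and> Tr ! u < int q \<and> (\<exists>j. (q + nat (Tr ! u)) div 2 ^ j = u))"

definition good :: "int list \<Rightarrow> int list \<Rightarrow> int list \<Rightarrow> int list \<Rightarrow> nat \<Rightarrow> bool" where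
  "good Zm Ze R Tr u \<longleftrightarrow> beats Zm Ze R (Tr ! u) (Tr ! (2 * u)) \<and> beats Zm Ze R (Tr ! u) (Tr ! (2 * u + 1))"

lemma beats_refl: "beats Zm Ze R a a" by (auto simp: beats_def)

lemma beats_trans: "beats Zm Ze R a b \<Longrightarrow> beats Zm Ze R b c \<Longrightarrow> beats Zm Ze R a c"
  by (auto simp: beats_def)

lemma root_beats:
  assumes "tree q 1 Tr" "\<And>u. 1 \<le> u \<Longrightarrow> u < q \<Longrightarrow> good Zm Ze R Tr u" "1 \<le> u" "u < 2 * q"
  shows "beats Zm Ze R (Tr ! 1) (Tr ! u)"
  using assms(3,4)
proof (induction u rule: less_induct)
  case (less u)
  show ?case
  proof (cases "u = 1")
    case False
    then have *: "1 \<le> u div 2" "u div 2 < q" "u div 2 < u" "u div 2 < 2 * q" using less.prems by auto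
    have "u = 2 * (u div 2) \<or> u = 2 * (u div 2) + 1" by presburger
    then have "beats Zm Ze R (Tr ! (u div 2)) (Tr ! u)"
      using assms(2)[OF *(1,2)] unfolding good_def by metis
    then show ?thesis using less.IH[OF *(3,1,4)] beats_trans by blast
  qed (simp add: beats_refl)
qed

text \<open>A leaf is its own only descendant: halving a number below \<open>2 * q\<close> gives a
  number below \<open>q\<close>, which is not a leaf. So the exponent \<open>j\<close> must be
  0.\<close>

lemma tree_leaf:
  assumes "tree q lo Tr" "lo \<le> q + p" "p < q"
  shows "Tr ! (q + p) = int p"
proof -
  obtain j where j: "0 \<le> Tr ! (q + p)" "Tr ! (q + p) < int q" "(q + nat (Tr ! (q + p))) div 2 ^ j = q + p"
    using assms unfolding tree_def by fastforce
  show ?thesis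
  proof (cases j)
    case 0
    then show ?thesis using j by simp
  next
    case (Suc i)
    have "(q + nat (Tr ! (q + p))) div 2 ^ j \<le> (q + nat (Tr ! (q + p))) div 2"
      unfolding Suc by (simp add: div_mult2_eq div_le_mono)
    also have "\<dots> < q" using j by linarith
    finally show ?thesis using j by simp
  qed
qed

lemma tree_update:
  assumes "tree q (Suc v) Tr" "1 \<le> v" "v < q" "c = Tr ! (2 * v) \<or> c = Tr ! (2 * v + 1)"
  shows "tree q v (Tr[v := c])"
proof -
  obtain w where w: "c = Tr ! w" "w = 2 * v \<or> w = 2 * v + 1" using assms by auto
  then have "w \<in> {Suc v..<2 * q}" using assms by auto
  then obtain j where j: "0 \<le> c" "c < int q" "(q + nat c) div 2 ^ j = w"
    using assms(1) w unfolding tree_def by blast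
  then have "(q + nat c) div 2 ^ Suc j = v" using w(2) by (simp only: power_Suc2 div_mult2_eq) auto
  then have "0 \<le> Tr[v := c] ! v \<and> Tr[v := c] ! v < int q \<and> (\<exists>j. (q + nat (Tr[v := c] ! v)) div 2 ^ j = v)"
    using j assms by (simp add: tree_def del: power_Suc) blast
  then show ?thesis using assms(1) unfolding tree_def
    by (auto simp: nth_list_update Suc_le_eq)
qed

lemma tree_anti_mono: "tree q lo Tr \<Longrightarrow> lo \<le> lo' \<Longrightarrow> tree q lo' Tr"
  unfolding tree_def by auto

text \<open>Register 8 holds the number of items, register 10 the node to be recomputed. Arrays 6 and 7 hold
  the mantissas and exponents of the items, array 8 the tree, array 9 the ranks (0 for items still
  in the tournament), array 10 the items in sorted order. Two numbers are compared by shifting one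
  mantissa to the right, which cannot overflow.\<close>

definition upd :: com where
  "upd =
    Seq (Assign 11 (Get 8 (Bin Times (N 2) (V 10))))
   (Seq (Assign 12 (Get 8 (Bin Plus (Bin Times (N 2) (V 10)) (N 1))))
   (Seq (If (Less (N 0) (Get 9 (V 11))) (Assign 13 (V 12))
          (If (Less (N 0) (Get 9 (V 12))) (Assign 13 (V 11))
            (If (Less (Get 7 (V 11)) (Get 7 (V 12)))
              (If (Less (Bin Shr (Bin Minus (Get 6 (V 11)) (N 1)) (Bin Minus (Get 7 (V 12)) (Get 7 (V 11)))) (Get 6 (V 12)))
                (Assign 13 (V 11)) (Assign 13 (V 12)))
              (If (Less (Bin Shr (Get 6 (V 12)) (Bin Minus (Get 7 (V 11)) (Get 7 (V 12)))) (Get 6 (V 11)))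
                (Assign 13 (V 12)) (Assign 13 (V 11))))))
     (Store 8 (V 10) (V 13))))"

lemma wr_upd [simp]: "wregs upd = {11, 12, 13}" and wa_upd [simp]: "warrs upd = {8}"
  by (auto simp: upd_def)

lemma abs_diff_le_of_halves: "2 * \<bar>x\<bar> \<le> M \<Longrightarrow> 2 * \<bar>y\<bar> \<le> M \<Longrightarrow> \<bar>x - y\<bar> \<le> M" for x y M :: int
  by linarith

lemma abs_diff_1_le: "\<bar>x\<bar> + 1 \<le> M \<Longrightarrow> \<bar>x - 1\<bar> \<le> M" for x M :: int
  by linarith

text \<open>The size conditions match what is computed: \<open>2 * v + 1\<close> as a child index, a
  mantissa minus 1, and the difference of two exponents. The four orders of comparison in the
  program are hidden from callers, who learn only that one of the children was chosen and beats
  both.\<close>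

lemma runs_upd:
  assumes s: "snd s 8 = Tr" "snd s 6 = Zm" "snd s 7 = Ze" "snd s 9 = R" "fst s 10 = int v"
    and tree: "tree q (Suc v) Tr" "1 \<le> v" "v < q"
    and len: "length Zm = q" "length Ze = q" "length R = q"
    and M: "2 * int q + 1 \<le> M" "\<And>x. x \<in> set Zm \<Longrightarrow> \<bar>x\<bar> + 1 \<le> M" "\<And>x. x \<in> set Ze \<Longrightarrow> 2 * \<bar>x\<bar> \<le> M"
  shows "runs M upd s 80 (\<lambda>s'. fst s' 10 = int v \<and> (\<exists>c. snd s' = (snd s)(8 := Tr[v := c]) \<and>
     (c = Tr ! (2 * v) \<or> c = Tr ! (2 * v + 1)) \<and>
     beats Zm Ze R c (Tr ! (2 * v)) \<and> beats Zm Ze R c (Tr ! (2 * v + 1))))"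
proof -
  define a where "a = Tr ! (2 * v)"
  define b where "b = Tr ! (2 * v + 1)"
  have lt: "length Tr = 2 * q" using tree by (simp add: tree_def)
  have ab: "0 \<le> a" "a < int q" "0 \<le> b" "b < int q"
    using tree unfolding tree_def a_def b_def by auto
  then have nab: "nat a < q" "nat b < q" by auto
  have Mab: "\<bar>Zm ! nat a\<bar> + 1 \<le> M" "\<bar>Zm ! nat b\<bar> + 1 \<le> M" "2 * \<bar>Ze ! nat a\<bar> \<le> M" "2 * \<bar>Ze ! nat b\<bar> \<le> M"
    using M(2,3) nab len by auto
  have nat2: "nat (2 * int v) = 2 * v" "nat (2 * int v + 1) = 2 * v + 1" by auto
  have la: "beats Zm Ze R a b" if "\<not> 0 < R ! nat a" "Ze ! nat a < Ze ! nat b"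
      "(Zm ! nat a - 1) div 2 ^ nat (Ze ! nat b - Ze ! nat a) < Zm ! nat b"
    using that by (simp add: beats_def item_val_def fp_le_iff_less)
  have lb: "beats Zm Ze R b a" if "\<not> 0 < R ! nat b" "Ze ! nat a < Ze ! nat b"
      "\<not> (Zm ! nat a - 1) div 2 ^ nat (Ze ! nat b - Ze ! nat a) < Zm ! nat b"
    using that fp_le_iff_less[of "Ze ! nat a" "Ze ! nat b" "Zm ! nat a" "Zm ! nat b"] by (simp add: beats_def item_val_def)
  have lc: "beats Zm Ze R b a" if "\<not> 0 < R ! nat b" "\<not> Ze ! nat a < Ze ! nat b"
      "Zm ! nat b div 2 ^ nat (Ze ! nat a - Ze ! nat b) < Zm ! nat a"
    using that fp_le_iff_ge[of "Ze ! nat b" "Ze ! nat a" "Zm ! nat a" "Zm ! nat b"]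
    by (simp add: beats_def item_val_def)
  have ld: "beats Zm Ze R a b" if "\<not> 0 < R ! nat a" "\<not> Ze ! nat a < Ze ! nat b"
      "\<not> Zm ! nat b div 2 ^ nat (Ze ! nat a - Ze ! nat b) < Zm ! nat a"
    using that fp_le_iff_ge[of "Ze ! nat b" "Ze ! nat a" "Zm ! nat a" "Zm ! nat b"]
    by (simp add: beats_def item_val_def)
  have le: "beats Zm Ze R b a" if "0 < R ! nat a" using that by (simp add: beats_def)
  have lf: "beats Zm Ze R a b" if "0 < R ! nat b" using that by (simp add: beats_def)
  have d: "\<bar>Ze ! nat b - Ze ! nat a\<bar> \<le> M" "\<bar>Ze ! nat a - Ze ! nat b\<bar> \<le> M" "\<bar>Zm ! nat a - 1\<bar> \<le> M"
    by (fact abs_diff_le_of_halves[OF Mab(4,3)] abs_diff_le_of_halves[OF Mab(3,4)] abs_diff_1_le[OF Mab(1)])+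
  then have d': "Ze ! nat b - Ze ! nat a \<le> M" "Ze ! nat a - Ze ! nat b \<le> M"
    using abs_ge_self order_trans by blast+
  have "\<bar>Zm ! nat b\<bar> \<le> M" using Mab(2) by simp
  then have sh: "\<bar>(Zm ! nat a - 1) div 2 ^ k\<bar> \<le> M" "\<bar>Zm ! nat b div 2 ^ k\<bar> \<le> M" for k
    using order_trans[OF abs_div_le_abs[of "2 ^ k"]] d(3) by simp_all
  have sz: "2 \<le> M" "1 \<le> M" "0 \<le> M" "2 * int v \<le> M" "2 * int v + 1 \<le> M"
    "\<bar>2 * int v\<bar> \<le> M" "\<bar>2 * int v + 1\<bar> \<le> M" using M(1) tree by auto
  have tv: "2 * v + 1 < 2 * q" "2 * v < 2 * q" "v < 2 * q" using tree by auto
  have ia: "Tr ! (2 * v) = a" "Tr ! Suc (2 * v) = b" "Tr ! (2 * v + 1) = b"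
    by (auto simp: a_def b_def)
  \<comment> \<open>The choice made by the nested conditionals of \<open>upd\<close>. If both
    children are removed it yields \<open>b\<close>, which is fine since removed items beat each
    other.\<close>
  define c where "c = (if 0 < R ! nat a then b else if 0 < R ! nat b then a else
     if Ze ! nat a < Ze ! nat b then
       (if (Zm ! nat a - 1) div 2 ^ nat (Ze ! nat b - Ze ! nat a) < Zm ! nat b then a else b)
     else (if Zm ! nat b div 2 ^ nat (Ze ! nat a - Ze ! nat b) < Zm ! nat a then b else a))"
  have c1: "c = a \<or> c = b" by (simp add: c_def)
  have c: "beats Zm Ze R c a \<and> beats Zm Ze R c b"
    by (simp add: c_def beats_refl la lb lc ld le lf)
  have "wp M upd (\<lambda>s'. s' = ((fst s)(11 := a, 12 := b, 13 := c), (snd s)(8 := Tr[v := c]))) s"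
    unfolding upd_def c_def
    by (simp add: nat2 ia s lt ab nab len sz sh d d' tv tree(3) del: One_nat_def)
  then show ?thesis
    by (rule runs_mono[OF runs_scost], simp add: upd_def) (use c1 c s in \<open>auto simp: a_def b_def\<close>)
qed

text \<open>The state of a selection sort after \<open>k\<close> extractions: on the extracted items
  \<open>R\<close> and \<open>Od\<close> are inverse to each other up to the shift by 1, and the
  last conjunct bounds them by the items still waiting. Ranks start at 1 because 0 marks a waiting
  item.\<close>

definition sorted_upto :: "nat \<Rightarrow> nat \<Rightarrow> int list \<Rightarrow> int list \<Rightarrow> int list \<Rightarrow> int list \<Rightarrow> bool" where
  "sorted_upto q k Zm Ze R Od \<longleftrightarrow> length R = q \<and> length Od = q \<and>
     (\<forall>i<k. 0 \<le> Od ! i \<and> Od ! i < int q \<and> R ! nat (Od ! i) = int i + 1) \<and>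
     (\<forall>p<q. R ! p = 0 \<or> (\<exists>i<k. R ! p = int i + 1 \<and> Od ! i = int p)) \<and>
     (\<forall>j<k. \<forall>i\<le>j. item_val Zm Ze (Od ! i) \<le> item_val Zm Ze (Od ! j)) \<and>
     (\<forall>i<k. \<forall>p<q. R ! p = 0 \<longrightarrow> item_val Zm Ze (Od ! i) \<le> item_val Zm Ze (int p))"

text \<open>Pigeonhole: all ranked items occur among the first \<open>k\<close> entries of
  \<open>Od\<close>. Hence the winner of the next round is an item still in the tournament.\<close>

lemma sorted_upto_unranked:
  assumes "sorted_upto q k Zm Ze R Od" "k < q"
  shows "\<exists>p<q. R ! p = 0"
proof (rule ccontr)
  assume "\<not> ?thesis"
  then have "{..<q} \<subseteq> (\<lambda>i. nat (Od ! i)) ` {..<k}"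
    using assms(1) unfolding sorted_upto_def by force
  then have "card {..<q} \<le> card {..<k}" by (meson card_image_le card_mono finite_imageI finite_lessThan le_trans)
  then show False using assms(2) by simp
qed

text \<open>The ranks make the map from positions to items injective, and an injective map of a
  finite set into itself is onto.\<close>

lemma sorted_upto_complete:
  assumes "sorted_upto q q Zm Ze R Od" "p < q"
  shows "\<exists>i<q. R ! p = int i + 1 \<and> Od ! i = int p"
proof -
  have *: "\<And>i. i < q \<Longrightarrow> 0 \<le> Od ! i \<and> Od ! i < int q \<and> R ! nat (Od ! i) = int i + 1"
    using assms by (auto simp: sorted_upto_def)
  have "inj_on (\<lambda>i. nat (Od ! i)) {..<q}"
    using * by (intro inj_onI) (metis add_right_cancel lessThan_iff of_nat_eq_iff)
  moreover have "(\<lambda>i. nat (Od ! i)) ` {..<q} \<subseteq> {..<q}" using * by fastforce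
  ultimately have "(\<lambda>i. nat (Od ! i)) ` {..<q} = {..<q}"
    by (simp add: endo_inj_surj)
  then obtain i where "i < q" "p = nat (Od ! i)" using assms(2) by (metis imageE lessThan_iff)
  then show ?thesis using * by (intro exI[of _ i]) auto
qed

text \<open>The root item beats every leaf. Since some leaf is unranked, the root item is unranked
  too, and it is minimal among the unranked items. Giving it a rank only makes it easier for any
  other item to beat something, so a node can stop being \<open>good\<close> only if it holds the
  removed item itself. By \<open>tree\<close> such a node is an ancestor of its leaf, which gives
  the last conclusion.\<close>

lemma sorted_upto_step:
  assumes S: "sorted_upto q k Zm Ze R Od" and "k < q" and tree: "tree q 1 Tr"
    and good: "\<And>u. 1 \<le> u \<Longrightarrow> u < q \<Longrightarrow> good Zm Ze R Tr u"
    and p: "p = Tr ! 1"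
  shows "0 \<le> p" "p < int q"
    "sorted_upto q (Suc k) Zm Ze (R[nat p := int k + 1]) (Od[k := p])"
    "\<And>u. 1 \<le> u \<Longrightarrow> u < q \<Longrightarrow>
      good Zm Ze (R[nat p := int k + 1]) Tr u \<or> (\<exists>j\<ge>1. u = (q + nat p) div 2 ^ j)"
proof -
  show p0: "0 \<le> p" and pq: "p < int q" using tree \<open>k < q\<close> by (auto simp: tree_def p)
  have len: "length R = q" "length Od = q" using S by (auto simp: sorted_upto_def)
  have b: "beats Zm Ze R p (int p')" if "p' < q" for p'
    using root_beats[OF tree good, of "q + p'"] tree_leaf[OF tree, of p'] that p by simp
  obtain p' where "p' < q" "R ! p' = 0" using sorted_upto_unranked[OF S \<open>k < q\<close>] by blast
  then have "\<not> 0 < R ! nat p" using b[of p'] by (simp add: beats_def)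
  moreover have "R ! nat p \<ge> 0" using S p0 pq unfolding sorted_upto_def by (metis nat_less_iff of_nat_0_le_iff add_nonneg_nonneg zero_le_one order_refl)
  ultimately have Rp: "R ! nat p = 0" by simp
  have min: "item_val Zm Ze p \<le> item_val Zm Ze (int p')" if "p' < q" "R ! p' = 0" for p'
    using b[OF that(1)] that by (simp add: beats_def)
  have old: "\<And>i. i < k \<Longrightarrow> nat (Od ! i) \<noteq> nat p"
    using S Rp unfolding sorted_upto_def by (metis add_is_0 of_nat_1 of_nat_add of_nat_eq_0_iff one_neq_zero)
  have last: "item_val Zm Ze (Od ! i) \<le> item_val Zm Ze p" if "i < k" for i
  proof -
    have "nat p < q" using p0 pq by simp
    then have "item_val Zm Ze (Od ! i) \<le> item_val Zm Ze (int (nat p))"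
      using S that Rp unfolding sorted_upto_def by blast
    then show ?thesis using p0 by simp
  qed
  show "sorted_upto q (Suc k) Zm Ze (R[nat p := int k + 1]) (Od[k := p])"
    unfolding sorted_upto_def
  proof (intro conjI allI impI)
    fix i assume i: "i < Suc k"
    show "0 \<le> Od[k := p] ! i" "Od[k := p] ! i < int q" "R[nat p := int k + 1] ! nat (Od[k := p] ! i) = int i + 1"
      using S i p0 pq len old[of i] \<open>k < q\<close> unfolding sorted_upto_def
      by (auto simp: nth_list_update less_Suc_eq)
  next
    fix p' assume p': "p' < q"
    show "R[nat p := int k + 1] ! p' = 0 \<or> (\<exists>i<Suc k. R[nat p := int k + 1] ! p' = int i + 1 \<and> Od[k := p] ! i = int p')"
    proof (cases "p' = nat p")
      case True
      then show ?thesis using p0 len \<open>k < q\<close> p' by (intro disjI2 exI[of _ k]) auto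
    next
      case False
      then have "R ! p' = 0 \<or> (\<exists>i<k. R ! p' = int i + 1 \<and> Od ! i = int p')"
        using S p' unfolding sorted_upto_def by blast
      then show ?thesis using False by (auto simp: nth_list_update less_Suc_eq)
    qed
  next
    fix j i assume "j < Suc k" "i \<le> j"
    then show "item_val Zm Ze (Od[k := p] ! i) \<le> item_val Zm Ze (Od[k := p] ! j)"
      using S len \<open>k < q\<close> last[of i] unfolding sorted_upto_def by (auto simp: nth_list_update less_Suc_eq)
  next
    fix i p' assume *: "i < Suc k" "p' < q" "R[nat p := int k + 1] ! p' = 0"
    then have "p' \<noteq> nat p" using len by auto
    then show "item_val Zm Ze (Od[k := p] ! i) \<le> item_val Zm Ze (int p')"
      using S len \<open>k < q\<close> min[of p'] * unfolding sorted_upto_def by (auto simp: nth_list_update less_Suc_eq)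
  qed (use len in auto)
  fix u assume u: "1 \<le> u" "u < q"
  show "good Zm Ze (R[nat p := int k + 1]) Tr u \<or> (\<exists>j\<ge>1. u = (q + nat p) div 2 ^ j)"
  proof (cases "Tr ! u = p")
    case True
    have "u \<in> {1..<2 * q}" using u by simp
    then obtain j where j: "(q + nat (Tr ! u)) div 2 ^ j = u" using tree unfolding tree_def by blast
    then have "j \<noteq> 0" using u by (cases j) auto
    then show ?thesis using j True by (intro disjI2 exI[of _ j]) auto
  next
    case False
    have "0 \<le> Tr ! u" "0 \<le> Tr ! (2 * u)" "0 \<le> Tr ! (2 * u + 1)"
      using tree u unfolding tree_def by auto
    then have "nat (Tr ! u) \<noteq> nat p" using False p0 by auto
    moreover have "nat p < length R" using p0 pq len by simp
    ultimately have "beats Zm Ze R (Tr ! u) x \<Longrightarrow> beats Zm Ze (R[nat p := int k + 1]) (Tr ! u) x" for x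
      by (auto simp: beats_def nth_list_update)
    then show ?thesis using good[OF u] by (auto simp: good_def)
  qed
qed

text \<open>Changing node \<open>v\<close> affects the condition at \<open>v\<close> and at its
  parent only. The former holds by the choice of \<open>c\<close>, and the parent is the next node
  on the path, so the nodes under suspicion move up by one level.\<close>

lemma good_walk_step:
  assumes tree: "tree q 1 Tr" and x: "x < 2 * q" and v: "v = x div 2 ^ j" "1 \<le> j" "0 < v"
    and good: "\<And>u. 1 \<le> u \<Longrightarrow> u < q \<Longrightarrow> good Zm Ze R Tr u \<or> (\<exists>j'\<ge>j. u = x div 2 ^ j')"
    and c: "beats Zm Ze R c (Tr ! (2 * v))" "beats Zm Ze R c (Tr ! (2 * v + 1))"
    and u: "1 \<le> u" "u < q"
  shows "good Zm Ze R (Tr[v := c]) u \<or> (\<exists>j'\<ge>Suc j. u = x div 2 ^ j')"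
proof -
  have len: "length Tr = 2 * q" using tree by (simp add: tree_def)
  consider "u = v" | "u = v div 2" | "u \<noteq> v" "2 * u \<noteq> v" "2 * u + 1 \<noteq> v" by fastforce
  then show ?thesis
  proof cases
    case 1
    then show ?thesis using c u len v by (auto simp: good_def)
  next
    case 2
    then have "u = x div 2 ^ Suc j" by (simp only: power_Suc2 div_mult2_eq v(1))
    then show ?thesis by blast
  next
    case 3
    then have "good Zm Ze R (Tr[v := c]) u \<longleftrightarrow> good Zm Ze R Tr u" by (simp add: good_def)
    then show ?thesis using good[OF u] 3(1) v(1) by (metis Suc_leI le_neq_implies_less)
  qed
qed


definition walk :: com where
  "walk = While (Less (N 0) (V 10)) (Seq upd (Assign 10 (Bin Div (V 10) (N 2))))"

lemma wr_walk [simp]: "wregs walk = {10, 11, 12, 13}" and wa_walk [simp]: "warrs walk = {8}"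
  by (auto simp: walk_def)

text \<open>A node number below \<open>2 ^ L\<close> can be halved at most \<open>L\<close> times
  before it becomes 0, so the repair of a path takes at most \<open>L\<close> rounds.\<close>

lemma runs_walk:
  assumes s: "snd s 8 = Tr" "snd s 6 = Zm" "snd s 7 = Ze" "snd s 9 = R" "fst s 10 = int (x div 2)"
    and tree: "tree q 1 Tr" and x: "x < 2 * q" "2 * q \<le> 2 ^ L"
    and good: "\<And>u. 1 \<le> u \<Longrightarrow> u < q \<Longrightarrow> good Zm Ze R Tr u \<or> (\<exists>j\<ge>1. u = x div 2 ^ j)"
    and len: "length Zm = q" "length Ze = q" "length R = q"
    and M: "2 * int q + 1 \<le> M" "\<And>x. x \<in> set Zm \<Longrightarrow> \<bar>x\<bar> + 1 \<le> M" "\<And>x. x \<in> set Ze \<Longrightarrow> 2 * \<bar>x\<bar> \<le> M"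
  shows "runs M walk s (88 * L + 4) (\<lambda>s'. \<exists>Tr'. snd s' = (snd s)(8 := Tr') \<and> tree q 1 Tr' \<and>
     (\<forall>u. 1 \<le> u \<longrightarrow> u < q \<longrightarrow> good Zm Ze R Tr' u))"
    (is "runs M walk s _ ?Q")
proof -
  define I where "I i s' \<longleftrightarrow> (\<exists>Tr'. snd s' = (snd s)(8 := Tr') \<and> tree q 1 Tr' \<and>
     fst s' 10 = int (x div 2 ^ Suc i) \<and>
     (\<forall>u. 1 \<le> u \<longrightarrow> u < q \<longrightarrow> good Zm Ze R Tr' u \<or> (\<exists>j\<ge>Suc i. u = x div 2 ^ j)))" for i and s' :: state
  have "runs M walk s (L * (84 + bcost (Less (N 0) (V 10)) + 1) + bcost (Less (N 0) (V 10)) + 1) ?Q"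
    unfolding walk_def
  proof (rule runs_While[of I])
    show "I 0 s" unfolding I_def using s tree good by (intro exI[of _ Tr]) auto
    fix i s' assume "I i s'"
    then obtain Tr' where I: "snd s' = (snd s)(8 := Tr')" "tree q 1 Tr'" "fst s' 10 = int (x div 2 ^ Suc i)"
      "\<And>u. 1 \<le> u \<Longrightarrow> u < q \<Longrightarrow> good Zm Ze R Tr' u \<or> (\<exists>j\<ge>Suc i. u = x div 2 ^ j)"
      unfolding I_def by blast
    define v where "v = x div 2 ^ Suc i"
    show "bok M (Less (N 0) (V 10)) s' \<and>
       (if bev (Less (N 0) (V 10)) s'
        then i < L \<and> runs M (Seq upd (Assign 10 (Bin Div (V 10) (N 2)))) s' 84 (I (Suc i)) else ?Q s')"
    proof (cases "0 < v")
      \<comment> \<open>The walk has passed the root. All remaining suspects are at most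
        \<open>v = 0\<close>, and 0 is not a node of the tree.\<close>
      case False
      have "good Zm Ze R Tr' u" if u: "1 \<le> u" "u < q" for u
      proof -
        have "u \<noteq> x div 2 ^ j" if "j \<ge> Suc i" for j
        proof -
          have "x div 2 ^ j \<le> x div 2 ^ Suc i"
            using that by (intro div_le_mono2 power_increasing) auto
          then show ?thesis using u False by (simp add: v_def)
        qed
        then show ?thesis using I(4)[OF u] by blast
      qed
      then show ?thesis using False I M by (auto simp: v_def)
    next
      case True
      have "v \<le> x div 2" unfolding v_def by (simp add: div_mult2_eq)
      then have vq: "v < q" using x by simp
      have "i < L"
      proof (rule ccontr)
        assume "\<not> i < L"
        then have "(2::nat) ^ L \<le> 2 ^ Suc i" by (intro power_increasing) auto
        then have "x < 2 ^ Suc i" using x by simp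
        then show False using True by (simp add: v_def)
      qed
      have t: "tree q (Suc v) Tr'" using tree_anti_mono[OF I(2)] by simp
      have "runs M upd s' 80 (\<lambda>s''. fst s'' 10 = int v \<and> (\<exists>c. snd s'' = (snd s')(8 := Tr'[v := c]) \<and>
         (c = Tr' ! (2 * v) \<or> c = Tr' ! (2 * v + 1)) \<and>
         beats Zm Ze R c (Tr' ! (2 * v)) \<and> beats Zm Ze R c (Tr' ! (2 * v + 1))))"
        by (rule runs_upd[OF _ _ _ _ _ t]) (use I s True vq len M in \<open>auto simp: v_def\<close>)
      then have "runs M (Seq upd (Assign 10 (Bin Div (V 10) (N 2)))) s' (80 + 4) (I (Suc i))"
      proof (rule runs_Seq)
        fix s'' :: state assume "fst s'' 10 = int v \<and> (\<exists>c. snd s'' = (snd s')(8 := Tr'[v := c]) \<and>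
         (c = Tr' ! (2 * v) \<or> c = Tr' ! (2 * v + 1)) \<and>
         beats Zm Ze R c (Tr' ! (2 * v)) \<and> beats Zm Ze R c (Tr' ! (2 * v + 1)))"
        then obtain c where c: "fst s'' 10 = int v" "snd s'' = (snd s')(8 := Tr'[v := c])"
          "c = Tr' ! (2 * v) \<or> c = Tr' ! (2 * v + 1)"
          "beats Zm Ze R c (Tr' ! (2 * v))" "beats Zm Ze R c (Tr' ! (2 * v + 1))" by blast
        have half: "int v div 2 = int (x div 2 ^ Suc (Suc i))"
          unfolding v_def power_Suc2[of _ "Suc i"] div_mult2_eq by (simp add: zdiv_int)
        have "tree q v (Tr'[v := c])" by (rule tree_update[OF t _ vq c(3)]) (use True in simp)
        then have "tree q 1 (Tr'[v := c])" using I(2) True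
          unfolding tree_def by (metis atLeastLessThan_iff le_eq_less_or_eq length_list_update nat_le_linear nth_list_update_neq)
        then have "I (Suc i) ((fst s'')(10 := int (x div 2 ^ Suc (Suc i))), snd s'')"
          unfolding I_def using good_walk_step[OF I(2) x(1) v_def _ True I(4) c(4,5)] c(2) I(1)
          by (intro exI[of _ "Tr'[v := c]"]) auto
        moreover have "int v div 2 \<le> int v" by simp
        ultimately show "runs M (Assign 10 (Bin Div (V 10) (N 2))) s'' 4 (I (Suc i))"
          using c(1) vq M(1) half by (intro runs_wp) (auto simp del: power_Suc)
      qed
      then show ?thesis using True I \<open>i < L\<close> M(1) by (simp add: v_def)
    qed
  qed
  then show ?thesis by (rule runs_mono) auto
qed

text \<open>The walk starts at the parent of the winner's leaf since the content of a leaf never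
  changes. Register 10 (a node) and array 10 (the sorted items) are unrelated.\<close>

definition pop :: com where
  "pop = Seq (Assign 14 (Get 8 (N 1))) (Seq (Store 10 (V 9) (V 14))
     (Seq (Store 9 (V 14) (Bin Plus (V 9) (N 1))) (Assign 10 (Bin Div (Bin Plus (V 8) (V 14)) (N 2)))))"

text \<open>One linear bottom-up pass over the inner nodes, then \<open>q\<close> extractions with a
  repair of logarithmic length each.\<close>

definition sort_prog :: com where
  "sort_prog =
     Seq (Alloc 8 (Bin Times (N 2) (V 8))) (Seq (Alloc 9 (V 8)) (Seq (Alloc 10 (V 8))
     (Seq (For 9 8 (Store 8 (Bin Plus (V 8) (V 9)) (V 9)))
     (Seq (Assign 16 (Bin Minus (V 8) (N 1)))
     (Seq (For 9 16 (Seq (Assign 10 (Bin Minus (V 16) (V 9))) upd))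
          (For 9 8 (Seq pop walk)))))))"

lemma wr_sort_prog [simp]: "wregs sort_prog = {9, 10, 11, 12, 13, 14, 16}"
  and wa_sort_prog [simp]: "warrs sort_prog = {8, 9, 10}"
  by (auto simp: sort_prog_def pop_def)

section \<open>Correctness and cost of the sort\<close>

lemma runs_leaves:
  assumes s: "fst s 8 = int q" "snd s 8 = replicate (2 * q) 0" and M: "2 * int q + 1 \<le> M"
  shows "runs M (For 9 8 (Store 8 (Bin Plus (V 8) (V 9)) (V 9))) s (q * (5 + 8) + 8)
    (\<lambda>s'. length (snd s' 8) = 2 * q \<and> (\<forall>p<q. snd s' 8 ! (q + p) = int p))"
proof (rule runs_For[where I = "\<lambda>i s'. length (snd s' 8) = 2 * q \<and> (\<forall>p<i. snd s' 8 ! (q + p) = int p)"])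
  fix i s' assume i: "i < q" "length (snd s' 8) = 2 * q \<and> (\<forall>p<i. snd s' 8 ! (q + p) = int p)"
    "fst s' 9 = int i" and f: "frame (For 9 8 (Store 8 (Bin Plus (V 8) (V 9)) (V 9))) s s'"
  have "fst s' 8 = int q" using frame_reg[OF f, of 8] s by simp
  moreover have "nat (int q + int i) = q + i" by simp
  ultimately show "runs M (Store 8 (Bin Plus (V 8) (V 9)) (V 9)) s' 5
     (\<lambda>s'. length (snd s' 8) = 2 * q \<and> (\<forall>p<Suc i. snd s' 8 ! (q + p) = int p))"
    using i M by (intro runs_wp) (auto simp: nth_list_update less_Suc_eq)
qed (use s M in auto)

text \<open>The inner nodes are visited in the order \<open>q - 1\<close>, ..., 1, so both children
  of a node are final when it is computed.\<close>

lemma runs_build: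
  assumes s: "fst s 16 = int (q - 1)" "snd s 6 = Zm" "snd s 7 = Ze" "snd s 9 = R" "1 \<le> q"
    "length (snd s 8) = 2 * q" "\<And>p. p < q \<Longrightarrow> snd s 8 ! (q + p) = int p"
    and len: "length Zm = q" "length Ze = q" "length R = q"
    and M: "2 * int q + 1 \<le> M" "\<And>x. x \<in> set Zm \<Longrightarrow> \<bar>x\<bar> + 1 \<le> M" "\<And>x. x \<in> set Ze \<Longrightarrow> 2 * \<bar>x\<bar> \<le> M"
  shows "runs M (For 9 16 (Seq (Assign 10 (Bin Minus (V 16) (V 9))) upd)) s ((q - 1) * ((4 + 80) + 8) + 8)
    (\<lambda>s'. tree q 1 (snd s' 8) \<and> (\<forall>u. 1 \<le> u \<longrightarrow> u < q \<longrightarrow> good Zm Ze R (snd s' 8) u))"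
proof -
  define I where "I i s' \<longleftrightarrow> tree q (q - i) (snd s' 8) \<and> (\<forall>u. q - i \<le> u \<longrightarrow> u < q \<longrightarrow> good Zm Ze R (snd s' 8) u)"
    for i and s' :: state
  have "runs M (For 9 16 (Seq (Assign 10 (Bin Minus (V 16) (V 9))) upd)) s ((q - 1) * ((4 + 80) + 8) + 8) (I (q - 1))"
  proof (rule runs_For)
    have "\<exists>j. (q + nat (snd s 8 ! u)) div 2 ^ j = u" "0 \<le> snd s 8 ! u" "snd s 8 ! u < int q"
      if "u \<in> {q..<2 * q}" for u
      using s(7)[of "u - q"] that by (auto intro: exI[of _ 0])
    then show "I 0 s" unfolding I_def tree_def using s by auto
    fix i s' assume i: "i < q - 1" "I i s'" "fst s' 9 = int i"
      and f: "frame (For 9 16 (Seq (Assign 10 (Bin Minus (V 16) (V 9))) upd)) s s'"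
    define v where "v = q - 1 - i"
    have v: "q - i = Suc v" "q - Suc i = v" "1 \<le> v" "v < q" using i by (auto simp: v_def)
    have "fst s' 16 = int (q - 1)" "snd s' 6 = Zm" "snd s' 7 = Ze" "snd s' 9 = R"
      using frame_reg[OF f, of 16] frame_arr[OF f, of 6] frame_arr[OF f, of 7] frame_arr[OF f, of 9] s(1-4) by simp_all
    note s' = this
    have t: "tree q (Suc v) (snd s' 8)" using i v by (simp add: I_def)
    show "runs M (Seq (Assign 10 (Bin Minus (V 16) (V 9))) upd) s' (4 + 80) (I (Suc i))"
    proof (rule runs_Seq)
      show "runs M (Assign 10 (Bin Minus (V 16) (V 9))) s' 4 (\<lambda>s''. s'' = ((fst s')(10 := int v), snd s'))"
        using s'(1) i(1,3) v(4) M(1) by (intro runs_wp) (simp_all add: v_def of_nat_diff diff_diff_eq)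
      fix s'' assume s'': "s'' = ((fst s')(10 := int v), snd s')"
      have "runs M upd s'' 80 (\<lambda>s'. fst s' 10 = int v \<and> (\<exists>c. snd s' = (snd s'')(8 := (snd s'' 8)[v := c]) \<and>
         (c = snd s'' 8 ! (2 * v) \<or> c = snd s'' 8 ! (2 * v + 1)) \<and>
         beats Zm Ze R c (snd s'' 8 ! (2 * v)) \<and> beats Zm Ze R c (snd s'' 8 ! (2 * v + 1))))"
        by (rule runs_upd) (use s' s'' t v len M in auto)
      then show "runs M upd s'' 80 (I (Suc i))"
      proof (rule runs_mono)
        fix s3 :: state
        assume "fst s3 10 = int v \<and> (\<exists>c. snd s3 = (snd s'')(8 := (snd s'' 8)[v := c]) \<and>
         (c = snd s'' 8 ! (2 * v) \<or> c = snd s'' 8 ! (2 * v + 1)) \<and>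
         beats Zm Ze R c (snd s'' 8 ! (2 * v)) \<and> beats Zm Ze R c (snd s'' 8 ! (2 * v + 1)))"
        then obtain c where c: "snd s3 = (snd s')(8 := (snd s' 8)[v := c])"
         "c = snd s' 8 ! (2 * v) \<or> c = snd s' 8 ! (2 * v + 1)"
         "beats Zm Ze R c (snd s' 8 ! (2 * v))" "beats Zm Ze R c (snd s' 8 ! (2 * v + 1))"
          using s'' by auto
        have "tree q v ((snd s' 8)[v := c])" by (rule tree_update[OF t v(3,4) c(2)])
        moreover have "good Zm Ze R ((snd s' 8)[v := c]) u" if u: "v \<le> u" "u < q" for u
        proof (cases "u = v")
          case True
          then show ?thesis using c t v by (auto simp: good_def tree_def)
        next
          case False
          then have "good Zm Ze R (snd s' 8) u" using i u v by (simp add: I_def)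
          then show ?thesis using False u by (simp add: good_def)
        qed
        ultimately show "I (Suc i) s3" using c(1) v by (simp add: I_def)
      qed simp
    qed
  qed (use s M in \<open>auto simp: I_def\<close>)
  then show ?thesis by (rule runs_mono) (use s(5) in \<open>auto simp: I_def\<close>)
qed

lemma runs_extract:
  assumes s: "fst s 8 = int q" "snd s 6 = Zm" "snd s 7 = Ze" "1 \<le> q" "2 * q \<le> 2 ^ L"
    "snd s 9 = replicate q 0" "snd s 10 = replicate q 0"
    "tree q 1 (snd s 8)" "\<forall>u. 1 \<le> u \<longrightarrow> u < q \<longrightarrow> good Zm Ze (snd s 9) (snd s 8) u"
    and len: "length Zm = q" "length Ze = q"
    and M: "2 * int q + 1 \<le> M" "\<And>x. x \<in> set Zm \<Longrightarrow> \<bar>x\<bar> + 1 \<le> M" "\<And>x. x \<in> set Ze \<Longrightarrow> 2 * \<bar>x\<bar> \<le> M"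
  shows "runs M (For 9 8 (Seq pop walk)) s (q * ((20 + (88 * L + 4)) + 8) + 8)
    (\<lambda>s'. sorted_upto q q Zm Ze (snd s' 9) (snd s' 10))"
proof -
  define I where "I i s' \<longleftrightarrow> tree q 1 (snd s' 8) \<and> (\<forall>u. 1 \<le> u \<longrightarrow> u < q \<longrightarrow> good Zm Ze (snd s' 9) (snd s' 8) u)
    \<and> sorted_upto q i Zm Ze (snd s' 9) (snd s' 10)" for i and s' :: state
  have "runs M (For 9 8 (Seq pop walk)) s (q * ((20 + (88 * L + 4)) + 8) + 8) (I q)"
  proof (rule runs_For)
    show "I 0 s" unfolding I_def sorted_upto_def using s by auto
    fix i s' assume i: "i < q" "I i s'" "fst s' 9 = int i" and f: "frame (For 9 8 (Seq pop walk)) s s'"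
    have s': "fst s' 8 = int q" "snd s' 6 = Zm" "snd s' 7 = Ze"
      using frame_reg[OF f, of 8] frame_arr[OF f, of 6] frame_arr[OF f, of 7] s(1-3) by (simp_all add: pop_def)
    define p where "p = snd s' 8 ! 1"
    note step = sorted_upto_step[OF _ i(1) _ _ p_def, of Zm Ze "snd s' 9" "snd s' 10"]
    have p: "0 \<le> p" "p < int q" "sorted_upto q (Suc i) Zm Ze ((snd s' 9)[nat p := int i + 1]) ((snd s' 10)[i := p])"
      using step(1-3) i(2) by (auto simp: I_def)
    have gd: "good Zm Ze ((snd s' 9)[nat p := int i + 1]) (snd s' 8) u \<or> (\<exists>j\<ge>1. u = (q + nat p) div 2 ^ j)"
      if "1 \<le> u" "u < q" for u
      using step(4)[OF _ _ _ that] i(2) by (auto simp: I_def)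
    have l: "length (snd s' 8) = 2 * q" "length (snd s' 9) = q" "length (snd s' 10) = q"
      using i(2) by (auto simp: I_def tree_def sorted_upto_def)
    define s1 where "s1 = ((fst s')(14 := p, 10 := int ((q + nat p) div 2)),
       (snd s')(10 := (snd s' 10)[i := p], 9 := (snd s' 9)[nat p := int i + 1]))"
    show "runs M (Seq pop walk) s' (20 + (88 * L + 4)) (I (Suc i))"
    proof (rule runs_Seq)
      have "(int q + p) div 2 = int ((q + nat p) div 2)" using p by (simp add: zdiv_int)
      moreover have "snd s' 8 ! Suc 0 = p" by (simp add: p_def)
      ultimately show "runs M pop s' 20 (\<lambda>s''. s'' = s1)"
        using s' i p M l unfolding pop_def s1_def by (intro runs_wp) (auto simp: fun_upd_twist)
      fix s'' assume s'': "s'' = s1"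
      have "runs M walk s'' (88 * L + 4) (\<lambda>s'. \<exists>Tr'. snd s' = (snd s'')(8 := Tr') \<and> tree q 1 Tr' \<and>
         (\<forall>u. 1 \<le> u \<longrightarrow> u < q \<longrightarrow> good Zm Ze ((snd s' 9)[nat p := int i + 1]) Tr' u))"
        by (rule runs_mono[OF runs_walk[where x = "q + nat p" and q = q and Zm = Zm and Ze = Ze
               and R = "(snd s' 9)[nat p := int i + 1]" and Tr = "snd s' 8" and L = L]])
          (use s' s'' gd l p i s len M in \<open>auto simp: s1_def I_def\<close>)
      then show "runs M walk s'' (88 * L + 4) (I (Suc i))"
        by (rule runs_mono) (use s'' p in \<open>auto simp: s1_def I_def\<close>)
    qed
  qed (use s M in \<open>auto simp: I_def pop_def\<close>)
  then show ?thesis by (rule runs_mono) (auto simp: I_def)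
qed

lemma runs_sort_prog:
  assumes s: "fst s 8 = int q" "snd s 6 = Zm" "snd s 7 = Ze" "1 \<le> q" "2 * q \<le> 2 ^ L"
    and len: "length Zm = q" "length Ze = q"
    and M: "2 * int q + 1 \<le> M" "\<And>x. x \<in> set Zm \<Longrightarrow> \<bar>x\<bar> + 1 \<le> M" "\<And>x. x \<in> set Ze \<Longrightarrow> 2 * \<bar>x\<bar> \<le> M"
  shows "runs M sort_prog s (q * (88 * L + 150) + 50) (\<lambda>s'. sorted_upto q q Zm Ze (snd s' 9) (snd s' 10))"
proof -
  have "runs M sort_prog s ((2 * q + 4) + ((q + 2) + ((q + 2) + ((q * (5 + 8) + 8) + (4 +
     (((q - 1) * ((4 + 80) + 8) + 8) + (q * ((20 + (88 * L + 4)) + 8) + 8))))))) (\<lambda>s'. sorted_upto q q Zm Ze (snd s' 9) (snd s' 10))"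
    unfolding sort_prog_def
  proof (rule runs_Seq[where R = "\<lambda>s'. s' = (fst s, (snd s)(8 := replicate (2 * q) 0))"], goal_cases)
    case 1
    show ?case by (rule runs_Alloc; use s M(1) in \<open>simp add: nat_mult_distrib\<close>)
  next
    case (2 s1)
    show ?case
    proof (rule runs_Seq[where R = "\<lambda>s'. s' = (fst s, (snd s)(8 := replicate (2 * q) 0, 9 := replicate q 0))"], goal_cases)
      case 1
      show ?case by (rule runs_Alloc; use s M(1) 2 in simp)
    next
      case (2 s2)
      show ?case
      proof (rule runs_Seq[where R = "\<lambda>s'. s' = (fst s, (snd s)(8 := replicate (2 * q) 0, 9 := replicate q 0, 10 := replicate q 0))"], goal_cases)
        case 1
        show ?case by (rule runs_Alloc; use s M(1) 2 in simp)
      next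
        case (2 s3)
        show ?case
        proof (rule runs_Seq, rule runs_leaves[where q = q], goal_cases)
          case (4 s4)
          then have s4: "fst s4 8 = int q" "snd s4 6 = Zm" "snd s4 7 = Ze" "snd s4 9 = replicate q 0"
            "snd s4 10 = replicate q 0" using 2 s by (auto simp: frame_def)
          show ?case
          proof (rule runs_Seq[where R = "\<lambda>s'. s' = ((fst s4)(16 := int (q - 1)), snd s4)"], goal_cases)
            case 1
            show ?case using s4 s M(1) by (intro runs_wp) (auto simp: of_nat_diff)
          next
            case (2 s5)
            show ?case
            proof (rule runs_Seq, rule runs_build[where q = q and Zm = Zm and Ze = Ze and R = "replicate q 0"], goal_cases)
              case (14 s6)
              show ?case
                by (rule runs_extract[OF _ _ _ s(4,5) _ _ _ _ len M])
                  (use 14 2 s4 in \<open>auto simp: frame_def\<close>)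
            qed (use 2 4 s4 s len M in auto)
          qed
        qed (use 2 s M(1) in auto)
      qed
    qed
  qed
  \<comment> \<open>The terms linear in \<open>q\<close> are 4 from the allocations, 13 from the
    leaves, 92 from the inner nodes and 32 from the extractions. Their sum 141 is rounded up to
    150.\<close>
  then show ?thesis by (rule runs_mono) (auto simp: algebra_simps)
qed

section \<open>Covering sums by maxima\<close>

text \<open>The factor \<open>G / l\<close> in units of \<open>1 / F\<close>, rounded up.\<close>

definition mult :: "int \<Rightarrow> int \<Rightarrow> int \<Rightarrow> int" where
  "mult F G l = (F * G + l - 1) div l"

lemma mult_bounds:
  assumes "0 < l"
  shows "F * G \<le> mult F G l * l" "mult F G l * l \<le> F * G + l - 1"
proof -
  have "mult F G l * l = F * G + l - 1 - (F * G + l - 1) mod l"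
    by (simp add: mult_def minus_mod_eq_div_mult)
  moreover have "0 \<le> (F * G + l - 1) mod l" "(F * G + l - 1) mod l < l" using assms by auto
  ultimately show "F * G \<le> mult F G l * l" "mult F G l * l \<le> F * G + l - 1" by linarith+
qed

lemma mult_ge_1:
  assumes "0 < l" "1 \<le> F" "1 \<le> G"
  shows "1 \<le> mult F G l"
proof -
  have "0 < F * G" using assms by simp
  then have "0 < mult F G l * l" using mult_bounds(1)[OF assms(1), of F G] by linarith
  then show ?thesis using assms(1) by (simp add: zero_less_mult_iff)
qed

text \<open>Bounds the growth of the mantissas under scaling, which the word limit has to
  accommodate. Equality occurs at \<open>l = 1\<close>.\<close>

lemma mult_le:
  assumes "0 < l" "1 \<le> F" "1 \<le> G"
  shows "mult F G l \<le> F * G"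
proof -
  have "0 \<le> (F * G - 1) * (l - 1)" using assms by (intro mult_nonneg_nonneg) auto
  then have "F * G + l - 1 \<le> F * G * l" by (simp add: algebra_simps)
  then have "mult F G l * l \<le> F * G * l" using mult_bounds(2)[OF assms(1), of F G] by linarith
  then show ?thesis using assms(1) by simp
qed

text \<open>If \<open>m\<close> is the maximum, then \<open>x \<le> m / \<alpha>\<close> and
  \<open>y \<le> m / \<beta>\<close>, and the two weights add up to at most 1.\<close>

lemma add_le_max_scaled:
  fixes x y \<alpha> \<beta> :: real
  assumes "0 \<le> x" "0 < \<alpha>" "0 < \<beta>" "1 / \<alpha> + 1 / \<beta> \<le> 1"
  shows "x + y \<le> max (x * \<alpha>) (y * \<beta>)"
proof -
  define m where "m = max (x * \<alpha>) (y * \<beta>)"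
  have "0 \<le> x * \<alpha>" using assms by simp
  then have "0 \<le> m" by (simp add: m_def le_max_iff_disj)
  have "x \<le> m / \<alpha>" "y \<le> m / \<beta>" using assms by (auto simp: m_def pos_le_divide_eq)
  then have "x + y \<le> m * (1 / \<alpha> + 1 / \<beta>)" by (simp add: algebra_simps)
  also have "\<dots> \<le> m * 1" using assms \<open>0 \<le> m\<close> by (intro mult_left_mono)
  finally show ?thesis by (simp add: m_def)
qed

text \<open>The weights \<open>F / mult F G l\<close> and \<open>F / mult F G (G - l)\<close> are at
  most \<open>l / G\<close> and \<open>(G - l) / G\<close>, which add up to 1. Rounding the
  multipliers up only decreases the weights, so no rounding error enters this direction.\<close>

lemma covering_lower:
  fixes x y :: real
  assumes "0 \<le> x" "1 \<le> F" "0 < l" "l < G"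
  shows "of_int F * (x + y) \<le> max (x * of_int (mult F G l)) (y * of_int (mult F G (G - l)))"
proof -
  have G: "0 < G - l" "1 \<le> G" using assms by auto
  have r: "of_int F * (x + y) \<le> max (x * of_int m1) (y * of_int m2)"
    if m: "1 \<le> m1" "1 \<le> m2" "F * G \<le> m1 * l" "F * G \<le> m2 * (G - l)" for m1 m2 :: int
  proof -
    have "real_of_int (F * G) \<le> of_int (m1 * l)" "real_of_int (F * G) \<le> of_int (m2 * (G - l))"
      using m by (simp_all only: of_int_le_iff)
    then have "real_of_int F / of_int m1 \<le> of_int l / of_int G" "real_of_int F / of_int m2 \<le> of_int (G - l) / of_int G"
      using m G by (simp_all add: field_simps)
    then have "real_of_int F / of_int m1 + real_of_int F / of_int m2 \<le> of_int l / of_int G + of_int (G - l) / of_int G" by simp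
    also have "\<dots> = 1" using G by (simp add: field_simps)
    finally have "x + y \<le> max (x * (of_int m1 / of_int F)) (y * (of_int m2 / of_int F))"
      using assms m by (intro add_le_max_scaled) auto
    then have "of_int F * (x + y) \<le> of_int F * max (x * (of_int m1 / of_int F)) (y * (of_int m2 / of_int F))"
      using assms by (intro mult_left_mono) auto
    also have "\<dots> = max (x * of_int m1) (y * of_int m2)"
      using assms by (subst max_mult_distrib_left) auto
    finally show ?thesis .
  qed
  show ?thesis using assms G mult_bounds(1) mult_ge_1 by (intro r) auto
qed

text \<open>There are two roundings. Replacing the ideal parameter by an integer \<open>l\<close>
  costs a factor \<open>1 + \<epsilon> / 3\<close>, and rounding the multipliers up costs a factor
  of about \<open>1 + 1 / F\<close>. Together they stay below \<open>1 + \<epsilon>\<close>.\<close>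

lemma covering_upper:
  fixes x y \<epsilon> :: real and F E G :: int
  assumes xy: "0 < x" "0 < y" and \<epsilon>: "0 < \<epsilon>" and E: "1 \<le> E" "1 / \<epsilon> \<le> of_int E" and G: "G = 6 * E + 2"
    and F: "4 \<le> F" "4 / \<epsilon> \<le> of_int F"
  shows "\<exists>l. 0 < l \<and> l < G \<and> x * of_int (mult F G l) \<le> of_int F * ((1 + \<epsilon>) * (x + y)) \<and>
    y * of_int (mult F G (G - l)) \<le> of_int F * ((1 + \<epsilon>) * (x + y))"
proof -
  \<comment> \<open>The ideal parameter: \<open>x * G / u\<close> and \<open>y * G / (G - u)\<close>
    both equal \<open>x + y\<close>.\<close>
  define u where "u = x * of_int G / (x + y)"
  have G0: "0 < real_of_int G" using E G by simp
  have u: "0 < u" using xy G0 by (simp add: u_def)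
  have uG: "u < of_int G"
  proof -
    have "x * of_int G < (x + y) * of_int G" using xy G0 by simp
    then show ?thesis using xy by (simp add: u_def field_simps)
  qed
  have E\<epsilon>: "1 \<le> of_int E * \<epsilon>" using E(2) \<epsilon> by (simp add: field_simps)
  have eG: "z + 1 \<le> (1 + \<epsilon> / 3) * z" if "3 * of_int E \<le> z" for z :: real
  proof -
    have "3 * of_int E * \<epsilon> \<le> z * \<epsilon>" using that \<epsilon> by (intro mult_right_mono) auto
    then show ?thesis using E\<epsilon> by (simp add: algebra_simps)
  qed
  have lge: "z \<le> (1 + \<epsilon> / 3) * z" if "0 \<le> z" for z :: real
  proof -
    have "0 \<le> \<epsilon> * z" using \<epsilon> that by simp
    then show ?thesis by (simp add: algebra_simps)
  qed
  obtain l where l: "0 < l" "l < G" "u \<le> (1 + \<epsilon> / 3) * of_int l" "of_int G - u \<le> (1 + \<epsilon> / 3) * of_int (G - l)"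
  \<comment> \<open>Rounding goes towards the midpoint \<open>3 * E + 1\<close> of \<open>G\<close>.
    The smaller of \<open>u\<close> and \<open>G - u\<close> then does not decrease, and the larger
    one loses less than 1 while staying at least \<open>3 * E\<close>, a relative loss of at most
    \<open>\<epsilon> / 3\<close> because \<open>E * \<epsilon> \<ge> 1\<close>.\<close>
  proof (cases "u \<le> of_int (3 * E + 1)")
    case True
    define l where "l = \<lceil>u\<rceil>"
    have 1: "0 < l" using u by (simp add: l_def)
    have 2: "l \<le> 3 * E + 1" using True by (simp only: l_def ceiling_le_iff)
    have 3: "u \<le> of_int l" "of_int l < u + 1" by (auto simp: l_def) linarith
    have 4: "3 * E \<le> G - l" using 2 G by simp
    have "of_int l \<le> (1 + \<epsilon> / 3) * of_int l" using 1 by (intro lge) simp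
    then have "u \<le> (1 + \<epsilon> / 3) * of_int l" using 3 by linarith
    moreover have "real_of_int (3 * E) \<le> of_int (G - l)" using 4 by (simp only: of_int_le_iff)
    then have "of_int (G - l) + 1 \<le> (1 + \<epsilon> / 3) * of_int (G - l)" by (intro eG) simp
    then have "of_int G - u \<le> (1 + \<epsilon> / 3) * of_int (G - l)" using 3 by simp
    moreover have "l < G" using 4 E by simp
    ultimately show thesis using that 1 by blast
  next
    case False
    define l where "l = \<lfloor>u\<rfloor>"
    have 1: "3 * E + 1 \<le> l" using False by (simp add: l_def le_floor_iff)
    have 2: "l < G" using uG by (simp add: l_def floor_less_iff)
    have 3: "of_int l \<le> u" "u < of_int l + 1" by (auto simp: l_def)
    have "real_of_int (3 * E + 1) \<le> of_int l" using 1 by (simp only: of_int_le_iff)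
    then have "of_int l + 1 \<le> (1 + \<epsilon> / 3) * of_int l" by (intro eG) simp
    then have "u \<le> (1 + \<epsilon> / 3) * of_int l" using 3 by simp
    moreover have "of_int (G - l) \<le> (1 + \<epsilon> / 3) * of_int (G - l)" using 2 by (intro lge) simp
    then have "of_int G - u \<le> (1 + \<epsilon> / 3) * of_int (G - l)" using 3 by simp
    moreover have "0 < l" using 1 E by simp
    ultimately show thesis using that 2 by blast
  qed
  have fin: "z * of_int (mult F G k) \<le> of_int F * ((1 + \<epsilon>) * (x + y))"
    if k: "0 < k" "k < G" and z: "0 < z" "z * of_int G \<le> (1 + \<epsilon> / 3) * of_int k * (x + y)" for z :: real and k
  proof -
    have F0: "0 < real_of_int F" using F by simp
    have "real_of_int (mult F G k * k) \<le> of_int (F * G + k - 1)"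
      using mult_bounds(2)[OF k(1)] by (simp only: of_int_le_iff)
    also have "\<dots> \<le> of_int ((F + 1) * G)"
      using k by (simp only: of_int_le_iff) (simp add: algebra_simps)
    finally have "z * (of_int (mult F G k) * of_int k) \<le> z * ((of_int F + 1) * of_int G)"
      using z by (intro mult_left_mono) auto
    also have "\<dots> = (of_int F + 1) * (z * of_int G)" by simp
    also have "\<dots> \<le> (of_int F + 1) * ((1 + \<epsilon> / 3) * of_int k * (x + y))"
      using F0 z by (intro mult_left_mono) auto
    finally have "(z * of_int (mult F G k)) * of_int k \<le> ((of_int F + 1) * ((1 + \<epsilon> / 3) * (x + y))) * of_int k"
      by (simp add: mult_ac)
    then have "z * of_int (mult F G k) \<le> (of_int F + 1) * ((1 + \<epsilon> / 3) * (x + y))"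
      using k by (subst (asm) mult_le_cancel_right_pos) auto
    also have "\<dots> = ((of_int F + 1) * (1 + \<epsilon> / 3)) * (x + y)" by simp
    also have "\<dots> \<le> (of_int F * (1 + \<epsilon>)) * (x + y)"
    proof (intro mult_right_mono)
      \<comment> \<open>Expanding the product leaves
        \<open>1 + \<epsilon> / 3 \<le> 2 / 3 * F * \<epsilon>\<close>. One third of
        \<open>F * \<epsilon>\<close> pays for the 1, the other for \<open>\<epsilon> / 3\<close>;
        this is why \<open>F\<close> is at least both 4 and \<open>4 / \<epsilon>\<close>.\<close>
      have "4 \<le> of_int F * \<epsilon>" using F(2) \<epsilon> by (simp add: field_simps)
      moreover have "4 * \<epsilon> \<le> of_int F * \<epsilon>" using F(1) \<epsilon> by (intro mult_right_mono) auto
      moreover have "(of_int F + 1) * (1 + \<epsilon> / 3) = of_int F + 1 + of_int F * \<epsilon> / 3 + \<epsilon> / 3"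
        "of_int F * (1 + \<epsilon>) = of_int F + of_int F * \<epsilon>" by (simp_all add: algebra_simps)
      ultimately show "(of_int F + 1) * (1 + \<epsilon> / 3) \<le> of_int F * (1 + \<epsilon>)" by linarith
    qed (use xy in auto)
    finally show ?thesis by simp
  qed
  have "x * of_int G \<le> (1 + \<epsilon> / 3) * of_int l * (x + y)"
    using l(3) xy by (simp add: u_def pos_divide_le_eq)
  moreover have "y * of_int G \<le> (1 + \<epsilon> / 3) * of_int (G - l) * (x + y)"
  proof -
    have "y * of_int G / (x + y) = of_int G - u" using xy by (simp add: u_def field_simps)
    then have "y * of_int G / (x + y) \<le> (1 + \<epsilon> / 3) * of_int (G - l)" using l(4) by simp
    then show ?thesis using xy by (simp add: pos_divide_le_eq)
  qed
  ultimately show ?thesis using fin[of l x] fin[of "G - l" y] l(1,2) xy by (intro exI[of _ l]) auto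
qed

section \<open>The minima that define the two convolutions\<close>

lemma conv_set_finite:
  "finite {f i j | i j. i < a \<and> j < b \<and> i + j = (k::nat)}"
proof -
  have "{f i j | i j. i < a \<and> j < b \<and> i + j = k} \<subseteq> (\<lambda>(i, j). f i j) ` ({..<a} \<times> {..<b})" by auto
  then show ?thesis by (rule finite_subset) auto
qed

lemma conv_set_nonempty:
  assumes "k < a + b - (1::nat)" "0 < a" "0 < b"
  shows "{f i j | i j. i < a \<and> j < b \<and> i + j = k} \<noteq> {}"
proof (cases "k < a")
  case True
  then have "f k 0 \<in> {f i j | i j. i < a \<and> j < b \<and> i + j = k}" using assms by (intro CollectI exI[of _ k] exI[of _ 0]) auto
  then show ?thesis by blast
next
  case False
  then have "f (a - 1) (k - (a - 1)) \<in> {f i j | i j. i < a \<and> j < b \<and> i + j = k}"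
    using assms by (intro CollectI exI[of _ "a - 1"] exI[of _ "k - (a - 1)"]) auto
  then show ?thesis by blast
qed

lemma min_plus_conv_le:
  "i < length A \<Longrightarrow> j < length B \<Longrightarrow> min_plus_conv A B (i + j) \<le> A ! i + B ! j"
  unfolding min_plus_conv_def by (rule Min_le[OF conv_set_finite]) blast

lemma min_max_conv_le:
  "i < length A \<Longrightarrow> j < length B \<Longrightarrow> min_max_conv A B (i + j) \<le> max (A ! i) (B ! j)"
  unfolding min_max_conv_def by (rule Min_le[OF conv_set_finite]) blast

lemma min_plus_conv_attained:
  assumes "k < length A + length B - 1" "A \<noteq> []" "B \<noteq> []"
  obtains i j where "i < length A" "j < length B" "i + j = k" "min_plus_conv A B k = A ! i + B ! j"
proof -
  have "min_plus_conv A B k \<in> {A ! i + B ! j | i j. i < length A \<and> j < length B \<and> i + j = k}"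
    unfolding min_plus_conv_def using assms by (intro Min_in conv_set_finite conv_set_nonempty) auto
  then show thesis using that by blast
qed

lemma min_max_conv_attained:
  assumes "k < length A + length B - 1" "A \<noteq> []" "B \<noteq> []"
  obtains i j where "i < length A" "j < length B" "i + j = k" "min_max_conv A B k = max (A ! i) (B ! j)"
proof -
  have "min_max_conv A B k \<in> {max (A ! i) (B ! j) | i j. i < length A \<and> j < length B \<and> i + j = k}"
    unfolding min_max_conv_def using assms by (intro Min_in conv_set_finite conv_set_nonempty) auto
  then show thesis using that by blast
qed


section \<open>Ranks in place of values, and scaled copies in blocks\<close>

lemma sorted_val_mono:
  assumes "sorted_upto q q Zm Ze R Od" "1 \<le> r" "r \<le> r'" "r' \<le> int q"
  shows "item_val Zm Ze (Od ! nat (r - 1)) \<le> item_val Zm Ze (Od ! nat (r' - 1))"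
  using assms unfolding sorted_upto_def by auto

lemma sorted_rank:
  assumes "sorted_upto q q Zm Ze R Od" "p < q"
  shows "1 \<le> R ! p" "R ! p \<le> int q" "Od ! nat (R ! p - 1) = int p"
  using sorted_upto_complete[OF assms] by auto

text \<open>The value is monotone in the rank and therefore commutes with the maximum. Equal values
  receive different ranks, which does no harm since ranks are translated back into values.\<close>

lemma sorted_val_max_rank:
  assumes "sorted_upto q q Zm Ze R Od" "p < q" "p' < q"
  shows "item_val Zm Ze (Od ! nat (max (R ! p) (R ! p') - 1)) = max (item_val Zm Ze (int p)) (item_val Zm Ze (int p'))"
  using sorted_val_mono[OF assms(1), of "R ! p" "R ! p'"] sorted_val_mono[OF assms(1), of "R ! p'" "R ! p"]
    sorted_rank[OF assms(1,2)] sorted_rank[OF assms(1,3)]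
  by (auto simp: max_def)

text \<open>Two remainders below \<open>n\<close> add up to less than \<open>2 * n\<close>, so
  nothing carries over between blocks, and block numbers and positions inside a block can be read
  off separately. This is the purpose of the block length \<open>2 * n\<close>.\<close>

lemma block_decompose:
  fixes n p p' b k :: nat
  assumes "0 < n" "p + p' = b * (2 * n) + k" "k < 2 * n - 1" "p mod (2 * n) < n" "p' mod (2 * n) < n"
  shows "p div (2 * n) + p' div (2 * n) = b" "p mod (2 * n) + p' mod (2 * n) = k"
proof -
  define x where "x = p div (2 * n) + p' div (2 * n)"
  define y where "y = p mod (2 * n) + p' mod (2 * n)"
  have y: "y < 2 * n" using assms by (simp add: y_def)
  have "p + p' = (p div (2 * n) * (2 * n) + p mod (2 * n)) + (p' div (2 * n) * (2 * n) + p' mod (2 * n))"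
    by (simp only: div_mult_mod_eq)
  then have "x * (2 * n) + y = b * (2 * n) + k" using assms(2) by (simp add: x_def y_def algebra_simps)
  then have "(x * (2 * n) + y) div (2 * n) = (b * (2 * n) + k) div (2 * n)"
    "(x * (2 * n) + y) mod (2 * n) = (b * (2 * n) + k) mod (2 * n)" by simp_all
  then show "p div (2 * n) + p' div (2 * n) = b" "p mod (2 * n) + p' mod (2 * n) = k"
    using y assms by (simp_all add: x_def y_def)
qed

text \<open>The second half of each block is padding with mantissa 0, that is, infinity. The offset
  \<open>off\<close> lets both block sequences share one array, so that their ranks are
  comparable.\<close>

definition scaled_blocks :: "int \<Rightarrow> int \<Rightarrow> (int \<times> int) list \<Rightarrow> nat \<Rightarrow> int list \<Rightarrow> int list \<Rightarrow> nat \<Rightarrow> bool" where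
  "scaled_blocks F G A m Zm Ze off \<longleftrightarrow> (\<forall>p<m. let i = p mod (2 * length A) in
     if i < length A then Zm ! (off + p) = fst (A ! i) * mult F G (int (p div (2 * length A)) + 1) \<and>
       Ze ! (off + p) = snd (A ! i)
     else Zm ! (off + p) = 0 \<and> Ze ! (off + p) = 0)"

lemma fp_real_scale: "fp_real (a * m, e) = fp_real (a, e) * of_int m"
  by (simp add: fp_real_def)

lemma fp_value_RplusD:
  assumes "fp_value ` set A \<subseteq> Rplus" "i < length A"
  shows "0 \<le> fst (A ! i)" "fst (A ! i) \<noteq> 0 \<Longrightarrow> 0 < fp_real (A ! i)"
proof -
  have "fp_value (A ! i) \<in> Rplus" using assms by auto
  then have *: "fst (A ! i) = 0 \<or> 1 \<le> fp_real (A ! i)" by (auto simp: fp_value_def Rplus_def split: if_splits)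
  then show "fst (A ! i) \<noteq> 0 \<Longrightarrow> 0 < fp_real (A ! i)" by auto
  show "0 \<le> fst (A ! i)"
  proof (rule ccontr)
    assume "\<not> 0 \<le> fst (A ! i)"
    then have "fp_real (A ! i) < 0" by (simp add: fp_real_def mult_neg_pos)
    then show False using * \<open>\<not> 0 \<le> fst (A ! i)\<close> by auto
  qed
qed

text \<open>Block \<open>b\<close> of either sequence is scaled by \<open>mult F G (b + 1)\<close>. The two copies that meet in the
  window starting at \<open>(G - 2) * 2n\<close> are those of blocks \<open>l - 1\<close> and \<open>G - l - 1\<close>.\<close>

lemma min_max_blocks_approx:
  fixes A B :: "(int \<times> int) list" and \<epsilon> :: real
  assumes n: "length A = n" "length B = n" "1 \<le> n"
    and AB: "fp_value ` set A \<subseteq> Rplus" "fp_value ` set B \<subseteq> Rplus"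
    and \<epsilon>: "0 < \<epsilon>" and E: "1 \<le> E" "1 / \<epsilon> \<le> of_int E" and G: "G = 6 * E + 2"
    and F: "F = 2 ^ f" "4 \<le> F" "4 / \<epsilon> \<le> of_int F"
    and m: "m = nat (G - 1) * (2 * n)"
    and Z: "scaled_blocks F G A m Zm Ze 0" "scaled_blocks F G B m Zm Ze m"
    and S: "sorted_upto (2 * m) (2 * m) Zm Ze R Od"
    and A': "length A' = m" "\<And>p. p < m \<Longrightarrow> A' ! p = (if 0 < Zm ! p then R ! p else 0)"
    and B': "length B' = m" "\<And>p. p < m \<Longrightarrow> B' ! p = (if 0 < Zm ! (m + p) then R ! (m + p) else 0)"
    and Out: "is_min_max_conv (map int_value A') (map int_value B') (map int_value Out)"
    and C: "length Cm = 2 * n - 1" "length Ce = 2 * n - 1"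
      "\<And>k. k < 2 * n - 1 \<Longrightarrow> 0 < Out ! (m - 2 * n + k) \<Longrightarrow>
        Cm ! k = Zm ! nat (Od ! nat (Out ! (m - 2 * n + k) - 1)) \<and>
        Ce ! k = Ze ! nat (Od ! nat (Out ! (m - 2 * n + k) - 1)) - int f"
      "\<And>k. k < 2 * n - 1 \<Longrightarrow> \<not> 0 < Out ! (m - 2 * n + k) \<Longrightarrow> Cm ! k = 0"
  shows "is_approx_min_plus_conv \<epsilon> (map fp_value A) (map fp_value B) (map fp_value (zip Cm Ce))"
proof -
  define g where "g = nat (G - 2)"
  have g: "nat (G - 1) = Suc g" "G = int g + 2" using E G by (auto simp: g_def)
  have m2: "m - 2 * n = g * (2 * n)" "m = Suc g * (2 * n)" using m g by auto
  have m0: "0 < m" using m2 n by simp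
  have F0: "0 < real_of_int F" using F by simp
  have ZA: "Zm ! p = fst (A ! (p mod (2 * n))) * mult F G (int (p div (2 * n)) + 1)"
    "Ze ! p = snd (A ! (p mod (2 * n)))" if "p < m" "p mod (2 * n) < n" for p
    using Z(1) that n unfolding scaled_blocks_def by (auto simp: Let_def)
  have ZA0: "Zm ! p = 0" if "p < m" "\<not> p mod (2 * n) < n" for p
    using Z(1) that n unfolding scaled_blocks_def by (auto simp: Let_def)
  have ZB: "Zm ! (m + p) = fst (B ! (p mod (2 * n))) * mult F G (int (p div (2 * n)) + 1)"
    "Ze ! (m + p) = snd (B ! (p mod (2 * n)))" if "p < m" "p mod (2 * n) < n" for p
    using Z(2) that n unfolding scaled_blocks_def by (auto simp: Let_def)
  have ZB0: "Zm ! (m + p) = 0" if "p < m" "\<not> p mod (2 * n) < n" for p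
    using Z(2) that n unfolding scaled_blocks_def by (auto simp: Let_def)
  have vA: "item_val Zm Ze (int p) = fp_real (A ! (p mod (2 * n))) * of_int (mult F G (int (p div (2 * n)) + 1))"
    if "p < m" "p mod (2 * n) < n" for p
    using ZA[OF that] by (simp add: item_val_def fp_real_scale)
  have vB: "item_val Zm Ze (int (m + p)) = fp_real (B ! (p mod (2 * n))) * of_int (mult F G (int (p div (2 * n)) + 1))"
    if "p < m" "p mod (2 * n) < n" for p
    using ZB[OF that] by (simp add: item_val_def fp_real_scale nat_int_add)
  have lenOut: "length Out = 2 * m - 1" using Out A'(1) B'(1) by (simp add: is_min_max_conv_def)
  have out: "int_value (Out ! k) = min_max_conv (map int_value A') (map int_value B') k" if "k < 2 * m - 1" for k
    using Out that lenOut by (simp add: is_min_max_conv_def)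
  have mult1: "1 \<le> mult F G (int b + 1)" for b
    using F E G by (intro mult_ge_1) auto
  have window: "g * (2 * n) + k < 2 * m - 1" if "k < 2 * n - 1" for k
    using that m2(2) n by simp
  \<comment> \<open>Soundness: a finite entry of the window is the maximum of two finite ranks.
    Finiteness excludes the padding on both sides, after which \<open>block_decompose\<close> shows
    that the two copies are partners \<open>l\<close> and \<open>G - l\<close>. Positivity of
    \<open>r\<close> follows because it equals one of the ranks.\<close>
  have found: "\<exists>i j l. i < n \<and> j < n \<and> i + j = k \<and> 0 < l \<and> l < G \<and>
      fst (A ! i) \<noteq> 0 \<and> fst (B ! j) \<noteq> 0 \<and> 1 \<le> r \<and> r \<le> int (2 * m) \<and>
      item_val Zm Ze (Od ! nat (r - 1)) = max (fp_real (A ! i) * of_int (mult F G l)) (fp_real (B ! j) * of_int (mult F G (G - l)))"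
    if k: "k < 2 * n - 1" and r: "r = Out ! (g * (2 * n) + k)" "r \<noteq> 0" for k r
  proof -
    obtain p p' where p: "p < m" "p' < m" "p + p' = g * (2 * n) + k"
      and mx: "int_value r = max (map int_value A' ! p) (map int_value B' ! p')"
    proof -
      have "g * (2 * n) + k < length (map int_value A') + length (map int_value B') - 1"
        using window[OF k] A'(1) B'(1) by (simp add: mult_2)
      moreover have "map int_value A' \<noteq> []" "map int_value B' \<noteq> []" using A'(1) B'(1) m0 by auto
      ultimately obtain p p' where "p < length (map int_value A')" "p' < length (map int_value B')"
        "p + p' = g * (2 * n) + k"
        "min_max_conv (map int_value A') (map int_value B') (g * (2 * n) + k) = max (map int_value A' ! p) (map int_value B' ! p')"
        by (rule min_max_conv_attained)
      then show thesis using that[of p p'] out[OF window[OF k]] A'(1) B'(1) r(1) by simp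
    qed
    have mx: "int_value r = max (int_value (A' ! p)) (int_value (B' ! p'))" using mx p A'(1) B'(1) by simp
    have nz: "A' ! p \<noteq> 0" "B' ! p' \<noteq> 0" using mx r(2) by (auto simp: int_value_def split: if_splits)
    then have pos: "0 < Zm ! p" "0 < Zm ! (m + p')" and rank: "A' ! p = R ! p" "B' ! p' = R ! (m + p')"
      using A'(2)[OF p(1)] B'(2)[OF p(2)] by (auto split: if_splits)
    have lt: "p mod (2 * n) < n" "p' mod (2 * n) < n"
      using ZA0[OF p(1)] ZB0[OF p(2)] pos by force+
    have dec: "p div (2 * n) + p' div (2 * n) = g" "p mod (2 * n) + p' mod (2 * n) = k"
      using block_decompose[OF _ p(3) k lt] n by auto
    define l where "l = int (p div (2 * n)) + 1"
    have l: "0 < l" "l < G" "int (p' div (2 * n)) + 1 = G - l" using dec(1) g(2) by (auto simp: l_def)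
    have q: "p < 2 * m" "m + p' < 2 * m" using p by auto
    have r': "r = max (R ! p) (R ! (m + p'))"
      using mx nz r(2) rank by (auto simp: int_value_def max_def split: if_splits)
    then have "item_val Zm Ze (Od ! nat (r - 1)) = max (item_val Zm Ze (int p)) (item_val Zm Ze (int (m + p')))"
      using sorted_val_max_rank[OF S q] by simp
    then have "item_val Zm Ze (Od ! nat (r - 1)) = max (fp_real (A ! (p mod (2 * n))) * of_int (mult F G l))
        (fp_real (B ! (p' mod (2 * n))) * of_int (mult F G (G - l)))"
      using vA[OF p(1) lt(1)] vB[OF p(2) lt(2)] l(3) by (simp add: l_def)
    moreover have "1 \<le> r" "r \<le> int (2 * m)" using r' sorted_rank[OF S q(1)] sorted_rank[OF S q(2)] by auto
    moreover have "fst (A ! (p mod (2 * n))) \<noteq> 0" "fst (B ! (p' mod (2 * n))) \<noteq> 0"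
      using pos ZA(1)[OF p(1) lt(1)] ZB(1)[OF p(2) lt(2)] by auto
    ultimately show ?thesis using lt dec(2) l(1,2) by blast
  qed
  \<comment> \<open>\<open>F\<close> being \<open>2 ^ f\<close>, subtracting \<open>f\<close> from
    the exponent divides by \<open>F\<close> exactly, so the output introduces no further
    error.\<close>
  have Cval: "fp_real (Cm ! k, Ce ! k) = item_val Zm Ze (Od ! nat (r - 1)) / of_int F"
    if k: "k < 2 * n - 1" and r: "r = Out ! (g * (2 * n) + k)" "1 \<le> r" for k r
  proof -
    have "Cm ! k = Zm ! nat (Od ! nat (r - 1))" "Ce ! k = Ze ! nat (Od ! nat (r - 1)) - int f"
      using C(3)[OF k] r m2(1) by auto
    then show ?thesis by (simp add: item_val_def fp_real_def F(1) power_int_diff)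
  qed
  have "min_plus_conv (map fp_value A) (map fp_value B) k \<le> fp_value (Cm ! k, Ce ! k) \<and>
      fp_value (Cm ! k, Ce ! k) \<le> ereal (1 + \<epsilon>) * min_plus_conv (map fp_value A) (map fp_value B) k"
    if k: "k < 2 * n - 1" for k
  proof
    define r where "r = Out ! (g * (2 * n) + k)"
    show "min_plus_conv (map fp_value A) (map fp_value B) k \<le> fp_value (Cm ! k, Ce ! k)"
    proof (cases "Cm ! k = 0")
      case True
      then show ?thesis by (simp add: fp_value_def)
    next
      case False
      then have r0: "0 < r" using C(4)[OF k] m2(1) by (auto simp: r_def)
      obtain i j l where f: "i < n" "j < n" "i + j = k" "0 < l" "l < G" "fst (A ! i) \<noteq> 0" "fst (B ! j) \<noteq> 0"
        "item_val Zm Ze (Od ! nat (r - 1)) = max (fp_real (A ! i) * of_int (mult F G l)) (fp_real (B ! j) * of_int (mult F G (G - l)))"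
        using found[OF k r_def] r0 by auto
      have "0 < fp_real (A ! i)" "0 < fp_real (B ! j)" using fp_value_RplusD(2)[OF AB(1)] fp_value_RplusD(2)[OF AB(2)] f n by auto
      then have "of_int F * (fp_real (A ! i) + fp_real (B ! j)) \<le> item_val Zm Ze (Od ! nat (r - 1))"
        unfolding f(8) using F(2) f by (intro covering_lower) auto
      then have "fp_real (A ! i) + fp_real (B ! j) \<le> fp_real (Cm ! k, Ce ! k)"
        using Cval[OF k r_def] r0 F0 by (simp add: pos_le_divide_eq mult.commute)
      moreover have "min_plus_conv (map fp_value A) (map fp_value B) (i + j) \<le> map fp_value A ! i + map fp_value B ! j"
        using f n by (intro min_plus_conv_le) auto
      ultimately show ?thesis using f n False by (auto simp: fp_value_def intro: order_trans)
    qed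
    obtain i j where ij: "i < n" "j < n" "i + j = k"
      "min_plus_conv (map fp_value A) (map fp_value B) k = fp_value (A ! i) + fp_value (B ! j)"
    proof -
      have "map fp_value A \<noteq> []" "map fp_value B \<noteq> []" "k < length (map fp_value A) + length (map fp_value B) - 1"
        using n k by auto
      then show thesis using min_plus_conv_attained[of k "map fp_value A" "map fp_value B"] that n by auto
    qed
    show "fp_value (Cm ! k, Ce ! k) \<le> ereal (1 + \<epsilon>) * min_plus_conv (map fp_value A) (map fp_value B) k"
    proof (cases "fst (A ! i) = 0 \<or> fst (B ! j) = 0")
      case True
      then have "min_plus_conv (map fp_value A) (map fp_value B) k = \<infinity>" unfolding ij(4) by (auto simp: fp_value_def)
      then show ?thesis using \<epsilon> by simp
    next
      \<comment> \<open>Completeness: \<open>covering_upper\<close> provides a good \<open>l\<close>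
        for the optimal pair \<open>(i, j)\<close>. Its two scaled copies meet in the window, so the
        output there is at most the maximum of their ranks.\<close>
      case False
      have xy: "0 < fp_real (A ! i)" "0 < fp_real (B ! j)"
        using fp_value_RplusD(2)[OF AB(1)] fp_value_RplusD(2)[OF AB(2)] ij False n by auto
      obtain l where l: "0 < l" "l < G"
        "fp_real (A ! i) * of_int (mult F G l) \<le> of_int F * ((1 + \<epsilon>) * (fp_real (A ! i) + fp_real (B ! j)))"
        "fp_real (B ! j) * of_int (mult F G (G - l)) \<le> of_int F * ((1 + \<epsilon>) * (fp_real (A ! i) + fp_real (B ! j)))"
        using covering_upper[OF xy \<epsilon> E G F(2,3)] by blast
      define b where "b = nat (l - 1)"
      have b: "int b + 1 = l" "int (g - b) + 1 = G - l" "b \<le> g" using l g(2) by (auto simp: b_def)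
      define p where "p = b * (2 * n) + i"
      define p' where "p' = (g - b) * (2 * n) + j"
      have pd: "p mod (2 * n) = i" "p div (2 * n) = b" "p' mod (2 * n) = j" "p' div (2 * n) = g - b"
        using ij by (simp_all add: p_def p'_def)
      have pm: "p < m" "p' < m"
      proof -
        have "b * (2 * n) \<le> g * (2 * n)" "(g - b) * (2 * n) \<le> g * (2 * n)" using b(3) by (intro mult_right_mono; simp)+
        moreover have "m = g * (2 * n) + 2 * n" using m2(2) by simp
        ultimately show "p < m" "p' < m" using ij(1,2) unfolding p_def p'_def by linarith+
      qed
      have "b * (2 * n) + (g - b) * (2 * n) = g * (2 * n)" using b(3) by (simp add: distrib_right[symmetric] del: mult_Suc)
      then have sum: "p + p' = g * (2 * n) + k" using ij(3) by (simp add: p_def p'_def)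
      have pos: "0 < Zm ! p" "0 < Zm ! (m + p')"
      proof -
        have "0 < fst (A ! i)" "0 < fst (B ! j)"
          using fp_value_RplusD(1)[OF AB(1)] fp_value_RplusD(1)[OF AB(2)] ij False n by (auto simp: less_le)
        then show "0 < Zm ! p" "0 < Zm ! (m + p')"
          using ZA(1)[OF pm(1)] ZB(1)[OF pm(2)] pd ij mult1[of b] mult1[of "g - b"] by auto
      qed
      have q: "p < 2 * m" "m + p' < 2 * m" using pm by auto
      have "int_value r \<le> max (map int_value A' ! p) (map int_value B' ! p')"
        using min_max_conv_le[of p "map int_value A'" p' "map int_value B'"] out[OF window[OF k]] pm A'(1) B'(1)
        by (simp add: sum r_def)
      also have "\<dots> = max (int_value (R ! p)) (int_value (R ! (m + p')))"
        using A' B' pm pos by simp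
      also have "\<dots> = ereal (of_int (max (R ! p) (R ! (m + p'))))"
        using sorted_rank(1)[OF S q(1)] sorted_rank(1)[OF S q(2)] by (auto simp: int_value_def max_def)
      finally have le: "int_value r \<le> ereal (of_int (max (R ! p) (R ! (m + p'))))" .
      then have r0: "r \<noteq> 0" by (auto simp: int_value_def)
      then have r: "r \<le> max (R ! p) (R ! (m + p'))" using le by (simp add: int_value_def)
      have r1: "1 \<le> r" using found[OF k r_def r0] by blast
      have "item_val Zm Ze (Od ! nat (r - 1)) \<le> item_val Zm Ze (Od ! nat (max (R ! p) (R ! (m + p')) - 1))"
        using sorted_rank(2)[OF S q(1)] sorted_rank(2)[OF S q(2)] r r1 by (intro sorted_val_mono[OF S]) auto
      also have "\<dots> = max (item_val Zm Ze (int p)) (item_val Zm Ze (int (m + p')))"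
        by (rule sorted_val_max_rank[OF S q])
      also have "\<dots> \<le> of_int F * ((1 + \<epsilon>) * (fp_real (A ! i) + fp_real (B ! j)))"
        using vA[OF pm(1)] vB[OF pm(2)] pd ij b l by simp
      finally have "fp_real (Cm ! k, Ce ! k) \<le> (1 + \<epsilon>) * (fp_real (A ! i) + fp_real (B ! j))"
        using Cval[OF k r_def r1] F0 by (simp add: pos_divide_le_eq mult.commute)
      \<comment> \<open>Mantissa 0 would be read as infinity, and then the bound on
        \<open>fp_real\<close> would say nothing about \<open>fp_value\<close>. The entry is nonzero
        because its value is a maximum involving a positive number.\<close>
      moreover have "Cm ! k \<noteq> 0"
      proof -
        obtain i' j' l' where f: "i' < n" "fst (A ! i') \<noteq> 0" "0 < l'"
          "item_val Zm Ze (Od ! nat (r - 1)) = max (fp_real (A ! i') * of_int (mult F G l')) (fp_real (B ! j') * of_int (mult F G (G - l')))"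
          using found[OF k r_def r0] by blast
        have "0 < fp_real (A ! i')" using fp_value_RplusD(2)[OF AB(1)] f n by auto
        moreover have "1 \<le> mult F G l'" using f F E G by (intro mult_ge_1) auto
        ultimately have "0 < fp_real (A ! i') * of_int (mult F G l')" by simp
        then have "0 < item_val Zm Ze (Od ! nat (r - 1))" unfolding f(4) by simp
        then have "0 < fp_real (Cm ! k, Ce ! k)" using Cval[OF k r_def r1] F0 by simp
        then show ?thesis by (auto simp: fp_real_def)
      qed
      ultimately show ?thesis unfolding ij(4) using False by (simp add: fp_value_def)
    qed
  qed
  then show ?thesis unfolding is_approx_min_plus_conv_def using n C(1,2) by auto
qed

section \<open>From exact min-max to approximate min-plus convolution\<close>

text \<open>Registers 3 to 8 hold \<open>F\<close>, \<open>f\<close> with \<open>F = 2 ^ f\<close>, \<open>G\<close>, \<open>2n\<close>, the length \<open>m\<close> of the block sequences and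
  \<open>2m\<close>. The input and output of the embedded min-max program are in registers and arrays from 20 on.\<close>

definition prep :: com where
  "prep =
    Seq (If (Less (V 2) (N 0))
          (Seq (Assign 3 (Bin Shl (N 1) (Bin Minus (N 0) (V 2)))) (Assign 4 (Bin Minus (N 2) (V 2))))
          (Seq (Assign 3 (N 1)) (Assign 4 (N 2))))
   (Seq (Assign 5 (Bin Plus (Bin Times (N 6) (Bin Plus (Bin Div (V 3) (V 1)) (N 1))) (N 2)))
   (Seq (Assign 3 (Bin Times (N 4) (V 3)))
   (Seq (Assign 6 (Bin Times (N 2) (V 0)))
   (Seq (Assign 7 (Bin Times (Bin Minus (V 5) (N 1)) (V 6)))
        (Assign 8 (Bin Times (N 2) (V 7)))))))"

text \<open>Position \<open>p\<close> of both block sequences is written in one pass since both use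
  the same multiplier in the same block. The copy of \<open>B\<close> goes to the second half of the
  arrays, so that a single sort ranks everything. Padding stays at the zeros of the
  allocation.\<close>

definition fill_body :: com where
  "fill_body =
    Seq (Assign 10 (Bin Mod (V 9) (V 6)))
   (If (Less (V 10) (V 0))
     (Seq (Assign 11 (Bin Plus (Bin Div (V 9) (V 6)) (N 1)))
     (Seq (Assign 11 (Bin Div (Bin Minus (Bin Plus (Bin Times (V 3) (V 5)) (V 11)) (N 1)) (V 11)))
     (Seq (Store 6 (V 9) (Bin Times (Get 0 (V 10)) (V 11)))
     (Seq (Store 7 (V 9) (Get 1 (V 10)))
     (Seq (Store 6 (Bin Plus (V 7) (V 9)) (Bin Times (Get 2 (V 10)) (V 11)))
          (Store 7 (Bin Plus (V 7) (V 9)) (Get 3 (V 10))))))))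
     Skip)"

definition fill :: com where
  "fill = Seq (Alloc 6 (V 8)) (Seq (Alloc 7 (V 8)) (For 9 7 fill_body))"

text \<open>The sort also ranks the entries with mantissa 0, as the smallest ones. They are skipped
  here and keep the value 0, which the min-max program reads as infinity.\<close>

definition ranks_body :: com where
  "ranks_body =
    Seq (If (Less (N 0) (Get 6 (V 9))) (Store 20 (V 9) (Get 9 (V 9))) Skip)
      (If (Less (N 0) (Get 6 (Bin Plus (V 7) (V 9)))) (Store 21 (V 9) (Get 9 (Bin Plus (V 7) (V 9)))) Skip)"

definition ranks :: com where
  "ranks = Seq (Alloc 20 (V 7)) (Seq (Alloc 21 (V 7)) (Seq (For 9 7 ranks_body) (Assign 20 (V 7))))"

text \<open>Array 22 is the output of the subroutine, and register 14 is the start of the window. A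
  positive rank is turned back into an item (ranks start at 1, positions at 0), and subtracting
  register 4 from its exponent undoes the scaling by \<open>F\<close>.\<close>

definition emit_body :: com where
  "emit_body =
    Seq (Assign 10 (Get 22 (Bin Plus (V 14) (V 9))))
     (If (Less (N 0) (V 10))
       (Seq (Assign 10 (Get 10 (Bin Minus (V 10) (N 1))))
       (Seq (Store 4 (V 9) (Get 6 (V 10)))
            (Store 5 (V 9) (Bin Minus (Get 7 (V 10)) (V 4)))))
       Skip)"

definition emit :: com where
  "emit = Seq (Assign 16 (Bin Minus (V 6) (N 1))) (Seq (Alloc 4 (V 16)) (Seq (Alloc 5 (V 16))
     (Seq (Assign 14 (Bin Minus (V 7) (V 6))) (For 9 16 emit_body))))"

lemma wr_approx_parts [simp]:
  "wregs prep = {3, 4, 5, 6, 7, 8}" "wregs fill_body = {10, 11}" "wregs fill = {9, 10, 11}"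
  "wregs ranks_body = {}" "wregs ranks = {9, 20}" "wregs emit_body = {10}" "wregs emit = {9, 10, 14, 16}"
  by (auto simp: prep_def fill_body_def fill_def ranks_body_def ranks_def emit_body_def emit_def)

lemma wa_approx_parts [simp]:
  "warrs prep = {}" "warrs fill_body = {6, 7}" "warrs fill = {6, 7}"
  "warrs ranks_body = {20, 21}" "warrs ranks = {20, 21}" "warrs emit_body = {4, 5}" "warrs emit = {4, 5}"
  by (auto simp: prep_def fill_body_def fill_def ranks_body_def ranks_def emit_body_def emit_def)

section \<open>Correctness and cost of the phases of the first reduction\<close>

lemma runs_prep:
  assumes s: "fst s 0 = int n" "fst s 1 = me" "fst s 2 = ee" and me: "0 < me" and n: "1 \<le> n"
    and F0: "F0 = 2 ^ nat (- ee)" and G: "G = 6 * (F0 div me + 1) + 2" and m: "m = nat (G - 1) * (2 * n)"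
    and M: "2 + \<bar>ee\<bar> \<le> M" "4 * F0 \<le> M" "G \<le> M" "2 * int m \<le> M" "2 * int n \<le> M"
  shows "runs M prep s 60 (\<lambda>s'. fst s' 3 = 4 * F0 \<and> fst s' 4 = int (nat (- ee) + 2) \<and> fst s' 5 = G \<and>
     fst s' 6 = int (2 * n) \<and> fst s' 7 = int m \<and> fst s' 8 = int (2 * m))"
proof -
  have F0': "1 \<le> F0" by (simp add: F0)
  have d: "0 \<le> F0 div me" "F0 div me \<le> F0"
    using me F0' by (auto simp: pos_imp_zdiv_nonneg_iff) (use zdiv_mono2[of F0 1 me] in simp)
  define D where "D = F0 div me"
  have D: "0 \<le> D" "D + 1 \<le> M" "6 * (D + 1) \<le> M" "G = 6 * (D + 1) + 2" "D \<le> M" "8 \<le> M"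
    using d M G by (auto simp: D_def)
  have im: "int m = (G - 1) * (2 * int n)" using D by (simp add: m)
  have im': "0 \<le> (G - 1) * (2 * int n)" "(G - 1) * (2 * int n) \<le> M" "2 * ((G - 1) * (2 * int n)) \<le> M"
    using M(4) unfolding im[symmetric] by auto
  have G1: "0 \<le> G - 1" "G - 1 \<le> M" "0 \<le> G" using D M by auto
  have b: "\<bar>6 * (D + 1)\<bar> \<le> M" "\<bar>6 * (D + 1) + 2\<bar> \<le> M" "\<bar>D\<bar> \<le> M" "\<bar>D + 1\<bar> \<le> M" "\<bar>4 * F0\<bar> \<le> M" "\<bar>F0\<bar> \<le> M" "\<bar>2 * int n\<bar> \<le> M"
    "\<bar>G - 1\<bar> \<le> M" "\<bar>(G - 1) * (2 * int n)\<bar> \<le> M" "\<bar>2 * ((G - 1) * (2 * int n))\<bar> \<le> M"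
    "\<bar>2 - ee\<bar> \<le> M" "\<bar>0 - ee\<bar> \<le> M" "\<bar>- ee\<bar> \<le> M" "\<bar>ee\<bar> \<le> M"
    using D M im' G1 F0' by auto
  have c: "6 \<le> M" "4 \<le> M" "2 \<le> M" "1 \<le> M" "0 \<le> M" using D by auto
  have "G - 1 = 1 + 6 * (D + 1)" "2 * ((G - 1) * (2 * int n)) = 4 * ((1 + 6 * (D + 1)) * int n)"
    unfolding D(4) by simp_all
  then have b': "\<bar>1 + 6 * (D + 1)\<bar> \<le> M" "\<bar>(1 + 6 * (D + 1)) * (2 * int n)\<bar> \<le> M"
    "\<bar>4 * ((1 + 6 * (D + 1)) * int n)\<bar> \<le> M" "2 * int n \<le> M"
    using b M(5) by metis+
  have "wp M prep (\<lambda>s'. fst s' 3 = 4 * F0 \<and> fst s' 4 = int (nat (- ee) + 2) \<and> fst s' 5 = 6 * (D + 1) + 2 \<and>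
     fst s' 6 = 2 * int n \<and> fst s' 7 = (6 * (D + 1) + 2 - 1) * (2 * int n) \<and> fst s' 8 = 2 * ((6 * (D + 1) + 2 - 1) * (2 * int n))) s"
  proof (cases "ee < 0")
    case True
    then have "2 ^ nat (- ee) = F0" "ee \<le> 0" "- ee \<le> M" "2 - ee \<le> M" using M(1) by (simp_all add: F0)
    then show ?thesis unfolding prep_def
      by (simp add: s b b' c me[THEN less_imp_neq, symmetric] D_def[symmetric] True
          del: One_nat_def int_distrib add_uminus_conv_diff diff_numeral_simps left_diff_distrib_numeral
          right_diff_distrib_numeral distrib_left_numeral distrib_right_numeral)
  next
    case False
    then have F1: "F0 = 1" by (simp add: F0)
    have D1': "nat (- ee) = 0" "ee \<le> 0 \<longleftrightarrow> ee = 0" using False by auto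
    from F1 have D1: "1 div me = D" by (simp add: D_def)
    show ?thesis unfolding prep_def
      by (simp add: s b b' c me[THEN less_imp_neq, symmetric] F1 D1 D1' False
          del: One_nat_def int_distrib add_uminus_conv_diff diff_numeral_simps left_diff_distrib_numeral
          right_diff_distrib_numeral distrib_left_numeral distrib_right_numeral)
  qed
  then show ?thesis
    by (rule runs_mono[OF runs_scost], simp add: prep_def) (use im D(4) in auto)
qed

definition block_mant :: "int \<Rightarrow> int \<Rightarrow> (int \<times> int) list \<Rightarrow> nat \<Rightarrow> int" where
  "block_mant F G A p = (if p mod (2 * length A) < length A
     then fst (A ! (p mod (2 * length A))) * mult F G (int (p div (2 * length A)) + 1) else 0)"

definition block_exp :: "(int \<times> int) list \<Rightarrow> nat \<Rightarrow> int" where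
  "block_exp A p = (if p mod (2 * length A) < length A then snd (A ! (p mod (2 * length A))) else 0)"

lemma scaled_blocksI:
  assumes "\<And>p. p < m \<Longrightarrow> Zm ! (off + p) = block_mant F G A p \<and> Ze ! (off + p) = block_exp A p"
  shows "scaled_blocks F G A m Zm Ze off"
  using assms unfolding scaled_blocks_def block_mant_def block_exp_def by (auto simp: Let_def)

lemma runs_fill:
  assumes s: "fst s 0 = int n" "fst s 3 = F" "fst s 5 = G" "fst s 6 = int (2 * n)" "fst s 7 = int m" "fst s 8 = int (2 * m)"
      "snd s 0 = map fst A" "snd s 1 = map snd A" "snd s 2 = map fst B" "snd s 3 = map snd B"
    and n: "length A = n" "length B = n" "1 \<le> n" and F: "1 \<le> F" "1 \<le> G" and m: "m = nat (G - 1) * (2 * n)"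
    and M: "2 * int m + 1 \<le> M" "F * G + G \<le> M"
      "\<And>i. i < n \<Longrightarrow> \<bar>fst (A ! i)\<bar> * (F * G) \<le> M" "\<And>i. i < n \<Longrightarrow> \<bar>fst (B ! i)\<bar> * (F * G) \<le> M"
  shows "runs M fill s (m * 62 + 20) (\<lambda>s'. length (snd s' 6) = 2 * m \<and> length (snd s' 7) = 2 * m \<and>
     (\<forall>p<m. snd s' 6 ! p = block_mant F G A p \<and> snd s' 6 ! (m + p) = block_mant F G B p \<and>
            snd s' 7 ! p = block_exp A p \<and> snd s' 7 ! (m + p) = block_exp B p))"
proof -
  define I where "I i s' \<longleftrightarrow> length (snd s' 6) = 2 * m \<and> length (snd s' 7) = 2 * m \<and>
     (\<forall>p<m. snd s' 6 ! p = (if p < i then block_mant F G A p else 0) \<and> snd s' 6 ! (m + p) = (if p < i then block_mant F G B p else 0) \<and>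
            snd s' 7 ! p = (if p < i then block_exp A p else 0) \<and> snd s' 7 ! (m + p) = (if p < i then block_exp B p else 0))"
    for i and s' :: state
  have loop: "runs M (For 9 7 fill_body) s0 (m * (50 + 8) + 8) (I m)"
    if s0: "s0 = (fst s, (snd s)(6 := replicate (2 * m) 0, 7 := replicate (2 * m) 0))" for s0
  proof (rule runs_For)
    show "I 0 s0" by (simp add: I_def s0)
    show "fst s0 7 = int m" using s by (simp add: s0)
    fix p s' assume p: "p < m" "I p s'" "fst s' 9 = int p" and fr: "frame (For 9 7 fill_body) s0 s'"
    have s': "fst s' 0 = int n" "fst s' 3 = F" "fst s' 5 = G" "fst s' 6 = 2 * int n" "fst s' 7 = int m"
      "snd s' 0 = map fst A" "snd s' 1 = map snd A" "snd s' 2 = map fst B" "snd s' 3 = map snd B"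
      using fr s by (auto simp: frame_def s0)
    have len: "length (snd s' 6) = 2 * m" "length (snd s' 7) = 2 * m" using p by (auto simp: I_def)
    define i where "i = p mod (2 * n)"
    have im: "int p mod (2 * int n) = int i" by (simp add: i_def zmod_int)
    define l where "l = int (p div (2 * n)) + 1"
    have lm: "int p div (2 * int n) + 1 = l" by (simp add: l_def zdiv_int)
    have "p div (2 * n) < nat (G - 1)"
      using p(1) n unfolding m by (simp add: less_mult_imp_div_less)
    then have l: "0 < l" "l \<le> G" by (auto simp: l_def)
    define f where "f = mult F G l"
    have f: "1 \<le> f" "f \<le> F * G" using mult_ge_1[OF l(1) F] mult_le[OF l(1) F] by (auto simp: f_def)
    have fm: "(F * G + l - 1) div l = f" by (simp add: f_def mult_def)
    have FG: "1 \<le> F * G" using F mult_mono[of 1 F 1 G] by simp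
    have c: "int p \<le> M" "\<bar>int i\<bar> \<le> M" "\<bar>l\<bar> \<le> M" "\<bar>l - 1\<bar> \<le> M" "\<bar>F * G\<bar> \<le> M" "\<bar>F * G + l\<bar> \<le> M" "\<bar>F * G + l - 1\<bar> \<le> M" "\<bar>f\<bar> \<le> M"
      "int m + int p \<le> M" "1 \<le> M" "int i \<le> M"
    proof -
      have "int i \<le> int p" by (simp add: i_def)
      then show "int p \<le> M" "\<bar>int i\<bar> \<le> M" "\<bar>l\<bar> \<le> M" "\<bar>l - 1\<bar> \<le> M" "\<bar>F * G\<bar> \<le> M" "\<bar>F * G + l\<bar> \<le> M" "\<bar>F * G + l - 1\<bar> \<le> M" "\<bar>f\<bar> \<le> M"
        "int m + int p \<le> M" "1 \<le> M" "int i \<le> M"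
        using p(1) l f FG M(1,2) by linarith+
    qed
    have lm': "int p div (2 * int n) = l - 1" using lm by simp
    have nm: "nat (int m + int p) = m + p" by simp
    show "runs M fill_body s' 50 (I (Suc p))"
    proof (cases "i < n")
      case True
      have mA: "\<bar>fst (A ! i) * f\<bar> \<le> M" "\<bar>fst (B ! i) * f\<bar> \<le> M"
      proof -
        have "\<bar>fst (A ! i)\<bar> * \<bar>f\<bar> \<le> \<bar>fst (A ! i)\<bar> * (F * G)" "\<bar>fst (B ! i)\<bar> * \<bar>f\<bar> \<le> \<bar>fst (B ! i)\<bar> * (F * G)"
          using f by (intro mult_left_mono; simp)+
        then show "\<bar>fst (A ! i) * f\<bar> \<le> M" "\<bar>fst (B ! i) * f\<bar> \<le> M"
          using M(3)[OF True] M(4)[OF True] unfolding abs_mult by linarith+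
      qed
      have z: "block_mant F G A p = fst (A ! i) * f" "block_mant F G B p = fst (B ! i) * f" "block_exp A p = snd (A ! i)" "block_exp B p = snd (B ! i)"
        using True n by (auto simp: block_mant_def block_exp_def i_def f_def l_def)
      define s1 where "s1 = ((fst s')(10 := int i, 11 := f),
         (snd s')(6 := ((snd s' 6)[p := fst (A ! i) * f])[m + p := fst (B ! i) * f],
                  7 := ((snd s' 7)[p := snd (A ! i)])[m + p := snd (B ! i)]))"
      have "wp M fill_body (\<lambda>s''. s'' = s1) s'"
        unfolding fill_body_def s1_def
        using True n p(1) mA c l(1)
        by (simp add: s' p(3) im lm lm' fm nm len fun_upd_twist[of 6 7] del: One_nat_def)
      then have "runs M fill_body s' 50 (\<lambda>s''. s'' = s1)" by (rule runs_wp) (simp add: fill_body_def)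
      moreover have "I (Suc p) s1"
        using p(1,2) unfolding I_def s1_def by (auto simp: nth_list_update z less_Suc_eq)
      ultimately show ?thesis by (auto intro: runs_mono)
    next
      case False
      have z: "block_mant F G A p = 0" "block_mant F G B p = 0" "block_exp A p = 0" "block_exp B p = 0"
        using False n by (auto simp: block_mant_def block_exp_def i_def)
      have "wp M fill_body (\<lambda>s''. s'' = ((fst s')(10 := int i), snd s')) s'"
        unfolding fill_body_def using False n c by (simp add: s' p(3) im)
      then have "runs M fill_body s' 50 (\<lambda>s''. s'' = ((fst s')(10 := int i), snd s'))"
        by (rule runs_wp) (simp add: fill_body_def)
      moreover have "I (Suc p) ((fst s')(10 := int i), snd s')"
        using p(2) unfolding I_def by (auto simp: z less_Suc_eq)
      ultimately show ?thesis by (auto intro: runs_mono)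
    qed
  qed (use M in \<open>auto simp: I_def\<close>)
  have "runs M fill s ((2 * m + 2) + ((2 * m + 2) + (m * (50 + 8) + 8))) (I m)"
    unfolding fill_def
  proof (rule runs_Seq[where R = "\<lambda>s'. s' = (fst s, (snd s)(6 := replicate (2 * m) 0))"], goal_cases)
    case 1
    show ?case by (rule runs_Alloc) (use s M(1) in \<open>auto simp: nat_mult_distrib\<close>)
  next
    case (2 s1)
    show ?case
    proof (rule runs_Seq[where R = "\<lambda>s'. s' = (fst s, (snd s)(6 := replicate (2 * m) 0, 7 := replicate (2 * m) 0))"], goal_cases)
      case 1
      show ?case by (rule runs_Alloc) (use 2 s M(1) in \<open>auto simp: nat_mult_distrib\<close>)
    qed (use loop in simp)
  qed
  then show ?thesis by (rule runs_mono) (auto simp: I_def)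
qed


lemma runs_ranks:
  assumes s: "fst s 7 = int m" "snd s 6 = Zm" "snd s 9 = R" and len: "length Zm = 2 * m" "length R = 2 * m"
    and M: "2 * int m + 1 \<le> M"
  shows "runs M ranks s (m * 40 + 20) (\<lambda>s'. fst s' 20 = int m \<and> length (snd s' 20) = m \<and> length (snd s' 21) = m \<and>
     (\<forall>p<m. snd s' 20 ! p = (if 0 < Zm ! p then R ! p else 0) \<and>
            snd s' 21 ! p = (if 0 < Zm ! (m + p) then R ! (m + p) else 0)))"
proof -
  define I where "I i s' \<longleftrightarrow> length (snd s' 20) = m \<and> length (snd s' 21) = m \<and>
     (\<forall>p<m. snd s' 20 ! p = (if p < i \<and> 0 < Zm ! p then R ! p else 0) \<and>
            snd s' 21 ! p = (if p < i \<and> 0 < Zm ! (m + p) then R ! (m + p) else 0))"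
    for i and s' :: state
  have loop: "runs M (For 9 7 ranks_body) s0 (m * (28 + 8) + 8) (I m)"
    if s0: "s0 = (fst s, (snd s)(20 := replicate m 0, 21 := replicate m 0))" for s0
  proof (rule runs_For)
    show "I 0 s0" by (simp add: I_def s0)
    show "fst s0 7 = int m" using s by (simp add: s0)
    fix p s' assume p: "p < m" "I p s'" "fst s' 9 = int p" and fr: "frame (For 9 7 ranks_body) s0 s'"
    have s': "fst s' 7 = int m" "snd s' 6 = Zm" "snd s' 9 = R" using fr s by (auto simp: frame_def s0)
    have l: "length (snd s' 20) = m" "length (snd s' 21) = m" using p by (auto simp: I_def)
    have nm: "nat (int m + int p) = m + p" by simp
    define x where "x = (if 0 < Zm ! p then (snd s' 20)[p := R ! p] else snd s' 20)"
    define y where "y = (if 0 < Zm ! (m + p) then (snd s' 21)[p := R ! (m + p)] else snd s' 21)"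
    have c: "int m + int p \<le> M" "0 \<le> M" using p(1) M by auto
    have "wp M ranks_body (\<lambda>s''. snd s'' 20 = x \<and> snd s'' 21 = y) s'"
      unfolding ranks_body_def x_def y_def using p(1) c len
      by (simp add: s' p(3) l nm)
    then show "runs M ranks_body s' 28 (I (Suc p))"
      by (rule runs_mono[OF runs_scost], simp add: ranks_body_def)
        (use p(1,2) in \<open>auto simp: I_def x_def y_def nth_list_update less_Suc_eq\<close>)
  qed (use M in \<open>auto simp: I_def\<close>)
  have "runs M ranks s ((m + 2) + ((m + 2) + ((m * (28 + 8) + 8) + 2))) (\<lambda>s'. I m s' \<and> fst s' 20 = int m)"
    unfolding ranks_def
  proof (rule runs_Seq[where R = "\<lambda>s'. s' = (fst s, (snd s)(20 := replicate m 0))"], goal_cases)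
    case 1
    show ?case by (rule runs_Alloc) (use s M(1) in auto)
  next
    case (2 s1)
    show ?case
    proof (rule runs_Seq[where R = "\<lambda>s'. s' = (fst s, (snd s)(20 := replicate m 0, 21 := replicate m 0))"], goal_cases)
      case 1
      show ?case by (rule runs_Alloc) (use 2 s M(1) in auto)
    next
      case (2 s2)
      show ?case
      proof (rule runs_Seq[OF loop[OF 2(1)]])
        fix s3 assume 3: "I m s3" "frame (For 9 7 ranks_body) s2 s3"
        then have "fst s3 7 = int m" using 2 s by (auto simp: frame_def)
        then show "runs M (Assign 20 (V 7)) s3 2 (\<lambda>s'. I m s' \<and> fst s' 20 = int m)"
          using 3(1) by (intro runs_wp) (auto simp: I_def)
      qed
    qed
  qed
  then show ?thesis by (rule runs_mono) (auto simp: I_def)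
qed

lemma runs_emit:
  assumes s: "fst s 6 = int (2 * n)" "fst s 7 = int m" "fst s 4 = int f" "snd s 6 = Zm" "snd s 7 = Ze" "snd s 10 = Od" "snd s 22 = Out"
    and len: "length Zm = 2 * m" "length Ze = 2 * m" "length Od = 2 * m" "length Out = 2 * m - 1"
    and n: "1 \<le> n" "2 * n \<le> m"
    and Od: "\<And>i. i < 2 * m \<Longrightarrow> 0 \<le> Od ! i \<and> Od ! i < int (2 * m)"
    and Out: "\<And>k. k < 2 * n - 1 \<Longrightarrow> Out ! (m - 2 * n + k) \<le> int (2 * m)"
    and M: "2 * int m + 1 \<le> M" "\<And>x. x \<in> set Ze \<Longrightarrow> \<bar>x\<bar> + int f \<le> M"
  shows "runs M emit s (n * 100 + 50) (\<lambda>s'. length (snd s' 4) = 2 * n - 1 \<and> length (snd s' 5) = 2 * n - 1 \<and>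
     (\<forall>k < 2 * n - 1. 0 < Out ! (m - 2 * n + k) \<longrightarrow>
        snd s' 4 ! k = Zm ! nat (Od ! nat (Out ! (m - 2 * n + k) - 1)) \<and>
        snd s' 5 ! k = Ze ! nat (Od ! nat (Out ! (m - 2 * n + k) - 1)) - int f) \<and>
     (\<forall>k < 2 * n - 1. \<not> 0 < Out ! (m - 2 * n + k) \<longrightarrow> snd s' 4 ! k = 0))"
proof -
  define h where "h = 2 * n - 1"
  define I where "I i s' \<longleftrightarrow> length (snd s' 4) = h \<and> length (snd s' 5) = h \<and>
     (\<forall>k < h. k < i \<longrightarrow> 0 < Out ! (m - 2 * n + k) \<longrightarrow>
        snd s' 4 ! k = Zm ! nat (Od ! nat (Out ! (m - 2 * n + k) - 1)) \<and>
        snd s' 5 ! k = Ze ! nat (Od ! nat (Out ! (m - 2 * n + k) - 1)) - int f) \<and>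
     (\<forall>k < h. k \<ge> i \<or> \<not> 0 < Out ! (m - 2 * n + k) \<longrightarrow> snd s' 4 ! k = 0)"
    for i and s' :: state
  have loop: "runs M (For 9 16 emit_body) s0 (h * (30 + 8) + 8) (I h)"
    if s0: "s0 = ((fst s)(16 := int h, 14 := int (m - 2 * n)), (snd s)(4 := replicate h 0, 5 := replicate h 0))" for s0
  proof (rule runs_For)
    show "I 0 s0" by (simp add: I_def s0)
    show "fst s0 16 = int h" using s by (simp add: s0)
    fix k s' assume k: "k < h" "I k s'" "fst s' 9 = int k" and fr: "frame (For 9 16 emit_body) s0 s'"
    have s': "fst s' 14 = int (m - 2 * n)" "fst s' 4 = int f" "snd s' 6 = Zm" "snd s' 7 = Ze" "snd s' 10 = Od" "snd s' 22 = Out"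
      using fr s by (auto simp: frame_def s0)
    have l: "length (snd s' 4) = h" "length (snd s' 5) = h" using k by (auto simp: I_def)
    have km: "m - 2 * n + k < 2 * m - 1" "m - 2 * n + k < m" using k(1) n by (auto simp: h_def)
    have nm: "nat (int (m - 2 * n) + int k) = m - 2 * n + k" by simp
    have c: "int (m - 2 * n) + int k \<le> M" "0 \<le> M" "1 \<le> M" using km M(1) by auto
    define r where "r = Out ! (m - 2 * n + k)"
    have r: "r \<le> int (2 * m)" using Out k(1) by (simp add: r_def h_def)
    show "runs M emit_body s' 30 (I (Suc k))"
    proof (cases "0 < r")
      case True
      define d where "d = Od ! nat (r - 1)"
      have r1: "nat (r - 1) < 2 * m" using r True by auto
      then have d: "0 \<le> d" "nat d < 2 * m" using Od[of "nat (r - 1)"] by (auto simp: d_def)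
      then have "\<bar>Ze ! nat d\<bar> + int f \<le> M" using M(2) len by simp
      then have e: "\<bar>Ze ! nat d - int f\<bar> \<le> M" by linarith
      have c': "r - 1 \<le> M" "0 \<le> r - 1" "\<bar>r - 1\<bar> \<le> M" using r True M(1) by auto
      have "wp M emit_body (\<lambda>s''. snd s'' = (snd s')(4 := (snd s' 4)[k := Zm ! nat d], 5 := (snd s' 5)[k := Ze ! nat d - int f])) s'"
        unfolding emit_body_def
        by (simp add: s' k(1,3) l nm c c' len km r_def[symmetric] True r1 d e d_def[symmetric]
            del: One_nat_def of_nat_add)
      then show ?thesis
        by (rule runs_mono[OF runs_scost], simp add: emit_body_def)
          (use k(1,2) True in \<open>auto simp: I_def nth_list_update less_Suc_eq d_def r_def\<close>)
    next
      case False
      have "wp M emit_body (\<lambda>s''. snd s'' = snd s') s'"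
        unfolding emit_body_def
        by (simp add: s' k(1,3) l nm c len km r_def[symmetric] False del: One_nat_def of_nat_add)
      then show ?thesis
        by (rule runs_mono[OF runs_scost], simp add: emit_body_def)
          (use k(1,2) False in \<open>auto simp: I_def less_Suc_eq r_def Suc_le_eq\<close>)
    qed
  qed (use M n in \<open>auto simp: I_def h_def\<close>)
  have nh: "2 * int n - 1 = int h" "int m - 2 * int n = int (m - 2 * n)" using n by (auto simp: h_def)
  have hM: "int h \<le> M" "int (m - 2 * n) \<le> M" "1 \<le> M" using n M(1) by (auto simp: h_def)
  have "runs M emit s (4 + ((h + 2) + ((h + 2) + (4 + (h * (30 + 8) + 8))))) (I h)"
    unfolding emit_def
  proof (rule runs_Seq[where R = "\<lambda>s'. s' = ((fst s)(16 := int h), snd s)"], goal_cases)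
    case 1
    show ?case by (rule runs_wp) (use s hM in \<open>auto simp: nh\<close>)
  next
    case (2 s1)
    show ?case
    proof (rule runs_Seq[where R = "\<lambda>s'. s' = ((fst s)(16 := int h), (snd s)(4 := replicate h 0))"], goal_cases)
      case 1
      show ?case by (rule runs_Alloc) (use 2 hM in auto)
    next
      case (2 s2)
      show ?case
      proof (rule runs_Seq[where R = "\<lambda>s'. s' = ((fst s)(16 := int h), (snd s)(4 := replicate h 0, 5 := replicate h 0))"], goal_cases)
        case 1
        show ?case by (rule runs_Alloc) (use 2 hM in auto)
      next
        case (2 s3)
        show ?case
        proof (rule runs_Seq[where R = "\<lambda>s'. s' = ((fst s)(16 := int h, 14 := int (m - 2 * n)), (snd s)(4 := replicate h 0, 5 := replicate h 0))"], goal_cases)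
          case 1
          show ?case by (rule runs_wp) (use 2 s hM in \<open>auto simp: nh\<close>)
        qed (use loop in simp)
      qed
    qed
  qed
  then show ?thesis by (rule runs_mono) (use n in \<open>auto simp: I_def h_def\<close>)
qed

text \<open>For a negative exponent \<open>1 / \<epsilon>\<close> is \<open>F0 / me\<close>, so the
  quotient plus 1 is an integer above it, and \<open>me \<ge> 1\<close> gives
  \<open>1 / \<epsilon> \<le> F0\<close>. Otherwise \<open>\<epsilon> \<ge> 1\<close> and
  \<open>F0 = 1\<close> is enough. The power \<open>F0 = me / \<epsilon>\<close> fits into words
  only because the word limit takes \<open>1 / \<epsilon>\<close> into account: it is at most
  \<open>b * b\<close>.\<close>

lemma eps_bounds:
  fixes me ee b :: int
  assumes eps: "0 < fp_real (me, ee)" and b: "3 \<le> b" "me \<le> b" "\<lceil>1 / fp_real (me, ee)\<rceil> \<le> b"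
    and F0: "F0 = 2 ^ nat (- ee)" and E: "E = F0 div me + 1"
  shows "0 < me" "1 \<le> E" "1 / fp_real (me, ee) \<le> of_int E" "4 / fp_real (me, ee) \<le> of_int (4 * F0)"
    "of_int E \<le> 2 / min 1 (fp_real (me, ee))" "F0 \<le> b\<^sup>2" "E \<le> b + 1" "1 \<le> F0"
proof -
  have "\<not> (2::real) powi ee < 0" by (simp add: not_less)
  then show me: "0 < me" using eps by (auto simp: fp_real_def zero_less_mult_iff)
  show F1: "1 \<le> F0" by (simp add: F0)
  have div0: "0 \<le> F0 div me" using me F1 by (simp add: pos_imp_zdiv_nonneg_iff)
  then show "1 \<le> E" by (simp add: E)
  have dl: "of_int (F0 div me) \<le> real_of_int F0 / of_int me" by (rule real_of_int_div4)
  have du: "real_of_int F0 / of_int me \<le> of_int (F0 div me) + 1"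
    using real_of_int_div2[of F0 me] real_of_int_div3[of F0 me] by linarith
  define \<epsilon> where "\<epsilon> = fp_real (me, ee)"
  have \<epsilon>0: "0 < \<epsilon>" using eps by (simp add: \<epsilon>_def)
  have "1 / \<epsilon> \<le> of_int E \<and> 4 / \<epsilon> \<le> of_int (4 * F0) \<and> of_int E \<le> 2 / min 1 \<epsilon> \<and> F0 \<le> b\<^sup>2 \<and> E \<le> b + 1"
  proof (cases "ee < 0")
    case True
    have "ee = - int (nat (- ee))" using True by simp
    then have "2 powi ee = 1 / real_of_int F0" unfolding F0
      by (metis of_int_numeral of_int_power power_int_minus power_int_of_nat inverse_eq_divide)
    then have \<epsilon>: "1 / \<epsilon> = real_of_int F0 / of_int me" by (simp add: \<epsilon>_def fp_real_def)
    have "of_int F0 / of_int me \<le> real_of_int b"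
      using b(3) \<epsilon> by (simp add: \<epsilon>_def[symmetric] ceiling_le_iff)
    then have "real_of_int F0 \<le> of_int (b * me)" using me by (simp add: pos_divide_le_eq)
    then have "F0 \<le> b * me" by (simp only: of_int_le_iff)
    also have "\<dots> \<le> b * b" using b by (intro mult_left_mono) auto
    finally have "F0 \<le> b\<^sup>2" by (simp add: power2_eq_square)
    moreover have "real_of_int (F0 div me) \<le> of_int b" using dl \<open>of_int F0 / of_int me \<le> real_of_int b\<close> by linarith
    then have "E \<le> b + 1" by (simp add: E)
    moreover have "1 / \<epsilon> \<le> of_int E" using du \<epsilon> by (simp add: E)
    moreover have "4 / \<epsilon> \<le> of_int (4 * F0)"
    proof -
      have "real_of_int F0 / of_int me \<le> real_of_int F0 / 1" using me F1 by (intro divide_left_mono) auto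
      then have "4 * (1 / \<epsilon>) \<le> 4 * of_int F0" unfolding \<epsilon> by simp
      then show ?thesis by simp
    qed
    moreover have "of_int E \<le> 2 / min 1 \<epsilon>"
    proof -
      have "of_int E \<le> 1 / \<epsilon> + 1" using dl \<epsilon> by (simp add: E)
      moreover have "1 / \<epsilon> \<le> 1 / min 1 \<epsilon>" "1 \<le> 1 / min 1 \<epsilon>" using \<epsilon>0 by (auto intro!: divide_left_mono)
      ultimately show ?thesis by (simp add: field_simps)
    qed
    ultimately show ?thesis by blast
  next
    case False
    then have F: "F0 = 1" by (simp add: F0)
    have "1 \<le> (2::real) powi ee" using False by (simp add: power_int_def)
    then have "1 * 1 \<le> \<epsilon>" unfolding \<epsilon>_def fp_real_def fst_conv snd_conv using me by (intro mult_mono) auto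
    then have \<epsilon>1: "1 \<le> \<epsilon>" by simp
    have "F0 div me \<le> 1" using zdiv_mono2[of 1 1 me] me by (simp add: F)
    then have "E \<le> 2" by (simp add: E)
    moreover have "1 / \<epsilon> \<le> 1" "4 / \<epsilon> \<le> 4" using \<epsilon>1 by (simp_all add: pos_divide_le_eq)
    moreover have "(1::int) \<le> b\<^sup>2" using b by simp
    ultimately show ?thesis using \<open>1 \<le> E\<close> F b \<epsilon>1 by (auto simp: min_def)
  qed
  then show "1 / fp_real (me, ee) \<le> of_int E" "4 / fp_real (me, ee) \<le> of_int (4 * F0)"
    "of_int E \<le> 2 / min 1 (fp_real (me, ee))" "F0 \<le> b\<^sup>2" "E \<le> b + 1" by (auto simp: \<epsilon>_def)
qed

definition approx_prog :: "com \<Rightarrow> com" where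
  "approx_prog P = Seq prep (Seq fill (Seq sort_prog (Seq ranks (Seq (shift 20 P) emit))))"

lemma int_value_in_Rplus_iff: "int_value x \<in> Rplus \<longleftrightarrow> 0 \<le> x"
proof
  assume "int_value x \<in> Rplus"
  then have "x = 0 \<or> (1::real) \<le> of_int x" by (auto simp: int_value_def Rplus_def split: if_splits)
  then show "0 \<le> x" by auto
next
  assume "0 \<le> x"
  then have "x = 0 \<or> (1::real) \<le> of_int x" by auto
  then show "int_value x \<in> Rplus" by (auto simp: int_value_def Rplus_def)
qed

text \<open>Every output is an input or represents infinity, so a rank returned by the subroutine is
  still a valid index into the sorted items.\<close>

lemma min_max_conv_bounded:
  assumes conv: "is_min_max_conv (map int_value A) (map int_value B) (map int_value C)"
    and k: "k < length C" and ne: "A \<noteq> []" "B \<noteq> []"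
    and c: "\<And>x. x \<in> set A \<union> set B \<Longrightarrow> x \<le> c" "0 \<le> c"
  shows "C ! k \<le> c"
proof -
  have "k < length (map int_value A) + length (map int_value B) - 1" "map int_value A \<noteq> []" "map int_value B \<noteq> []"
    using conv k ne by (auto simp: is_min_max_conv_def)
  then obtain i j where ij: "i < length A" "j < length B"
    "min_max_conv (map int_value A) (map int_value B) k = max (map int_value A ! i) (map int_value B ! j)"
    by (rule min_max_conv_attained) auto
  then have "int_value (C ! k) = max (int_value (A ! i)) (int_value (B ! j))"
    using conv k by (simp add: is_min_max_conv_def)
  then have "C ! k = 0 \<or> C ! k = A ! i \<or> C ! k = B ! j"
    by (auto simp: int_value_def max_def split: if_splits)
  then show ?thesis using c ij(1,2) by auto
qed

text \<open>The exponent \<open>8 + 6 * w\<close> has two sources: the numbers computed by the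
  reduction itself stay below \<open>81 * b ^ 4 \<le> b ^ 8\<close>, and the subroutine needs at
  most \<open>(b ^ 6) ^ w\<close>. \<open>L\<close> is left open, to be chosen as a logarithm of
  \<open>4 * m\<close>: the tournament has \<open>2 * m\<close> items and twice as many
  nodes.\<close>

lemma approx_prog_correct:
  fixes A B :: "(int \<times> int) list" and T :: "nat \<Rightarrow> real"
  assumes P: "\<And>n A B. 1 \<le> n \<Longrightarrow> length A = n \<Longrightarrow> length B = n \<Longrightarrow>
      int_value ` set A \<subseteq> Rplus \<Longrightarrow> int_value ` set B \<subseteq> Rplus \<Longrightarrow>
      \<exists>t regs arrs. exec (max_word w n (A @ B)) P (exact_input A B) t (regs, arrs) \<and> real t \<le> T n \<and>
        is_min_max_conv (map int_value A) (map int_value B) (map int_value (arrs 2))"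
    and n: "1 \<le> n" "length A = n" "length B = n"
    and AB: "fp_value ` set A \<subseteq> Rplus" "fp_value ` set B \<subseteq> Rplus" and eps: "0 < fp_real \<epsilon>"
  shows "\<exists>m E :: nat. m = (6 * E + 1) * (2 * n) \<and> 1 \<le> m \<and> real E \<le> 2 / min 1 (fp_real \<epsilon>) \<and>
    (\<forall>L. 4 * m \<le> 2 ^ L \<longrightarrow> (\<exists>t regs arrs.
      exec (approx_max_word (8 + 6 * w) A B \<epsilon>) (approx_prog P) (approx_input A B \<epsilon>) t (regs, arrs) \<and>
      real t \<le> T m + real (m * (176 * L + 502) + 200) \<and> length (arrs 4) = length (arrs 5) \<and>
      is_approx_min_plus_conv (fp_real \<epsilon>) (map fp_value A) (map fp_value B) (map fp_value (zip (arrs 4) (arrs 5)))))"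
proof -
  obtain me ee where \<epsilon>: "\<epsilon> = (me, ee)" by fastforce
  define xs where "xs = map fst A @ map snd A @ map fst B @ map snd B @ [fst \<epsilon>, snd \<epsilon>, \<lceil>1 / fp_real \<epsilon>\<rceil>]"
  define b where "b = int n + 2 + Max (insert 0 (abs ` set xs))"
  define M where "M = b ^ (8 + 6 * w)"
  have M_eq: "approx_max_word (8 + 6 * w) A B \<epsilon> = M"
    using n by (simp add: approx_max_word_def max_word_def M_def b_def xs_def)
  have Max0: "0 \<le> Max (insert 0 (abs ` set xs))" by (rule Max_ge) auto
  have xb: "\<bar>x\<bar> + int n + 2 \<le> b" if "x \<in> set xs" for x
    using Max_ge[of "insert 0 (abs ` set xs)" "\<bar>x\<bar>"] that by (simp add: b_def)
  have b3: "3 \<le> b" and nb: "int n + 2 \<le> b" using n(1) Max0 unfolding b_def by linarith+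
  have "\<bar>me\<bar> + int n + 2 \<le> b" "\<bar>ee\<bar> + int n + 2 \<le> b" "\<bar>\<lceil>1 / fp_real \<epsilon>\<rceil>\<bar> + int n + 2 \<le> b"
    by (rule xb; simp add: xs_def \<epsilon>)+
  then have eb: "me \<le> b" "\<bar>ee\<bar> + 2 \<le> b" "\<lceil>1 / fp_real (me, ee)\<rceil> \<le> b" by (auto simp: \<epsilon>)
  have Ab: "\<bar>fst (A ! i)\<bar> \<le> b" "\<bar>snd (A ! i)\<bar> \<le> b" "\<bar>fst (B ! i)\<bar> \<le> b" "\<bar>snd (B ! i)\<bar> \<le> b" if "i < n" for i
  proof -
    have "fst (A ! i) \<in> set xs" "snd (A ! i) \<in> set xs" "fst (B ! i) \<in> set xs" "snd (B ! i) \<in> set xs"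
      using that n by (auto simp: xs_def)
    then show "\<bar>fst (A ! i)\<bar> \<le> b" "\<bar>snd (A ! i)\<bar> \<le> b" "\<bar>fst (B ! i)\<bar> \<le> b" "\<bar>snd (B ! i)\<bar> \<le> b"
      using xb by fastforce+
  qed
  define F0 where "F0 = (2::int) ^ nat (- ee)"
  define E where "E = F0 div me + 1"
  note eps_b = eps_bounds[OF eps[unfolded \<epsilon>] b3 eb(1,3) F0_def E_def]
  define G where "G = 6 * E + 2"
  define F where "F = 4 * F0"
  define f where "f = nat (- ee) + 2"
  define m where "m = nat (G - 1) * (2 * n)"
  have F_f: "F = 2 ^ f" by (simp add: F_def F0_def f_def)
  have F4: "4 \<le> F" using eps_b(8) by (simp add: F_def)
  have m1: "1 \<le> m" "2 * n \<le> m" "nat (G - 1) = 6 * nat E + 1" using eps_b(2) n by (auto simp: m_def G_def)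
  have G9: "G \<le> 9 * b" "2 \<le> G" using eps_b(2,7) b3 by (auto simp: G_def)
  have bp: "b ^ i \<le> b ^ j" if "i \<le> j" for i j using b3 that by (intro power_increasing) auto
  \<comment> \<open>Since \<open>b \<ge> 3\<close>, four extra powers of \<open>b\<close> absorb
    every constant factor up to 81.\<close>
  have b81: "81 * b ^ i \<le> b ^ (i + 4)" for i
  proof -
    have "(3::int) ^ 4 \<le> b ^ 4" using b3 by (intro power_mono) auto
    then have "81 * b ^ i \<le> b ^ 4 * b ^ i" using b3 by (intro mult_right_mono) auto
    then show ?thesis by (simp add: power_add mult.commute)
  qed
  have M8: "b ^ 8 \<le> M" unfolding M_def by (rule bp) simp
  have b0: "0 \<le> b ^ i" for i using b3 by simp
  have mb: "int m \<le> 18 * b\<^sup>2"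
  proof -
    have "int m = (G - 1) * (2 * int n)" using G9 by (simp add: m_def)
    also have "\<dots> \<le> (9 * b) * (2 * b)" using G9 nb by (intro mult_mono) auto
    finally show ?thesis by (simp add: power2_eq_square)
  qed
  have FG: "F * G \<le> 36 * b ^ 3"
  proof -
    have "F * G \<le> (4 * b\<^sup>2) * (9 * b)" using eps_b(6,8) G9 b3 by (intro mult_mono) (auto simp: F_def)
    then show ?thesis by (simp add: power2_eq_square power3_eq_cube)
  qed
  have FG0: "0 \<le> F * G" using F4 G9 by simp
  have pw: "b ^ 1 \<le> b ^ 4" "b ^ 1 \<le> b ^ 2" "b ^ 2 \<le> b ^ 4" "b ^ 3 \<le> b ^ 4" "81 * b ^ 4 \<le> b ^ 8" "1 \<le> b ^ 4"
    using bp[of 1 4] bp[of 1 2] bp[of 2 4] bp[of 3 4] b81[of 4] bp[of 0 4] by auto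
  have fb: "int f \<le> \<bar>ee\<bar> + 2" by (simp add: f_def)
  have Mm: "4 * int m + 2 \<le> M" "2 + \<bar>ee\<bar> \<le> M" "4 * F0 \<le> M" "G \<le> M" "2 * int n \<le> M" "F * G + G \<le> M" "2 * b \<le> M" "b + int f \<le> M"
    using mb FG G9(1) eps_b(6) eb(2) nb M8 pw[unfolded power_one_right] fb by linarith+
  have zmb: "\<bar>a\<bar> * (F * G) + 1 \<le> M" if "\<bar>a\<bar> \<le> b" for a
  proof -
    have "\<bar>a\<bar> * (F * G) \<le> b * (36 * b ^ 3)" using that FG FG0 b3 by (intro mult_mono[of "\<bar>a\<bar>" b "F * G"]) auto
    also have "\<dots> = 36 * b ^ 4" by (simp add: power_numeral_reduce)
    finally show ?thesis using M8 pw by linarith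
  qed
  have zmZ: "\<bar>block_mant F G A' p\<bar> + 1 \<le> M"
    if A': "length A' = n" "\<And>i. i < n \<Longrightarrow> \<bar>fst (A' ! i)\<bar> \<le> b" for A' p
  proof (cases "p mod (2 * n) < n")
    case True
    define c where "c = mult F G (int (p div (2 * n)) + 1)"
    have c: "1 \<le> c" "c \<le> F * G" unfolding c_def using F4 G9 by (intro mult_ge_1 mult_le; simp)+
    have "\<bar>fst (A' ! (p mod (2 * n)))\<bar> * \<bar>c\<bar> \<le> \<bar>fst (A' ! (p mod (2 * n)))\<bar> * (F * G)"
      using c by (intro mult_left_mono) auto
    then show ?thesis using zmb[OF A'(2)[OF True]] True A'(1) by (simp add: block_mant_def c_def abs_mult)
  next
    case False
    then show ?thesis using A' Mm(5) n by (simp add: block_mant_def)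
  qed
  have zeZ: "\<bar>block_exp A' p\<bar> \<le> b"
    if A': "length A' = n" "\<And>i. i < n \<Longrightarrow> \<bar>snd (A' ! i)\<bar> \<le> b" for A' p
    using that b3 by (auto simp: block_exp_def)
  have main: "\<exists>t regs arrs.
      exec M (approx_prog P) (approx_input A B \<epsilon>) t (regs, arrs) \<and>
      real t \<le> T m + real (m * (176 * L + 502) + 200) \<and> length (arrs 4) = length (arrs 5) \<and>
      is_approx_min_plus_conv (fp_real \<epsilon>) (map fp_value A) (map fp_value B) (map fp_value (zip (arrs 4) (arrs 5)))"
    if L: "4 * m \<le> 2 ^ L" for L
  proof -
    define s0 where "s0 = approx_input A B \<epsilon>"
    have s0: "fst s0 0 = int n" "fst s0 1 = me" "fst s0 2 = ee" "snd s0 0 = map fst A" "snd s0 1 = map snd A"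
      "snd s0 2 = map fst B" "snd s0 3 = map snd B" "\<And>x. 20 \<le> x \<Longrightarrow> fst s0 x = 0" "\<And>x. 20 \<le> x \<Longrightarrow> snd s0 x = []"
      using n by (auto simp: s0_def approx_input_def \<epsilon>)
    have "runs M prep s0 60 (\<lambda>s'. fst s' 3 = F \<and> fst s' 4 = int f \<and> fst s' 5 = G \<and>
       fst s' 6 = int (2 * n) \<and> fst s' 7 = int m \<and> fst s' 8 = int (2 * m))"
      unfolding F_def f_def
      by (rule runs_prep[OF s0(1-3) eps_b(1) n(1) F0_def _ m_def]) (use Mm in \<open>auto simp: G_def E_def\<close>)
    then obtain t1 s1 where e1: "exec M prep s0 t1 s1" "t1 \<le> 60" and
      r1: "fst s1 3 = F" "fst s1 4 = int f" "fst s1 5 = G" "fst s1 6 = int (2 * n)" "fst s1 7 = int m" "fst s1 8 = int (2 * m)"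
      unfolding runs_def by blast
    note f1 = frame_reg[OF exec_frame[OF e1(1)]] frame_arr[OF exec_frame[OF e1(1)]]
    have s1: "fst s1 0 = int n" "snd s1 0 = map fst A" "snd s1 1 = map snd A" "snd s1 2 = map fst B" "snd s1 3 = map snd B"
      "\<And>x. 20 \<le> x \<Longrightarrow> fst s1 x = 0" "\<And>x. 20 \<le> x \<Longrightarrow> snd s1 x = []"
      using s0 f1 by auto
    have fm: "1 \<le> F" "1 \<le> G" "2 * int m + 1 \<le> M" "F * G + G \<le> M" using F4 G9 Mm(1,6) by linarith+
    have AM: "\<bar>fst (A ! i)\<bar> * (F * G) \<le> M" "\<bar>fst (B ! i)\<bar> * (F * G) \<le> M" if "i < n" for i
      using zmb[OF Ab(1)[OF that]] zmb[OF Ab(3)[OF that]] by linarith+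
    obtain t2 s2 where e2: "exec M fill s1 t2 s2" "t2 \<le> m * 62 + 20" and
      r2: "length (snd s2 6) = 2 * m" "length (snd s2 7) = 2 * m"
       "\<And>p. p < m \<Longrightarrow> snd s2 6 ! p = block_mant F G A p" "\<And>p. p < m \<Longrightarrow> snd s2 6 ! (m + p) = block_mant F G B p"
       "\<And>p. p < m \<Longrightarrow> snd s2 7 ! p = block_exp A p" "\<And>p. p < m \<Longrightarrow> snd s2 7 ! (m + p) = block_exp B p"
      using runs_fill[OF s1(1) r1(1,3,4,5,6) s1(2-5) n(2,3,1) fm(1,2) m_def fm(3,4) AM] unfolding runs_def by blast
    define Zm where "Zm = snd s2 6"
    define Ze where "Ze = snd s2 7"
    note f2 = frame_reg[OF exec_frame[OF e2(1)]] frame_arr[OF exec_frame[OF e2(1)]]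
    have s2: "fst s2 4 = int f" "fst s2 6 = int (2 * n)" "fst s2 7 = int m" "fst s2 8 = int (2 * m)"
      "\<And>x. 20 \<le> x \<Longrightarrow> fst s2 x = 0" "\<And>x. 20 \<le> x \<Longrightarrow> snd s2 x = []"
      using s1 r1 f2 by auto
    have split: "\<exists>p'<m. p = p' \<or> p = m + p'" if "p < 2 * m" for p
    proof (cases "p < m")
      case False
      then show ?thesis using that by (intro exI[of _ "p - m"]) auto
    qed auto
    have ZmM: "\<bar>x\<bar> + 1 \<le> M" if x: "x \<in> set Zm" for x
    proof -
      obtain p where p: "p < 2 * m" "x = Zm ! p" using x r2(1) by (auto simp: in_set_conv_nth Zm_def)
      then obtain p' where "x = block_mant F G A p' \<or> x = block_mant F G B p'" using split[OF p(1)] r2(3,4) by (auto simp: Zm_def)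
      then show ?thesis using zmZ[OF n(2) Ab(1)] zmZ[OF n(3) Ab(3)] by auto
    qed
    have Zeb: "\<bar>x\<bar> \<le> b" if x: "x \<in> set Ze" for x
    proof -
      obtain p where p: "p < 2 * m" "x = Ze ! p" using x r2(2) by (auto simp: in_set_conv_nth Ze_def)
      then obtain p' where "x = block_exp A p' \<or> x = block_exp B p'" using split[OF p(1)] r2(5,6) by (auto simp: Ze_def)
      then show ?thesis using zeZ[OF n(2) Ab(2)] zeZ[OF n(3) Ab(4)] by auto
    qed
    have "runs M sort_prog s2 (2 * m * (88 * L + 150) + 50) (\<lambda>s'. sorted_upto (2 * m) (2 * m) Zm Ze (snd s' 9) (snd s' 10))"
      by (rule runs_sort_prog[OF s2(4)]) (use r2 m1 L Mm ZmM Zeb in \<open>force simp: Zm_def Ze_def\<close>)+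
    then obtain t3 s3 where e3: "exec M sort_prog s2 t3 s3" "t3 \<le> 2 * m * (88 * L + 150) + 50" and
      S: "sorted_upto (2 * m) (2 * m) Zm Ze (snd s3 9) (snd s3 10)"
      unfolding runs_def by blast
    note f3 = frame_reg[OF exec_frame[OF e3(1)]] frame_arr[OF exec_frame[OF e3(1)]]
    have s3: "fst s3 4 = int f" "fst s3 6 = int (2 * n)" "fst s3 7 = int m" "snd s3 6 = Zm" "snd s3 7 = Ze"
      "\<And>x. 20 \<le> x \<Longrightarrow> fst s3 x = 0" "\<And>x. 20 \<le> x \<Longrightarrow> snd s3 x = []"
      using s2 f3 by (auto simp: Zm_def Ze_def)
    define R where "R = snd s3 9"
    define Od where "Od = snd s3 10"
    note S = S[folded R_def Od_def]
    have lens: "length R = 2 * m" "length Od = 2 * m" "length Zm = 2 * m" "length Ze = 2 * m"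
      using S r2 by (auto simp: sorted_upto_def Zm_def Ze_def)
    obtain t4 s4 where e4: "exec M ranks s3 t4 s4" "t4 \<le> m * 40 + 20" and
      r4: "fst s4 20 = int m" "length (snd s4 20) = m" "length (snd s4 21) = m"
        "\<And>p. p < m \<Longrightarrow> snd s4 20 ! p = (if 0 < Zm ! p then R ! p else 0)"
        "\<And>p. p < m \<Longrightarrow> snd s4 21 ! p = (if 0 < Zm ! (m + p) then R ! (m + p) else 0)"
      using runs_ranks[OF s3(3,4) R_def[symmetric] lens(3,1) fm(3)] unfolding runs_def by blast
    define A' where "A' = snd s4 20"
    define B' where "B' = snd s4 21"
    note f4 = frame_reg[OF exec_frame[OF e4(1)]] frame_arr[OF exec_frame[OF e4(1)]]
    have s4: "fst s4 4 = int f" "fst s4 6 = int (2 * n)" "fst s4 7 = int m" "snd s4 6 = Zm" "snd s4 7 = Ze" "snd s4 10 = Od"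
      using s3 f4 by (auto simp: Od_def)
    \<comment> \<open>Apart from the length and the two input sequences, everything from index 20 on
      is still zero or empty, so the subroutine starts from a genuine initial state.\<close>
    have emb: "embeds 20 (exact_input A' B') s4"
      unfolding embeds_def exact_input_def using r4(1,2) f4 s3(6,7) by (auto simp: A'_def B'_def)
    have AB'_range: "x = 0 \<or> 1 \<le> x \<and> x \<le> int (2 * m)" if x: "x \<in> set A' \<union> set B'" for x
    proof -
      obtain p where "p < 2 * m" "x = 0 \<or> x = R ! p"
      proof (cases "x \<in> set A'")
        case True
        then obtain p where "p < m" "x = A' ! p" using r4(2) by (auto simp: in_set_conv_nth A'_def)
        then show thesis using r4(4) that[of p] by (auto simp: A'_def split: if_splits)
      next
        case False
        then obtain p where "p < m" "x = B' ! p" using x r4(3) by (auto simp: in_set_conv_nth B'_def)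
        then show thesis using r4(5) that[of "m + p"] by (auto simp: B'_def split: if_splits)
      qed
      then show ?thesis using sorted_rank(1,2)[OF S] by auto
    qed
    have Rp: "int_value ` set A' \<subseteq> Rplus" "int_value ` set B' \<subseteq> Rplus"
      using AB'_range by (fastforce simp: int_value_in_Rplus_iff)+
    obtain t5 regs arrs where e5: "exec (max_word w m (A' @ B')) P (exact_input A' B') t5 (regs, arrs)" "real t5 \<le> T m"
      and conv: "is_min_max_conv (map int_value A') (map int_value B') (map int_value (arrs 2))"
      using P[OF m1(1) _ _ Rp] r4(2,3) by (auto simp: A'_def B'_def)
    \<comment> \<open>All ranks are at most \<open>2 * m\<close>, so the limit under which the
      subroutine is known to work is polynomial in \<open>m\<close>, and hence in
      \<open>b\<close>.\<close>
    have "max_word w m (A' @ B') \<le> M"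
    proof -
      have "Max (insert 0 (abs ` set (A' @ B'))) \<le> int (2 * m)"
      proof (intro Max.boundedI)
        fix y assume "y \<in> insert 0 (abs ` set (A' @ B'))"
        then consider "y = 0" | x where "x \<in> set A' \<union> set B'" "y = \<bar>x\<bar>" by auto
        then show "y \<le> int (2 * m)"
        proof cases
          case 2
          then show ?thesis using AB'_range[of x] by auto
        qed simp
      qed auto
      then have "int m + 2 + Max (insert 0 (abs ` set (A' @ B'))) \<le> 3 * int m + 2" by simp
      also have "\<dots> \<le> 81 * b ^ 2" using mb bp[of 0 2] by simp
      also have "\<dots> \<le> b ^ 6" using b81[of 2] by simp
      finally have "max_word w m (A' @ B') \<le> (b ^ 6) ^ w" unfolding max_word_def
        by (intro power_mono) (auto intro!: add_nonneg_nonneg simp: Max_ge_iff)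
      also have "\<dots> \<le> M" unfolding M_def power_mult[symmetric] by (rule bp) simp
      finally show ?thesis .
    qed
    from exec_shift[OF e5(1) emb this] obtain s5 where e5': "exec M (shift 20 P) s4 t5 s5" and
      emb5: "embeds 20 (regs, arrs) s5" by blast
    define Out where "Out = arrs 2"
    have out5: "snd s5 22 = Out" using emb5[unfolded embeds_def, THEN conjunct2, rule_format, of 2] by (simp add: Out_def)
    have f5: "x < 20 \<Longrightarrow> fst s5 x = fst s4 x" "x < 20 \<Longrightarrow> snd s5 x = snd s4 x" for x
      using frame_reg[OF exec_frame[OF e5'], of x] frame_arr[OF exec_frame[OF e5'], of x] wr_shift[of 20 P] wa_shift[of 20 P]
      by force+
    have s5: "fst s5 4 = int f" "fst s5 6 = int (2 * n)" "fst s5 7 = int m" "snd s5 6 = Zm" "snd s5 7 = Ze" "snd s5 10 = Od"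
      using s4 f5 by auto
    have conv: "is_min_max_conv (map int_value A') (map int_value B') (map int_value Out)" using conv by (simp add: Out_def)
    have lenOut: "length Out = 2 * m - 1" using conv r4(2,3) by (simp add: is_min_max_conv_def A'_def B'_def)
    have "A' \<noteq> []" "B' \<noteq> []" using r4(2,3) m1 by (auto simp: A'_def B'_def)
    then have Outm: "Out ! k \<le> int (2 * m)" if "k < 2 * m - 1" for k
      using min_max_conv_bounded[OF conv, of k "int (2 * m)"] AB'_range that lenOut by fastforce
    have OdZ: "0 \<le> Od ! i \<and> Od ! i < int (2 * m)" if "i < 2 * m" for i
      using S that unfolding sorted_upto_def by blast
    have OutZ: "Out ! (m - 2 * n + k) \<le> int (2 * m)" if "k < 2 * n - 1" for k
      using that m1 by (intro Outm) auto
    have ZeM: "\<bar>x\<bar> + int f \<le> M" if "x \<in> set Ze" for x using Zeb[OF that] Mm(8) by simp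
    obtain t6 s6 where e6: "exec M emit s5 t6 s6" "t6 \<le> n * 100 + 50" and
      r6: "length (snd s6 4) = 2 * n - 1" "length (snd s6 5) = 2 * n - 1"
        "\<And>k. k < 2 * n - 1 \<Longrightarrow> 0 < Out ! (m - 2 * n + k) \<Longrightarrow>
          snd s6 4 ! k = Zm ! nat (Od ! nat (Out ! (m - 2 * n + k) - 1)) \<and>
          snd s6 5 ! k = Ze ! nat (Od ! nat (Out ! (m - 2 * n + k) - 1)) - int f"
       "\<And>k. k < 2 * n - 1 \<Longrightarrow> \<not> 0 < Out ! (m - 2 * n + k) \<Longrightarrow> snd s6 4 ! k = 0"
      using runs_emit[OF s5(2,3,1,4,5,6) out5 lens(3,4,2) lenOut n(1) m1(2) OdZ OutZ fm(3) ZeM] unfolding runs_def by blast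
    have sb: "scaled_blocks F G A m Zm Ze 0" "scaled_blocks F G B m Zm Ze m"
      using r2 by (auto intro!: scaled_blocksI simp: Zm_def Ze_def)
    have "is_approx_min_plus_conv (fp_real \<epsilon>) (map fp_value A) (map fp_value B) (map fp_value (zip (snd s6 4) (snd s6 5)))"
      by (rule min_max_blocks_approx[OF n(2,3,1) AB eps eps_b(2) _ G_def F_f F4 _ m_def sb S _ _ _ _ conv r6])
        (use eps_b(3,4) r4 in \<open>auto simp: \<epsilon> F_def A'_def B'_def\<close>)
    moreover have "exec M (approx_prog P) s0 (t1 + (t2 + (t3 + (t4 + (t5 + t6))))) s6"
      unfolding approx_prog_def using e1 e2 e3 e4 e5' e6 by (blast intro: exec.Seq)
    moreover have "real (t1 + (t2 + (t3 + (t4 + (t5 + t6))))) \<le> T m + real (m * (176 * L + 502) + 200)"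
    proof -
      \<comment> \<open>The coefficient 502 is 62 + 300 + 40 + 100 from filling, sorting, ranking
        and emitting, the last one using \<open>n \<le> m\<close>. The constants add up to
        200.\<close>
      have "t1 + t2 + t3 + t4 + t6 \<le> 60 + (m * 62 + 20) + (2 * m * (88 * L + 150) + 50) + (m * 40 + 20) + (n * 100 + 50)"
        using e1 e2 e3 e4 e6 by linarith
      also have "\<dots> \<le> m * (176 * L + 502) + 200" using m1(2) by (simp add: algebra_simps)
      finally have "real (t1 + t2 + t3 + t4 + t6) \<le> real (m * (176 * L + 502) + 200)" by (simp only: of_nat_le_iff)
      then show ?thesis using e5(2) by simp
    qed
    ultimately show ?thesis using r6(1,2) unfolding s0_def[symmetric] by (metis prod.collapse)
  qed
  show ?thesis unfolding M_eq
    by (intro exI[of _ m] exI[of _ "nat E"] conjI allI impI main)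
      (use m1 eps_b(2,5) in \<open>auto simp: m_def \<epsilon>\<close>)
qed

section \<open>From approximate min-plus to exact min-max convolution\<close>

text \<open>Register 1 holds the largest input number, register 3 the spread \<open>c\<close> between exponents. Registers
  and arrays from 20 on belong to the embedded program.\<close>

definition max_body :: com where
  "max_body =
    Seq (If (Less (V 1) (Get 0 (V 2))) (Assign 1 (Get 0 (V 2))) Skip)
      (If (Less (V 1) (Get 1 (V 2))) (Assign 1 (Get 1 (V 2))) Skip)"

definition enc_body :: com where
  "enc_body =
    Seq (If (Less (N 0) (Get 0 (V 2)))
          (Seq (Store 20 (V 2) (N 1)) (Store 21 (V 2) (Bin Times (V 3) (Get 0 (V 2))))) Skip)
      (If (Less (N 0) (Get 1 (V 2)))
          (Seq (Store 22 (V 2) (N 1)) (Store 23 (V 2) (Bin Times (V 3) (Get 1 (V 2))))) Skip)"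

text \<open>The spread is proportional to \<open>n\<close> plus the largest input number, far above
  the logarithmic growth of the word length; the 3 keeps it at least 3. The last two assignments set
  the length and the mantissa of \<open>\<epsilon>\<close>; its exponent is still 0, so
  \<open>\<epsilon> = 1\<close>.\<close>

definition enc_prog :: "int \<Rightarrow> com" where
  "enc_prog c0 = Seq (For 2 0 max_body)
    (Seq (Assign 3 (Bin Times (N c0) (Bin Plus (Bin Plus (V 0) (V 1)) (N 3))))
    (Seq (Alloc 20 (V 0)) (Seq (Alloc 21 (V 0)) (Seq (Alloc 22 (V 0)) (Seq (Alloc 23 (V 0))
    (Seq (For 2 0 enc_body)
    (Seq (Assign 20 (V 0)) (Assign 21 (N 1)))))))))"

text \<open>\<open>- ((2 - e) div c)\<close> is the ceiling of \<open>(e - 2) / c\<close>. Entries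
  with mantissa 0 stay 0, which is infinity in both encodings.\<close>

definition dec_body :: com where
  "dec_body =
    If (Less (N 0) (Get 24 (V 2)))
      (Store 2 (V 2) (Bin Minus (N 0) (Bin Div (Bin Minus (N 2) (Get 25 (V 2))) (V 3)))) Skip"

definition dec_prog :: com where
  "dec_prog = Seq (Assign 4 (Bin Minus (Bin Times (N 2) (V 0)) (N 1))) (Seq (Alloc 2 (V 4)) (For 2 4 dec_body))"

definition exact_prog :: "int \<Rightarrow> com \<Rightarrow> com" where
  "exact_prog c0 P = Seq (enc_prog c0) (Seq (shift 20 P) dec_prog)"

lemma wr_exact_parts [simp]:
  "wregs max_body = {1}" "wregs enc_body = {}" "wregs (enc_prog c0) = {1, 2, 3, 20, 21}" "wregs dec_body = {}" "wregs dec_prog = {2, 4}"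
  by (auto simp: max_body_def enc_body_def enc_prog_def dec_body_def dec_prog_def)

lemma wa_exact_parts [simp]:
  "warrs max_body = {}" "warrs enc_body = {20, 21, 22, 23}" "warrs (enc_prog c0) = {20, 21, 22, 23}" "warrs dec_body = {2}" "warrs dec_prog = {2}"
  by (auto simp: max_body_def enc_body_def enc_prog_def dec_body_def dec_prog_def)

section \<open>Correctness and cost of encoding and decoding\<close>

lemma runs_max:
  assumes s: "fst s 0 = int n" "fst s 1 = 0" "snd s 0 = A" "snd s 1 = B" and len: "length A = n" "length B = n" and n: "1 \<le> n"
    and W: "0 \<le> W" "\<And>x. x \<in> set A \<union> set B \<Longrightarrow> x \<le> W" and M: "int n \<le> M"
  shows "runs M (For 2 0 max_body) s (n * (24 + 8) + 8) (\<lambda>s'. 0 \<le> fst s' 1 \<and> fst s' 1 \<le> W \<and>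
    (\<forall>x \<in> set A \<union> set B. x \<le> fst s' 1))"
proof -
  define I where "I i s' \<longleftrightarrow> 0 \<le> fst s' 1 \<and> fst s' 1 \<le> W \<and> (\<forall>k<i. A ! k \<le> fst s' 1 \<and> B ! k \<le> fst s' 1)" for i and s' :: state
  have "runs M (For 2 0 max_body) s (n * (24 + 8) + 8) (I n)"
  proof (rule runs_For)
    show "I 0 s" using s W by (simp add: I_def)
    fix i s' assume i: "i < n" "I i s'" "fst s' 2 = int i" and fr: "frame (For 2 0 max_body) s s'"
    have s': "snd s' 0 = A" "snd s' 1 = B" using fr s by (auto simp: frame_def)
    define y where "y = max (max (fst s' 1) (A ! i)) (B ! i)"
    have "wp M max_body (\<lambda>s''. fst s'' 1 = y) s'"
      unfolding max_body_def y_def using i(1) len by (simp add: s' i(3) max_def del: One_nat_def)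
    then have "runs M max_body s' 24 (\<lambda>s''. fst s'' 1 = y)" by (rule runs_wp) (simp add: max_body_def)
    moreover have "A ! i \<le> W" "B ! i \<le> W" using W(2) i(1) len by auto
    ultimately show "runs M max_body s' 24 (I (Suc i))"
      by (elim runs_mono) (use i(2) in \<open>auto simp: I_def y_def less_Suc_eq le_max_iff_disj\<close>)
  qed (use s n M in \<open>auto simp: I_def\<close>)
  then show ?thesis by (rule runs_mono) (auto simp: I_def in_set_conv_nth len)
qed

lemma runs_enc:
  assumes s: "fst s 0 = int n" "fst s 3 = c" "snd s 0 = A" "snd s 1 = B"
     "snd s 20 = replicate n 0" "snd s 21 = replicate n 0" "snd s 22 = replicate n 0" "snd s 23 = replicate n 0"
    and len: "length A = n" "length B = n" and n: "1 \<le> n"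
    and M: "int n \<le> M" "\<And>x. x \<in> set A \<union> set B \<Longrightarrow> \<bar>c * x\<bar> \<le> M"
  shows "runs M (For 2 0 enc_body) s (n * (40 + 8) + 8) (\<lambda>s'.
     snd s' 20 = map (\<lambda>x. if 0 < x then 1 else 0) A \<and> snd s' 21 = map (\<lambda>x. if 0 < x then c * x else 0) A \<and>
     snd s' 22 = map (\<lambda>x. if 0 < x then 1 else 0) B \<and> snd s' 23 = map (\<lambda>x. if 0 < x then c * x else 0) B)"
proof -
  define upto :: "nat \<Rightarrow> (int \<Rightarrow> int) \<Rightarrow> int list \<Rightarrow> int list \<Rightarrow> bool"
    where "upto k f X Y \<longleftrightarrow> length Y = n \<and> (\<forall>i<n. Y ! i = (if i < k \<and> 0 < X ! i then f (X ! i) else 0))" for k f X Y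
  define I where "I k s' \<longleftrightarrow> upto k (\<lambda>_. 1) A (snd s' 20) \<and> upto k (\<lambda>x. c * x) A (snd s' 21) \<and>
     upto k (\<lambda>_. 1) B (snd s' 22) \<and> upto k (\<lambda>x. c * x) B (snd s' 23)" for k and s' :: state
  have up: "upto (Suc k) f X (if 0 < X ! k then Y[k := f (X ! k)] else Y)" if "upto k f X Y" "k < n" for k f X Y
    using that by (auto simp: upto_def nth_list_update less_Suc_eq)
  have fin: "Y = map (\<lambda>x. if 0 < x then f x else 0) X" if "upto n f X Y" "length X = n" for f X Y
    using that by (intro nth_equalityI) (auto simp: upto_def)
  have "runs M (For 2 0 enc_body) s (n * (40 + 8) + 8) (I n)"
  proof (rule runs_For)
    show "I 0 s" using s by (simp add: I_def upto_def)
    fix i s' assume i: "i < n" "I i s'" "fst s' 2 = int i" and fr: "frame (For 2 0 enc_body) s s'"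
    have s': "fst s' 3 = c" "snd s' 0 = A" "snd s' 1 = B" using fr s by (auto simp: frame_def)
    have l: "length (snd s' 20) = n" "length (snd s' 21) = n" "length (snd s' 22) = n" "length (snd s' 23) = n"
      using i(2) by (auto simp: I_def upto_def)
    have c: "\<bar>c * A ! i\<bar> \<le> M" "\<bar>c * B ! i\<bar> \<le> M" "1 \<le> M" "0 \<le> M" using M i(1) len n by auto
    have "wp M enc_body (\<lambda>s''. snd s'' 20 = (if 0 < A ! i then (snd s' 20)[i := 1] else snd s' 20) \<and>
        snd s'' 21 = (if 0 < A ! i then (snd s' 21)[i := c * A ! i] else snd s' 21) \<and>
        snd s'' 22 = (if 0 < B ! i then (snd s' 22)[i := 1] else snd s' 22) \<and>
        snd s'' 23 = (if 0 < B ! i then (snd s' 23)[i := c * B ! i] else snd s' 23)) s'"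
      unfolding enc_body_def using i(1) len by (simp add: s' i(3) l c del: One_nat_def)
    then show "runs M enc_body s' 40 (I (Suc i))"
      by (rule runs_mono[OF runs_scost], simp add: enc_body_def) (use i(2) up[OF _ i(1), of "\<lambda>_. 1"] up[OF _ i(1), of "\<lambda>x. c * x"] in \<open>simp_all add: I_def\<close>)
  qed (use s n M in \<open>auto simp: I_def\<close>)
  then show ?thesis by (rule runs_mono) (use fin len in \<open>auto simp: I_def\<close>)
qed

definition encode :: "int \<Rightarrow> int list \<Rightarrow> (int \<times> int) list" where
  "encode c A = map (\<lambda>x. if 0 < x then (1, c * x) else (0, 0)) A"

lemma map_fst_snd_encode:
  "map fst (encode c A) = map (\<lambda>x. if 0 < x then 1 else 0) A"
  "map snd (encode c A) = map (\<lambda>x. if 0 < x then c * x else 0) A"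
  by (auto simp: encode_def)

lemma runs_enc_prog:
  assumes len: "length A = n" "length B = n" and n: "1 \<le> n"
    and W: "0 \<le> W" "\<And>x. x \<in> set A \<union> set B \<Longrightarrow> 0 \<le> x \<and> x \<le> W" and c0: "1 \<le> c0"
    and M: "c0 * (int n + W + 3) * (W + 1) \<le> M"
  shows "runs M (enc_prog c0) (exact_input A B) (n * 90 + 50) (\<lambda>s. \<exists>W0. 0 \<le> W0 \<and> W0 \<le> W \<and>
     (\<forall>x \<in> set A \<union> set B. x \<le> W0) \<and> fst s 0 = int n \<and> fst s 3 = c0 * (int n + W0 + 3) \<and>
     embeds 20 (approx_input (encode (c0 * (int n + W0 + 3)) A) (encode (c0 * (int n + W0 + 3)) B) (1, 0)) s)"
    (is "runs _ _ ?s0 _ ?Q")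
proof -
  define X where "X = c0 * (int n + W + 3)"
  have X: "int n + W + 3 \<le> X" "c0 \<le> X"
    using mult_right_mono[of 1 c0 "int n + W + 3"] mult_left_mono[of 1 "int n + W + 3" c0] c0 W(1)
    by (simp_all add: X_def)
  have "X * 1 \<le> X * (W + 1)" using X c0 W(1) by (intro mult_left_mono) auto
  then have "X \<le> M" using M[folded X_def] by simp
  then have "X \<le> M" "int n + W + 3 \<le> M" "c0 \<le> M" "int n \<le> M" "3 \<le> M" "1 \<le> M"
    using X W(1) by auto
  note Mb = this[unfolded X_def]
  have s0: "fst ?s0 0 = int n" "fst ?s0 1 = 0" "snd ?s0 0 = A" "snd ?s0 1 = B"
    "\<And>x. 20 \<le> x \<Longrightarrow> fst ?s0 x = 0" "\<And>x. 20 \<le> x \<Longrightarrow> snd ?s0 x = []"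
    using len by (auto simp: exact_input_def)
  have "runs M (enc_prog c0) ?s0 ((n * (24 + 8) + 8) + (8 + ((n + 2) + ((n + 2) + ((n + 2) + ((n + 2) +
     ((n * (40 + 8) + 8) + (2 + 2)))))))) ?Q"
    unfolding enc_prog_def
  proof (rule runs_Seq[OF runs_max[OF s0(1-4) len n W(1)]], goal_cases)
    case (3 s1)
    define c where "c = c0 * (int n + fst s1 1 + 3)"
    have f1: "fst s1 0 = int n" "snd s1 0 = A" "snd s1 1 = B" "\<And>x. 20 \<le> x \<Longrightarrow> fst s1 x = 0" "\<And>x. 20 \<le> x \<Longrightarrow> snd s1 x = []"
      using 3(2) s0 by (auto simp: frame_def)
    have c1: "0 \<le> c" "c \<le> c0 * (int n + W + 3)"
      using 3(1) c0 unfolding c_def by (auto intro!: mult_nonneg_nonneg mult_left_mono)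
    have c2: "\<bar>c * x\<bar> \<le> M" if "x \<in> set A \<union> set B" for x
    proof -
      have "0 \<le> x" "x \<le> W" using W(2)[OF that] by auto
      then have "c * x \<le> c0 * (int n + W + 3) * (W + 1)" using c1 by (intro mult_mono) auto
      then show ?thesis using M c1 \<open>0 \<le> x\<close> by (simp add: abs_mult)
    qed
    show ?case
    proof (rule runs_Seq[where R = "\<lambda>s'. s' = ((fst s1)(3 := c), snd s1)"], goal_cases)
      case 1
      have "0 \<le> fst s1 1" "fst s1 1 \<le> W" using 3(1) by auto
      moreover have "\<bar>c0 * (int n + fst s1 1 + 3)\<bar> \<le> M" using c1 Mb unfolding c_def by linarith
      ultimately show ?case using Mb c0 by (intro runs_wp) (auto simp: f1 c_def)
    next
      case (2 s2)
      show ?case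
      proof (rule runs_Seq[where R = "\<lambda>s'. s' = ((fst s1)(3 := c), (snd s1)(20 := replicate n 0))"], goal_cases)
        case 1
        show ?case by (rule runs_Alloc) (use 2 f1 in auto)
      next
        case (2 s3)
        show ?case
        proof (rule runs_Seq[where R = "\<lambda>s'. s' = ((fst s1)(3 := c), (snd s1)(20 := replicate n 0, 21 := replicate n 0))"], goal_cases)
          case 1
          show ?case by (rule runs_Alloc) (use 2 f1 in auto)
        next
          case (2 s4)
          show ?case
          proof (rule runs_Seq[where R = "\<lambda>s'. s' = ((fst s1)(3 := c), (snd s1)(20 := replicate n 0, 21 := replicate n 0, 22 := replicate n 0))"], goal_cases)
            case 1
            show ?case by (rule runs_Alloc) (use 2 f1 in auto)
          next
            case (2 s5)
            show ?case
            proof (rule runs_Seq[where R = "\<lambda>s'. s' = ((fst s1)(3 := c), (snd s1)(20 := replicate n 0, 21 := replicate n 0, 22 := replicate n 0, 23 := replicate n 0))"], goal_cases)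
              case 1
              show ?case by (rule runs_Alloc) (use 2 f1 in auto)
            next
              case (2 s6)
              have s6: "fst s6 0 = int n" "fst s6 3 = c" "snd s6 0 = A" "snd s6 1 = B"
                "snd s6 20 = replicate n 0" "snd s6 21 = replicate n 0" "snd s6 22 = replicate n 0" "snd s6 23 = replicate n 0"
                "\<And>x. 20 \<le> x \<Longrightarrow> fst s6 x = 0" "\<And>x. 24 \<le> x \<Longrightarrow> snd s6 x = []"
                using 2(1) f1 by auto
              show ?case
              proof (rule runs_Seq[OF runs_enc[OF s6(1-8) len n Mb(4) c2]], goal_cases)
                case (2 s7)
                have s7: "fst s7 0 = int n" "fst s7 3 = c" "\<And>x. 20 \<le> x \<Longrightarrow> fst s7 x = 0" "\<And>x. 24 \<le> x \<Longrightarrow> snd s7 x = []"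
                  using 2(2) s6 by (auto simp: frame_def)
                have "embeds 20 (approx_input (encode c A) (encode c B) (1, 0)) ((fst s7)(20 := int n, 21 := 1), snd s7)"
                  unfolding embeds_def approx_input_def map_fst_snd_encode using 2(1) s7(3,4) len
                  by (auto simp: encode_def)
                moreover have "(\<forall>x \<in> set A \<union> set B. x \<le> fst s1 1)" "0 \<le> fst s1 1" "fst s1 1 \<le> W" using 3(1) by auto
                ultimately have "?Q ((fst s7)(20 := int n, 21 := 1), snd s7)"
                  using s7(1,2) by (intro exI[of _ "fst s1 1"]) (simp add: c_def)
                then have "runs M (Seq (Assign 20 (V 0)) (Assign 21 (N 1))) s7 4 ?Q"
                  using Mb(6) s7(1) by (intro runs_wp) simp_all
                then show ?case by simp
              qed
            qed
          qed
        qed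
      qed
    qed
  qed (use W Mb in auto)
  then show ?thesis by (rule runs_mono) auto
qed

lemma runs_dec_prog:
  assumes s: "fst s 0 = int n" "fst s 3 = c" "snd s 24 = Cm" "snd s 25 = Ce" and len: "length Cm = 2 * n - 1" "length Ce = 2 * n - 1"
    and n: "1 \<le> n" and c: "0 < c" and M: "2 * int n \<le> M" "\<And>x. x \<in> set Ce \<Longrightarrow> \<bar>x\<bar> + 2 \<le> M"
  shows "runs M dec_prog s (n * 100 + 50) (\<lambda>s'. length (snd s' 2) = 2 * n - 1 \<and>
     (\<forall>k<2 * n - 1. snd s' 2 ! k = (if 0 < Cm ! k then - ((2 - Ce ! k) div c) else 0)))"
proof -
  define h where "h = 2 * n - 1"
  define I where "I i s' \<longleftrightarrow> length (snd s' 2) = h \<and>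
     (\<forall>k<h. snd s' 2 ! k = (if k < i \<and> 0 < Cm ! k then - ((2 - Ce ! k) div c) else 0))" for i and s' :: state
  have loop: "runs M (For 2 4 dec_body) s0 (h * (20 + 8) + 8) (I h)"
    if s0: "s0 = ((fst s)(4 := int h), (snd s)(2 := replicate h 0))" for s0
  proof (rule runs_For)
    show "I 0 s0" by (simp add: I_def s0)
    show "fst s0 4 = int h" by (simp add: s0)
    fix k s' assume k: "k < h" "I k s'" "fst s' 2 = int k" and fr: "frame (For 2 4 dec_body) s0 s'"
    have s': "fst s' 3 = c" "snd s' 24 = Cm" "snd s' 25 = Ce" using fr s by (auto simp: frame_def s0)
    have l: "length (snd s' 2) = h" "length Cm = h" "length Ce = h" using k len by (auto simp: I_def h_def)
    have e: "\<bar>Ce ! k\<bar> + 2 \<le> M" using M(2) k(1) l(3) by simp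
    then have b: "\<bar>2 - Ce ! k\<bar> \<le> M" "2 \<le> M" "0 \<le> M" by linarith+
    then have b2: "\<bar>(2 - Ce ! k) div c\<bar> \<le> M" using abs_div_le_abs[OF c, of "2 - Ce ! k"] by linarith
    have "wp M dec_body (\<lambda>s''. snd s'' 2 = (if 0 < Cm ! k then (snd s' 2)[k := - ((2 - Ce ! k) div c)] else snd s' 2)) s'"
      unfolding dec_body_def using c by (simp add: s' k(1,3) l b b2 del: One_nat_def)
    then show "runs M dec_body s' 20 (I (Suc k))"
      by (rule runs_mono[OF runs_scost], simp add: dec_body_def) (use k(1,2) in \<open>auto simp: I_def nth_list_update less_Suc_eq\<close>)
  qed (use M n in \<open>auto simp: I_def h_def\<close>)
  have h: "2 * int n - 1 = int h" "int h \<le> M" "2 \<le> M" using n M(1) by (auto simp: h_def)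
  have "runs M dec_prog s (6 + ((h + 2) + (h * (20 + 8) + 8))) (I h)"
    unfolding dec_prog_def
  proof (rule runs_Seq[where R = "\<lambda>s'. s' = ((fst s)(4 := int h), snd s)"], goal_cases)
    case 1
    show ?case using s(1) h M(1) by (intro runs_wp) simp_all
  next
    case (2 s1)
    show ?case
    proof (rule runs_Seq[where R = "\<lambda>s'. s' = ((fst s)(4 := int h), (snd s)(2 := replicate h 0))"], goal_cases)
      case 1
      show ?case by (rule runs_Alloc) (use 2 in auto)
    qed (use loop in simp)
  qed
  then show ?thesis by (rule runs_mono) (use n in \<open>auto simp: I_def h_def\<close>)
qed


section \<open>Reading the result off the exponents\<close>

lemma two_powi_le_iff: "(2::real) powi a \<le> 2 powi b \<longleftrightarrow> a \<le> b"
  using power_int_strict_increasing[of b a "2::real"] power_int_increasing[of a b "2::real"]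
  by (auto simp: not_less[symmetric])

text \<open>The spread exceeds the bit length of every word, so an exponent alone, with its mantissa
  unknown, determines the rounded value.\<close>

lemma decode_exponent:
  fixes c m0 x e :: int
  assumes c: "3 \<le> c" and x: "1 \<le> x" "8 * x \<le> 2 ^ nat c"
    and lo: "2 powi (c * m0) \<le> fp_real (x, e)" and hi: "fp_real (x, e) \<le> 2 powi (c * m0 + 2)"
  shows "- ((2 - e) div c) = m0"
proof -
  have "1 * (2::real) powi e \<le> fp_real (x, e)" unfolding fp_real_def fst_conv snd_conv
    using x by (intro mult_right_mono) auto
  then have "(2::real) powi e \<le> 2 powi (c * m0 + 2)" using hi by simp
  then have e1: "e \<le> c * m0 + 2" by (simp add: two_powi_le_iff)
  have "real_of_int (8 * x) \<le> of_int (2 ^ nat c)" using x by (simp only: of_int_le_iff)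
  also have "\<dots> = 2 powi c" using c by (simp add: power_int_def)
  finally have "of_int (8 * x) * (2::real) powi e \<le> 2 powi c * 2 powi e" by (intro mult_right_mono) auto
  moreover have "8 * 2 powi (c * m0) \<le> of_int (8 * x) * (2::real) powi e" using lo by (simp add: fp_real_def)
  moreover have "(2::real) powi (c * m0 + 3) = 8 * 2 powi (c * m0)" "(2::real) powi (c + e) = 2 powi c * 2 powi e"
    by (simp_all add: power_int_add)
  ultimately have "(2::real) powi (c * m0 + 3) \<le> 2 powi (c + e)" by linarith
  then have e2: "c * m0 + 3 \<le> c + e" by (simp add: two_powi_le_iff)
  \<comment> \<open>The mantissa is at least 1, so \<open>e - 2 \<le> c * m0\<close>. It is at most
    \<open>2 ^ c / 8\<close>, so \<open>e - 2 \<ge> c * (m0 - 1) + 1\<close>: the factor 8 is what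
    keeps this bound strictly above \<open>c * (m0 - 1)\<close>. Hence the ceiling of
    \<open>(e - 2) / c\<close> is \<open>m0\<close>.\<close>
  have "(2 - e) div c = - m0"
    using e1 e2 c by (intro int_div_pos_eq[of _ _ _ "2 - e + c * m0"]) auto
  then show ?thesis by simp
qed

lemma fp_value_encode:
  "i < length A \<Longrightarrow> fp_value (encode c A ! i) = (if 0 < A ! i then ereal (2 powi (c * A ! i)) else \<infinity>)"
  by (auto simp: encode_def fp_value_def fp_real_def)

text \<open>A sum of two powers of 2 lies between the larger one and its double, so the min-plus
  optimum lies between \<open>2 ^ (c * m0)\<close> and its double, where \<open>m0\<close> is the
  min-max optimum. With \<open>\<epsilon> = 1\<close> another factor 2 is lost, which gives the
  interval up to \<open>2 ^ (c * m0 + 2)\<close> required by \<open>decode_exponent\<close>.\<close>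

lemma min_max_decode:
  fixes A B :: "int list"
  assumes len: "length A = n" "length B = n" "1 \<le> n" and pos: "\<And>x. x \<in> set A \<union> set B \<Longrightarrow> 0 \<le> x"
    and c: "3 \<le> c"
    and approx: "is_approx_min_plus_conv 1 (map fp_value (encode c A)) (map fp_value (encode c B)) (map fp_value (zip Cm Ce))"
    and C: "length Cm = length Ce" "\<And>x. x \<in> set Cm \<Longrightarrow> 8 * x \<le> 2 ^ nat c"
    and D: "length D = 2 * n - 1" "\<And>k. k < 2 * n - 1 \<Longrightarrow> D ! k = (if 0 < Cm ! k then - ((2 - Ce ! k) div c) else 0)"
  shows "is_min_max_conv (map int_value A) (map int_value B) (map int_value D)"
proof -
  let ?A = "map fp_value (encode c A)" and ?B = "map fp_value (encode c B)"
  let ?A' = "map int_value A" and ?B' = "map int_value B"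
  have lens: "length ?A = n" "length ?B = n" "length Cm = 2 * n - 1"
    using len approx C(1) by (auto simp: is_approx_min_plus_conv_def encode_def)
  have pw: "(2::real) powi (c * a) \<le> 2 powi (c * b)" if "a \<le> b" for a b
    using that c by (intro power_int_increasing) auto
  have p0: "0 < (2::real) powi z" for z by simp
  have "int_value (D ! k) = min_max_conv ?A' ?B' k" if k: "k < 2 * n - 1" for k
  proof -
    have ap: "min_plus_conv ?A ?B k \<le> fp_value (Cm ! k, Ce ! k)" "fp_value (Cm ! k, Ce ! k) \<le> ereal 2 * min_plus_conv ?A ?B k"
      using approx k lens C(1) by (auto simp: is_approx_min_plus_conv_def)
    have "k < length ?A + length ?B - 1" "?A \<noteq> []" "?B \<noteq> []" using k lens len(3) by (auto simp: encode_def)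
    then obtain i' j' where "i' < length ?A" "j' < length ?B" and ij': "i' + j' = k" "min_plus_conv ?A ?B k = ?A ! i' + ?B ! j'"
      by (rule min_plus_conv_attained)
    then have ij'n: "i' < n" "j' < n" using lens by auto
    have "k < length ?A' + length ?B' - 1" "?A' \<noteq> []" "?B' \<noteq> []" using k len by auto
    then obtain i j where "i < length ?A'" "j < length ?B'" and ij: "i + j = k" "min_max_conv ?A' ?B' k = max (?A' ! i) (?B' ! j)"
      by (rule min_max_conv_attained)
    then have ijn: "i < n" "j < n" using len by auto
    have mp: "min_plus_conv ?A ?B k \<le> fp_value (encode c A ! i) + fp_value (encode c B ! j)"
      using min_plus_conv_le[of i ?A j ?B] ij(1) ijn lens by (simp add: encode_def)
    have mm: "min_max_conv ?A' ?B' k \<le> max (int_value (A ! i')) (int_value (B ! j'))"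
      using min_max_conv_le[of i' ?A' j' ?B'] ij'(1) ij'n len by simp
    have mp': "min_plus_conv ?A ?B k = fp_value (encode c A ! i') + fp_value (encode c B ! j')"
      using ij'(2) ij'n lens by (simp add: encode_def)
    have mm': "min_max_conv ?A' ?B' k = max (int_value (A ! i)) (int_value (B ! j))"
      using ij(2) ijn len by simp
    have nn: "0 \<le> A ! i" "0 \<le> B ! j" "0 \<le> A ! i'" "0 \<le> B ! j'" using pos ijn ij'n len by auto
    show ?thesis
    proof (cases "A ! i = 0 \<or> B ! j = 0")
      case True
      then have inf: "min_max_conv ?A' ?B' k = \<infinity>" unfolding mm' by (auto simp: int_value_def)
      then have "A ! i' = 0 \<or> B ! j' = 0" using mm by (auto simp: int_value_def max_def split: if_splits)
      then have "min_plus_conv ?A ?B k = \<infinity>"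
        unfolding mp' using ij'n len by (auto simp: fp_value_encode)
      \<comment> \<open>No finite number is an upper bound for infinity, so the output has to be
        infinite.\<close>
      then have "Cm ! k = 0" using ap(1) by (auto simp: fp_value_def split: if_splits)
      then show ?thesis using D(2)[OF k] inf by (simp add: int_value_def)
    next
      case False
      then have ab: "0 < A ! i" "0 < B ! j" using nn by auto
      define m0 where "m0 = max (A ! i) (B ! j)"
      have m0: "min_max_conv ?A' ?B' k = int_value m0" "0 < m0"
        unfolding mm' using ab by (auto simp: int_value_def m0_def max_def)
      have "min_plus_conv ?A ?B k \<le> ereal (2 powi (c * A ! i) + 2 powi (c * B ! j))"
        using mp ab ijn len by (simp add: fp_value_encode)
      also have "\<dots> \<le> ereal (2 * 2 powi (c * m0))"
        using pw[of "A ! i" m0] pw[of "B ! j" m0] by (simp add: m0_def)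
      finally have up: "min_plus_conv ?A ?B k \<le> ereal (2 * 2 powi (c * m0))" .
      then have ab': "0 < A ! i'" "0 < B ! j'" unfolding mp' using ij'n len nn
        by (auto simp: fp_value_encode split: if_splits)
      then have mpv: "min_plus_conv ?A ?B k = ereal (2 powi (c * A ! i') + 2 powi (c * B ! j'))"
        unfolding mp' using ij'n len by (simp add: fp_value_encode)
      \<comment> \<open>The pair that is optimal for min-plus also competes for the min-max minimum,
        so its larger entry is at least \<open>m0\<close>.\<close>
      have "m0 \<le> A ! i' \<or> m0 \<le> B ! j'" using mm m0 ab' by (auto simp: int_value_def max_def split: if_splits)
      then have "2 powi (c * m0) \<le> 2 powi (c * A ! i') + (2::real) powi (c * B ! j')"
        using pw[of m0 "A ! i'"] pw[of m0 "B ! j'"] p0[of "c * A ! i'"] p0[of "c * B ! j'"] by linarith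
      then have lo: "ereal (2 powi (c * m0)) \<le> fp_value (Cm ! k, Ce ! k)"
        using ap(1) unfolding mpv by (metis ereal_less_eq(3) order_trans)
      have "fp_value (Cm ! k, Ce ! k) \<le> ereal 2 * ereal (2 * 2 powi (c * m0))"
        using ap(2) ereal_mult_left_mono[OF up, of "ereal 2"] by (simp add: order_trans)
      then have hi: "fp_value (Cm ! k, Ce ! k) \<le> ereal (2 powi (c * m0 + 2))" by (simp add: power_int_add mult.commute)
      then have nz: "Cm ! k \<noteq> 0" by (auto simp: fp_value_def)
      then have lh: "2 powi (c * m0) \<le> fp_real (Cm ! k, Ce ! k)" "fp_real (Cm ! k, Ce ! k) \<le> 2 powi (c * m0 + 2)"
        using lo hi by (simp_all add: fp_value_def)
      have "0 < fp_real (Cm ! k, Ce ! k)" using lh(1) p0[of "c * m0"] by linarith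
      moreover have "\<not> (2::real) powi (Ce ! k) < 0" by (simp add: not_less)
      ultimately have Cpos: "0 < Cm ! k" by (auto simp: fp_real_def zero_less_mult_iff)
      have "- ((2 - Ce ! k) div c) = m0"
        using Cpos C(2) k lens by (intro decode_exponent[OF c _ _ lh]) auto
      then show ?thesis using D(2)[OF k] Cpos m0(1) by simp
    qed
  qed
  then show ?thesis unfolding is_min_max_conv_def using D(1) len by (simp add: mult_2)
qed

text \<open>The base on the left bounds the input size of the subroutine when the spread is
  \<open>4 ^ (r + 2) * u\<close>. By \<open>u \<le> 2 ^ u\<close> the left side has at most
  \<open>3 + r * (1 + 2 * (r + 2) + 2 * u)\<close> bits. This is at most
  \<open>16 * (r + 1)\<^sup>2 * u\<close>, and \<open>r + 1 \<le> 2 ^ r\<close> makes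
  \<open>4 ^ (r + 2)\<close> a sufficient factor.\<close>

lemma spread_bound:
  fixes u r :: nat
  assumes "1 \<le> u"
  shows "8 * (2 * 4 ^ (r + 2) * u\<^sup>2) ^ r \<le> 2 ^ (4 ^ (r + 2) * u)"
proof -
  define z where "z = 1 + 2 * (r + 2) + 2 * u"
  have "u \<le> 2 ^ u" by (rule less_imp_le[OF less_exp])
  then have "u\<^sup>2 \<le> (2 ^ u)\<^sup>2" by (rule power_mono) simp
  then have "2 * 4 ^ (r + 2) * u\<^sup>2 \<le> 2 * 4 ^ (r + 2) * (2 ^ u)\<^sup>2" by simp
  also have "\<dots> = 2 ^ (1 + 2 * (r + 2) + 2 * u)"
    by (simp add: power_add power_mult power2_eq_square mult_2_right power_mult_distrib[symmetric])
  finally have "(2 * 4 ^ (r + 2) * u\<^sup>2) ^ r \<le> (2 ^ z) ^ r" unfolding z_def by (rule power_mono) simp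
  then have "8 * (2 * 4 ^ (r + 2) * u\<^sup>2) ^ r \<le> 8 * (2 ^ z) ^ r" by (rule mult_left_mono) simp
  also have "\<dots> = 2 ^ (3 + z * r)" by (simp add: power_add power_mult)
  also have "\<dots> \<le> 2 ^ (4 ^ (r + 2) * u)"
  proof (rule power_increasing)
    have "r + 1 \<le> 2 ^ r" using less_exp[of r] by (simp add: Suc_le_eq)
    then have "(r + 1)\<^sup>2 \<le> (2 ^ r)\<^sup>2" by (rule power_mono) simp
    then have 4: "16 * (r + 1)\<^sup>2 \<le> 4 ^ (r + 2)"
      by (simp add: power_add power2_eq_square power_mult_distrib[symmetric])
    have "z = (5 + 2 * r) * 1 + 2 * u" by (simp add: z_def)
    also have "\<dots> \<le> (5 + 2 * r) * u + 2 * u" using assms by (intro add_right_mono mult_left_mono) auto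
    finally have "z \<le> (5 + 2 * r) * u + 2 * u" .
    then have "3 + z * r \<le> 3 * u + ((5 + 2 * r) * u + 2 * u) * r"
      using assms by (intro add_mono mult_right_mono) auto
    also have "\<dots> \<le> 16 * (r + 1)\<^sup>2 * u" by (simp add: power2_eq_square algebra_simps)
    also have "\<dots> \<le> 4 ^ (r + 2) * u" using 4 by (rule mult_right_mono) simp
    finally show "3 + z * r \<le> 4 ^ (r + 2) * u" .
  qed simp
  finally show ?thesis .
qed

text \<open>Two limits are kept apart: \<open>M\<close> for the whole program, and \<open>M1\<close>
  for the words of the embedded run. Decoding compares the spread with \<open>M1\<close>, which
  itself depends on the spread. The subroutine is called with \<open>\<epsilon> = (1, 0)\<close>,
  whence the time \<open>T n 1\<close>.\<close>

lemma exact_prog_correct: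
  fixes A B :: "int list" and T :: "nat \<Rightarrow> real \<Rightarrow> real"
  assumes P: "\<And>n A B \<epsilon>. 1 \<le> n \<Longrightarrow> length A = n \<Longrightarrow> length B = n \<Longrightarrow>
      fp_value ` set A \<subseteq> Rplus \<Longrightarrow> fp_value ` set B \<subseteq> Rplus \<Longrightarrow> 0 < fp_real \<epsilon> \<Longrightarrow>
      \<exists>t regs arrs. exec (approx_max_word w A B \<epsilon>) P (approx_input A B \<epsilon>) t (regs, arrs) \<and>
        real t \<le> T n (fp_real \<epsilon>) \<and> length (arrs 4) = length (arrs 5) \<and>
        is_approx_min_plus_conv (fp_real \<epsilon>) (map fp_value A) (map fp_value B) (map fp_value (zip (arrs 4) (arrs 5)))"
    and n: "1 \<le> n" and len: "length A = n" "length B = n"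
    and AB: "int_value ` set A \<subseteq> Rplus" "int_value ` set B \<subseteq> Rplus"
    and r: "r = Suc w"
  shows "\<exists>t regs arrs. exec (max_word ((2 * r + 9) * r + 2) n (A @ B)) (exact_prog (4 ^ (r + 2)) P) (exact_input A B) t (regs, arrs) \<and>
    real t \<le> T n 1 + real (190 * n + 100) \<and>
    is_min_max_conv (map int_value A) (map int_value B) (map int_value (arrs 2))"
proof -
  define W where "W = Max (insert 0 (abs ` set (A @ B)))"
  define b where "b = int n + 2 + W"
  define M where "M = b ^ ((2 * r + 9) * r + 2)"
  have M_eq: "max_word ((2 * r + 9) * r + 2) n (A @ B) = M" by (simp add: max_word_def M_def b_def W_def)
  have W0: "0 \<le> W" unfolding W_def by (rule Max_ge) auto
  have pos: "0 \<le> x" if "x \<in> set A \<union> set B" for x using AB that by (auto simp: int_value_in_Rplus_iff)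
  have xW: "0 \<le> x \<and> x \<le> W" if "x \<in> set A \<union> set B" for x
  proof -
    have "\<bar>x\<bar> \<le> W" unfolding W_def using that by (intro Max_ge) auto
    then show ?thesis using pos[OF that] by simp
  qed
  have b3: "3 \<le> b" using n W0 unfolding b_def by linarith
  define c0 where "c0 = (4::int) ^ (r + 2)"
  have c01: "1 \<le> c0" unfolding c0_def by (rule one_le_power) simp
  have bp: "b ^ i \<le> b ^ j" if "i \<le> j" for i j using b3 that by (intro power_increasing) auto
  have c0b: "8 * c0 * b\<^sup>2 \<le> b ^ (2 * r + 9)"
  proof -
    have "8 * c0 = 2 ^ (2 * r + 7)" by (simp add: c0_def power_add power_mult)
    also have "\<dots> \<le> b ^ (2 * r + 7)" using b3 by (intro power_mono) auto
    finally have "8 * c0 * b\<^sup>2 \<le> b ^ (2 * r + 7) * b\<^sup>2" by (intro mult_right_mono) auto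
    then show ?thesis by (simp add: power_add[symmetric] add.commute)
  qed
  have Bd_M: "b ^ (2 * r + 9) \<le> M" unfolding M_def r by (rule bp) simp
  have W1: "int n + W + 3 \<le> 2 * b" "W + 1 \<le> b" using b3 n by (auto simp: b_def)
  have encM: "c0 * (int n + W + 3) * (W + 1) \<le> M"
  proof -
    have "c0 * (int n + W + 3) * (W + 1) \<le> c0 * (2 * b) * b" using W1 W0 c01 b3 by (intro mult_mono) auto
    also have "\<dots> = 2 * (c0 * b\<^sup>2)" by (simp add: power2_eq_square)
    also have "\<dots> \<le> 8 * (c0 * b\<^sup>2)" using c01 by (intro mult_right_mono) auto
    finally show ?thesis using c0b Bd_M by simp
  qed
  define s0 where "s0 = exact_input A B"
  from runs_enc_prog[OF len n W0 xW c01 encM]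
  obtain t1 s1 V0 where e1: "exec M (enc_prog c0) s0 t1 s1" "t1 \<le> n * 90 + 50" and
    V0: "0 \<le> V0" "V0 \<le> W" "\<And>x. x \<in> set A \<union> set B \<Longrightarrow> x \<le> V0" and
    s1: "fst s1 0 = int n" "fst s1 3 = c0 * (int n + V0 + 3)"
      "embeds 20 (approx_input (encode (c0 * (int n + V0 + 3)) A) (encode (c0 * (int n + V0 + 3)) B) (1, 0)) s1"
    unfolding runs_def s0_def by blast
  define u where "u = n + nat V0 + 3"
  define c where "c = c0 * int u"
  have u: "int n + V0 + 3 = int u" "1 \<le> u" using V0 by (auto simp: u_def)
  note s1 = s1[unfolded u(1), folded c_def]
  have cu: "int u \<le> c" using mult_right_mono[OF c01, of "int u"] by (simp add: c_def)
  have c3: "3 \<le> c" "0 \<le> c" using cu V0(1) unfolding u(1)[symmetric] by auto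
  define A1 where "A1 = encode c A"
  define B1 where "B1 = encode c B"
  have len1: "length A1 = n" "length B1 = n" using len by (auto simp: A1_def B1_def encode_def)
  have Rp: "fp_value ` set (encode c X) \<subseteq> Rplus" if "\<And>x. x \<in> set X \<Longrightarrow> 0 \<le> x" for X
  proof -
    have "(1::real) \<le> 2 powi (c * x)" if "0 \<le> x" for x
      using two_powi_le_iff[of 0 "c * x"] that c3 by simp
    then show ?thesis using that by (auto simp: encode_def fp_value_def fp_real_def Rplus_def)
  qed
  have Rp1: "fp_value ` set A1 \<subseteq> Rplus" "fp_value ` set B1 \<subseteq> Rplus"
    unfolding A1_def B1_def using pos by (auto intro!: Rp)
  have fp1: "fp_real (1, 0) = 1" by (simp add: fp_real_def)
  obtain t2 regs arrs where e2: "exec (approx_max_word w A1 B1 (1, 0)) P (approx_input A1 B1 (1, 0)) t2 (regs, arrs)"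
      "real t2 \<le> T n 1" "length (arrs 4) = length (arrs 5)"
    and approx: "is_approx_min_plus_conv 1 (map fp_value A1) (map fp_value B1) (map fp_value (zip (arrs 4) (arrs 5)))"
    using P[OF n len1 Rp1, of "(1, 0)"] unfolding fp1 by auto
  define xs where "xs = map fst A1 @ map snd A1 @ map fst B1 @ map snd B1 @ [1, 0, \<lceil>1 / fp_real (1, 0)\<rceil>]"
  define d where "d = int n + 2 + Max (insert 0 (abs ` set xs))"
  have w_eq: "approx_max_word w A1 B1 (1, 0) = d ^ w"
    using len1 by (simp add: approx_max_word_def max_word_def d_def xs_def)
  have xd: "\<bar>x\<bar> + int n + 2 \<le> d" if "x \<in> set xs" for x
    using Max_ge[of "insert 0 (abs ` set xs)" "\<bar>x\<bar>"] that by (simp add: d_def)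
  have d1: "int n + 2 \<le> d" using xd[of 0] by (simp add: xs_def)
  have cV: "0 \<le> c * V0" using c3 V0 by simp
  have enc_le: "\<bar>x\<bar> \<le> 1 + c * V0"
    if x: "x \<in> fst ` set (encode c X) \<union> snd ` set (encode c X)"
      and X: "\<And>y. y \<in> set X \<Longrightarrow> 0 \<le> y \<and> y \<le> V0" for x X
  proof -
    obtain y where y: "y \<in> set X" "x = 1 \<or> x = 0 \<or> x = c * y"
      using x by (auto simp: encode_def split: if_splits)
    have "c * y \<le> c * V0" "0 \<le> c * y" using X[OF y(1)] c3 by (auto intro: mult_left_mono)
    then show ?thesis using y(2) cV by auto
  qed
  have "d \<le> int n + 3 + c * V0"
  proof -
    have "\<bar>x\<bar> \<le> 1 + c * V0" if x: "x \<in> set xs" for x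
    proof -
      have "set xs = (fst ` set A1 \<union> snd ` set A1) \<union> (fst ` set B1 \<union> snd ` set B1) \<union> {1, 0}"
        by (auto simp: xs_def fp1)
      then consider "x \<in> fst ` set A1 \<union> snd ` set A1" | "x \<in> fst ` set B1 \<union> snd ` set B1" | "x \<in> {1, 0}"
        using x by blast
      then show ?thesis
      proof cases
        case 1
        then show ?thesis using enc_le[of x A] pos V0(3) by (simp add: A1_def)
      next
        case 2
        then show ?thesis using enc_le[of x B] pos V0(3) by (simp add: B1_def)
      next
        case 3
        then show ?thesis using cV by auto
      qed
    qed
    then have "Max (insert 0 (abs ` set xs)) \<le> 1 + c * V0" using cV by (intro Max.boundedI) auto
    then show ?thesis by (simp add: d_def)
  qed
  also have "\<dots> \<le> 2 * c0 * (int u)\<^sup>2"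
  proof -
    have "c * V0 \<le> c * int u" using c3 u(1) by (intro mult_left_mono) auto
    moreover have "c * 1 \<le> c * int u" using c3 u(2) by (intro mult_left_mono) auto
    moreover have "int n + 3 \<le> int u" using u(1) V0(1) by simp
    moreover have "2 * c0 * (int u)\<^sup>2 = c * int u + c * int u" by (simp add: c_def power2_eq_square)
    ultimately show ?thesis using cu by linarith
  qed
  finally have d_le: "d \<le> 2 * c0 * (int u)\<^sup>2" .
  \<comment> \<open>The exponent is \<open>r = Suc w\<close> rather than \<open>w\<close>, so that
    \<open>M1\<close> bounds the input words as well, even when \<open>w = 0\<close>.\<close>
  define M1 where "M1 = d ^ r"
  have dM1: "d \<le> M1" using power_increasing[of 1 r d] d1 by (simp add: M1_def r)
  have wM1: "d ^ w \<le> M1" unfolding M1_def r using d1 by (intro power_increasing) auto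
  have M1c: "8 * M1 \<le> 2 ^ nat c"
  proof -
    have "8 * M1 \<le> 8 * (2 * c0 * (int u)\<^sup>2) ^ r" unfolding M1_def using d_le d1 by (intro mult_left_mono power_mono) auto
    also have "\<dots> = int (8 * (2 * 4 ^ (r + 2) * u\<^sup>2) ^ r)" by (simp add: c0_def)
    also have "\<dots> \<le> int (2 ^ (4 ^ (r + 2) * u))" using spread_bound[OF u(2), of r] by (simp only: of_nat_le_iff)
    also have "4 ^ (r + 2) * u = nat c" by (simp add: c_def c0_def nat_mult_distrib nat_power_eq)
    finally show ?thesis by simp
  qed
  \<comment> \<open>\<open>u \<le> 2 * b\<close> turns the bound on \<open>d\<close> into
    \<open>8 * c0 * b\<^sup>2 \<le> b ^ (2 * r + 9)\<close>, and the \<open>r\<close>-th power gives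
    the exponent \<open>(2 * r + 9) * r\<close>. The two further powers of \<open>b\<close>
    contribute a factor of at least 9, which absorbs the 2 added during decoding.\<close>
  have M1M: "M1 + 2 \<le> M" "M1 \<le> M"
  proof -
    have "int u \<le> 2 * b" using V0(2) W1 u(1) by linarith
    then have "2 * c0 * (int u)\<^sup>2 \<le> 2 * c0 * (2 * b)\<^sup>2" using c01 by (intro mult_left_mono power_mono) auto
    also have "\<dots> = 8 * c0 * b\<^sup>2" by (simp add: power2_eq_square)
    finally have "d \<le> b ^ (2 * r + 9)" using d_le c0b by linarith
    then have "M1 \<le> (b ^ (2 * r + 9)) ^ r" unfolding M1_def using d1 by (intro power_mono) auto
    then have 1: "M1 \<le> b ^ ((2 * r + 9) * r)" by (simp add: power_mult)
    have "3 * 3 \<le> b * b" using b3 by (intro mult_mono) auto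
    then have "b ^ ((2 * r + 9) * r) * 9 \<le> b ^ ((2 * r + 9) * r) * (b * b)" using b3 by (intro mult_left_mono) auto
    also have "\<dots> = M" by (simp add: M_def power_add power2_eq_square)
    finally have 9: "9 * b ^ ((2 * r + 9) * r) \<le> M" by simp
    have "1 \<le> b ^ ((2 * r + 9) * r)" using b3 by simp
    then show "M1 + 2 \<le> M" "M1 \<le> M" using 1 9 by linarith+
  qed
  have wb0: "words_bounded M1 (approx_input A1 B1 (1, 0))"
  proof -
    have "\<bar>x\<bar> \<le> M1" if "x \<in> set xs" for x using xd[OF that] dM1 by linarith
    then have "\<forall>x \<in> set xs. \<bar>x\<bar> \<le> M1" by blast
    moreover have "int n \<le> M1" "1 \<le> M1" using d1 dM1 by auto
    ultimately show ?thesis unfolding words_bounded_def approx_input_def using len1 by (auto simp: xs_def)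
  qed
  have wb: "words_bounded M1 (regs, arrs)"
    by (rule exec_words_bounded[OF e2(1) wb0]) (simp add: w_eq wM1)
  have "approx_max_word w A1 B1 (1, 0) \<le> M" using w_eq wM1 M1M by simp
  from exec_shift[OF e2(1) s1(3)[folded A1_def B1_def] this] obtain s2 where
    e2': "exec M (shift 20 P) s1 t2 s2" and emb: "embeds 20 (regs, arrs) s2" by blast
  have out: "snd s2 24 = arrs 4" "snd s2 25 = arrs 5"
    using emb[unfolded embeds_def, THEN conjunct2, rule_format, of 4]
      emb[unfolded embeds_def, THEN conjunct2, rule_format, of 5] by simp_all
  have f2: "x < 20 \<Longrightarrow> fst s2 x = fst s1 x" for x
    using frame_reg[OF exec_frame[OF e2'], of x] wr_shift[of 20 P] by force
  have s2: "fst s2 0 = int n" "fst s2 3 = c" using f2 s1 by auto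
  have lenC: "length (arrs 4) = 2 * n - 1" "length (arrs 5) = 2 * n - 1"
    using approx e2(3) len1 by (auto simp: is_approx_min_plus_conv_def)
  have "runs M dec_prog s2 (n * 100 + 50) (\<lambda>s'. length (snd s' 2) = 2 * n - 1 \<and>
     (\<forall>k<2 * n - 1. snd s' 2 ! k = (if 0 < arrs 4 ! k then - ((2 - arrs 5 ! k) div c) else 0)))"
  proof (rule runs_dec_prog[OF s2 out lenC n])
    show "0 < c" using c3 by simp
    have "2 * int n \<le> b * b" using mult_mono[of 2 b "int n" b] b3 W0 by (simp add: b_def)
    also have "\<dots> = b ^ 2" by (simp add: power2_eq_square)
    also have "\<dots> \<le> M" unfolding M_def by (rule bp) simp
    finally show "2 * int n \<le> M" .
    show "\<bar>x\<bar> + 2 \<le> M" if "x \<in> set (arrs 5)" for x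
    proof -
      have "\<bar>x\<bar> \<le> M1" using wb that by (auto simp: words_bounded_def)
      then show ?thesis using M1M by linarith
    qed
  qed
  then obtain t3 s3 where e3: "exec M dec_prog s2 t3 s3" "t3 \<le> n * 100 + 50" and
    D: "length (snd s3 2) = 2 * n - 1"
      "\<And>k. k < 2 * n - 1 \<Longrightarrow> snd s3 2 ! k = (if 0 < arrs 4 ! k then - ((2 - arrs 5 ! k) div c) else 0)"
    unfolding runs_def by blast
  have Cm: "8 * x \<le> 2 ^ nat c" if "x \<in> set (arrs 4)" for x
  proof -
    have "\<bar>x\<bar> \<le> M1" using wb that by (auto simp: words_bounded_def)
    then show ?thesis using M1c by linarith
  qed
  have "is_min_max_conv (map int_value A) (map int_value B) (map int_value (snd s3 2))"
    by (rule min_max_decode[OF len n pos c3(1) approx[unfolded A1_def B1_def] e2(3) Cm D])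
  moreover have "exec M (exact_prog c0 P) s0 (t1 + (t2 + t3)) s3"
    unfolding exact_prog_def using e1(1) e2' e3(1) by (blast intro: exec.Seq)
  moreover have "real (t1 + (t2 + t3)) \<le> T n 1 + real (190 * n + 100)"
  proof -
    have "t1 + t3 \<le> 190 * n + 100" using e1(2) e3(2) by linarith
    then have "real (t1 + t3) \<le> real (190 * n + 100)" by (simp only: of_nat_le_iff)
    then show ?thesis using e2(2) by simp
  qed
  ultimately show ?thesis unfolding M_eq c0_def[symmetric] s0_def[symmetric]
    by (intro exI[of _ "t1 + (t2 + t3)"] exI[of _ "fst s3"] exI[of _ "snd s3"]) simp
qed

section \<open>Asymptotic time bounds\<close>

lemma powr_ge_self: "real n \<le> real n powr c" if "1 \<le> n" "1 \<le> c" for c :: real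
  using powr_mono[of 1 c "real n"] that by simp

lemma log2_add_2_ge_1: "1 \<le> log 2 (x + 2)" if "0 \<le> x" for x :: real
  using that by (simp add: le_log_iff)

text \<open>At \<open>\<epsilon> = 1\<close> the factor depending on \<open>\<epsilon>\<close> is
  the constant \<open>log 2 3 ^ l\<close>, and the linear overhead of encoding and decoding is
  absorbed because \<open>c \<ge> 1\<close>.\<close>

lemma min_max_if_approx_min_plus:
  fixes c :: real
  assumes c: "1 \<le> c" and solv: "approx_min_plus_solvable_in T"
    and O: "soft_O_eps T (\<lambda>n \<epsilon>. real n powr c / min 1 \<epsilon> ^ d)"
  shows "\<exists>T. min_max_solvable_in T \<and> soft_O T (\<lambda>n. real n powr c)"
proof -
  obtain P w where P: "\<And>n A B \<epsilon>. 1 \<le> n \<Longrightarrow> length A = n \<Longrightarrow> length B = n \<Longrightarrow>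
      fp_value ` set A \<subseteq> Rplus \<Longrightarrow> fp_value ` set B \<subseteq> Rplus \<Longrightarrow> 0 < fp_real \<epsilon> \<Longrightarrow>
      \<exists>t regs arrs. exec (approx_max_word w A B \<epsilon>) P (approx_input A B \<epsilon>) t (regs, arrs) \<and>
        real t \<le> T n (fp_real \<epsilon>) \<and> length (arrs 4) = length (arrs 5) \<and>
        is_approx_min_plus_conv (fp_real \<epsilon>) (map fp_value A) (map fp_value B) (map fp_value (zip (arrs 4) (arrs 5)))"
  proof -
    from solv obtain P w where P: "\<forall>n A B \<epsilon>. 1 \<le> n \<and> length A = n \<and> length B = n \<and>
        fp_value ` set A \<subseteq> Rplus \<and> fp_value ` set B \<subseteq> Rplus \<and> 0 < fp_real \<epsilon> \<longrightarrow>
        (\<exists>t regs arrs. exec (approx_max_word w A B \<epsilon>) P (approx_input A B \<epsilon>) t (regs, arrs) \<and>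
          real t \<le> T n (fp_real \<epsilon>) \<and> length (arrs 4) = length (arrs 5) \<and>
          is_approx_min_plus_conv (fp_real \<epsilon>) (map fp_value A) (map fp_value B) (map fp_value (zip (arrs 4) (arrs 5))))"
      unfolding approx_min_plus_solvable_in_def by (elim exE)
    show thesis by (rule that, rule P[rule_format]) auto
  qed
  obtain K l :: nat where Kl: "\<And>n \<epsilon>. 1 \<le> n \<Longrightarrow> 0 < \<epsilon> \<Longrightarrow>
      T n \<epsilon> \<le> real K * (real n powr c / min 1 \<epsilon> ^ d) * (log 2 (real n + 2) * log 2 (1 / \<epsilon> + 2)) ^ l"
    using O unfolding soft_O_eps_def by blast
  define T' where "T' n = T n 1 + real (190 * n + 100)" for n
  have "min_max_solvable_in T'"
    unfolding min_max_solvable_in_def T'_def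
  proof (rule exI, rule exI, intro allI impI)
    fix n A B
    assume "1 \<le> n \<and> length A = n \<and> length B = n \<and> int_value ` set A \<subseteq> Rplus \<and> int_value ` set B \<subseteq> Rplus"
    then show "\<exists>t regs arrs. exec (max_word ((2 * Suc w + 9) * Suc w + 2) n (A @ B)) (exact_prog (4 ^ (Suc w + 2)) P) (exact_input A B) t (regs, arrs) \<and>
      real t \<le> T n 1 + real (190 * n + 100) \<and>
      is_min_max_conv (map int_value A) (map int_value B) (map int_value (arrs 2))"
      by (intro exact_prog_correct[OF P _ _ _ _ _ refl]) simp_all
  qed
  moreover have "soft_O T' (\<lambda>n. real n powr c)"
    unfolding soft_O_def
  proof (intro exI allI impI)
    fix n :: nat assume n: "1 \<le> n"
    define g where "g = log 2 (real n + 2) ^ l"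
    have g1: "1 \<le> g" unfolding g_def using log2_add_2_ge_1[of "real n"] by (simp add: one_le_power)
    have p1: "real n \<le> real n powr c" using powr_ge_self[OF n c] .
    then have pg: "real n \<le> real n powr c * g" using mult_mono[of "real n" "real n powr c" 1 g] g1 by simp
    have "T n 1 \<le> real K * real n powr c * (log 2 (real n + 2) * log 2 3) ^ l" using Kl[OF n, of 1] by simp
    also have "\<dots> = (real K * log 2 3 ^ l) * (real n powr c * g)" by (simp add: g_def power_mult_distrib)
    also have "\<dots> \<le> real (nat \<lceil>real K * log 2 3 ^ l\<rceil>) * (real n powr c * g)"
      using g1 by (intro mult_right_mono) (auto simp: real_nat_ceiling_ge)
    finally have "T n 1 \<le> real (nat \<lceil>real K * log 2 3 ^ l\<rceil>) * (real n powr c * g)" .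
    moreover have "real (190 * n + 100) \<le> 290 * (real n powr c * g)" using pg n by simp
    ultimately show "T' n \<le> real (nat \<lceil>real K * log 2 3 ^ l\<rceil> + 290) * real n powr c * log 2 (real n + 2) ^ l"
      unfolding T'_def g_def by (simp add: algebra_simps)
  qed
  ultimately show ?thesis by blast
qed

text \<open>The subroutine runs on length \<open>m\<close>, at most a constant times
  \<open>n / min 1 \<epsilon>\<close>, so \<open>m powr c\<close> splits into
  \<open>n powr c\<close> and a power of \<open>1 / min 1 \<epsilon>\<close>, whose exponent is
  rounded up to \<open>d\<close>. Sorting costs about \<open>m * log m\<close>, hence the one
  additional logarithm in \<open>Suc l\<close>.\<close>

lemma approx_min_plus_if_min_max:
  fixes c :: real
  assumes c: "1 \<le> c" and solv: "min_max_solvable_in T" and O: "soft_O T (\<lambda>n. real n powr c)"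
  shows "\<exists>T d :: nat. approx_min_plus_solvable_in T \<and> soft_O_eps T (\<lambda>n \<epsilon>. real n powr c / min 1 \<epsilon> ^ d)"
proof -
  obtain P w where P: "\<And>n A B. 1 \<le> n \<Longrightarrow> length A = n \<Longrightarrow> length B = n \<Longrightarrow>
      int_value ` set A \<subseteq> Rplus \<Longrightarrow> int_value ` set B \<subseteq> Rplus \<Longrightarrow>
      \<exists>t regs arrs. exec (max_word w n (A @ B)) P (exact_input A B) t (regs, arrs) \<and> real t \<le> T n \<and>
        is_min_max_conv (map int_value A) (map int_value B) (map int_value (arrs 2))"
    using solv unfolding min_max_solvable_in_def by blast
  obtain K l :: nat where Kl: "\<And>n. 1 \<le> n \<Longrightarrow> T n \<le> real K * real n powr c * log 2 (real n + 2) ^ l"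
    using O unfolding soft_O_def by blast
  define d where "d = nat \<lceil>c\<rceil>"
  define K' where "K' = nat \<lceil>(real K + 1406) * 26 powr c * 7 ^ Suc l\<rceil>"
  \<comment> \<open>The time bound is chosen to be the target bound itself, so that only the
    comparison with the actual running time remains.\<close>
  define T' where "T' n \<epsilon> = real K' * (real n powr c / min 1 \<epsilon> ^ d) * (log 2 (real n + 2) * log 2 (1 / \<epsilon> + 2)) ^ Suc l"
    for n :: nat and \<epsilon> :: real
  have time: "\<exists>L. 4 * m \<le> 2 ^ L \<and> T m + real (m * (176 * L + 502) + 200) \<le> T' n \<epsilon>"
    if n: "1 \<le> n" and \<epsilon>: "0 < \<epsilon>" and m: "m = (6 * E + 1) * (2 * n)" "1 \<le> m" and E: "real E \<le> 2 / min 1 \<epsilon>"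
    for m n E :: nat and \<epsilon> :: real
  proof (intro exI conjI)
    define \<mu> where "\<mu> = min 1 \<epsilon>"
    have \<mu>: "0 < \<mu>" "\<mu> \<le> 1" "1 \<le> 1 / \<mu>" using \<epsilon> by (auto simp: \<mu>_def)
    have \<mu>\<epsilon>: "1 / \<mu> \<le> 1 / \<epsilon> + 2" using \<epsilon> by (auto simp: \<mu>_def min_def)
    define L where "L = nat \<lceil>log 2 (4 * real m)\<rceil>"
    define g where "g = log 2 (real m + 2)"
    have g1: "1 \<le> g" unfolding g_def by (rule log2_add_2_ge_1) simp
    have L2: "log 2 (4 * real m) \<le> real L" by (simp add: L_def real_nat_ceiling_ge)
    then have "4 * real m \<le> 2 powr real L" using m(2) by (simp add: log_le_iff)
    then have "real (4 * m) \<le> real (2 ^ L)" by (simp add: powr_realpow)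
    then show "4 * m \<le> 2 ^ L" by (simp only: of_nat_le_iff)
    have "0 \<le> log 2 (4 * real m)" using m(2) by (simp add: le_log_iff)
    then have "real L \<le> log 2 (4 * real m) + 1" unfolding L_def by linarith
    moreover have "log 2 (4 * real m) = 2 + log 2 (real m)"
    proof -
      have "log 2 (4::real) = 2" using log_pow_cancel[of 2 2] by simp
      then show ?thesis using m(2) by (simp add: log_mult)
    qed
    moreover have "log 2 (real m) \<le> g" unfolding g_def using m(2) by simp
    ultimately have Lg: "real L \<le> 4 * g" using g1 by linarith
    have mc: "real m \<le> real m powr c" using powr_ge_self[OF m(2) c] .
    have gl: "1 \<le> g ^ l" using g1 by (simp add: one_le_power)
    \<comment> \<open>702 is 502 + 200, using \<open>m \<ge> 1\<close>. With
      \<open>L \<le> 4 * g\<close> and \<open>g \<ge> 1\<close> this becomes 4 * 176 + 702 =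
      1406.\<close>
    have "real (m * (176 * L + 502) + 200) \<le> real m * (176 * real L + 702)" using m(2) by (simp add: algebra_simps)
    also have "\<dots> \<le> real m * (1406 * g)" using Lg g1 by (intro mult_left_mono) auto
    also have "\<dots> \<le> real m powr c * (1406 * g ^ Suc l)"
      using mc g1 gl by (intro mult_mono) (auto simp: mult_le_cancel_left1)
    finally have 1: "real (m * (176 * L + 502) + 200) \<le> 1406 * (real m powr c * g ^ Suc l)" by (simp add: mult_ac)
    have "T m \<le> real K * real m powr c * g ^ l" using Kl[OF m(2)] by (simp add: g_def)
    also have "\<dots> \<le> real K * real m powr c * g ^ Suc l" using g1 by (intro mult_left_mono power_increasing) auto
    finally have 2: "T m + real (m * (176 * L + 502) + 200) \<le> (real K + 1406) * (real m powr c * g ^ Suc l)"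
      using 1 by (simp add: algebra_simps)
    \<comment> \<open>\<open>E \<le> 2 / \<mu>\<close> gives
      \<open>6 * E + 1 \<le> 13 / \<mu>\<close>, and the block length \<open>2 * n\<close> doubles
      the 13.\<close>
    have mb: "real m \<le> 26 * (real n * (1 / \<mu>))"
    proof -
      have "real m = (6 * real E + 1) * (2 * real n)" by (simp add: m algebra_simps)
      also have "\<dots> \<le> (13 * (1 / \<mu>)) * (2 * real n)" using E \<mu>(3) by (intro mult_right_mono) (auto simp: \<mu>_def)
      finally show ?thesis by simp
    qed
    have mpc: "real m powr c \<le> 26 powr c * (real n powr c / \<mu> ^ d)"
    proof -
      have "real m powr c \<le> (26 * (real n * (1 / \<mu>))) powr c" using mb c by (intro powr_mono2) auto
      also have "\<dots> = 26 powr c * (real n powr c * (1 / \<mu>) powr c)"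
        by (simp only: powr_mult)
      also have "(1 / \<mu>) powr c \<le> (1 / \<mu>) powr real d"
        using \<mu>(3) by (intro powr_mono) (auto simp: d_def real_nat_ceiling_ge)
      also have "(1 / \<mu>) powr real d = 1 / \<mu> ^ d" using \<mu> by (simp add: powr_realpow power_one_over)
      finally show ?thesis by (simp add: mult_left_mono)
    qed
    define \<Lambda> where "\<Lambda> = log 2 (real n + 2) * log 2 (1 / \<epsilon> + 2)"
    have lg: "g \<le> 7 * \<Lambda>"
    proof -
      define p where "p = log 2 (real n + 2)"
      define q where "q = log 2 (1 / \<epsilon> + 2)"
      have pq: "1 \<le> p" "1 \<le> q" unfolding p_def q_def using \<epsilon> by (auto intro!: log2_add_2_ge_1)
      have e2: "0 < 1 / \<epsilon> + 2" using \<epsilon> by (simp add: add_pos_pos)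
      have "real n * (1 / \<mu>) \<le> real n * (1 / \<epsilon> + 2)" using \<mu>\<epsilon> by (intro mult_left_mono) auto
      moreover have "32 * ((real n + 2) * (1 / \<epsilon> + 2)) = 32 * (real n * (1 / \<epsilon> + 2)) + 64 * (1 / \<epsilon> + 2)"
        by (simp add: algebra_simps)
      moreover have "0 \<le> real n * (1 / \<epsilon> + 2)" "2 \<le> 64 * (1 / \<epsilon> + 2)" using \<epsilon> e2 by auto
      \<comment> \<open>32 is a power of two above 26, and it contributes the 5 in
        \<open>g \<le> 5 + p + q\<close>. As \<open>p\<close> and \<open>q\<close> are at least 1,
        their product bounds each of 1, \<open>p\<close> and \<open>q\<close>, which gives the
        factor 7.\<close>
      ultimately have "real m + 2 \<le> 32 * ((real n + 2) * (1 / \<epsilon> + 2))" using mb by linarith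
      then have "g \<le> log 2 (32 * ((real n + 2) * (1 / \<epsilon> + 2)))" unfolding g_def by (intro log_mono) auto
      also have "\<dots> = log 2 32 + (p + q)" unfolding p_def q_def using e2 by (simp add: log_mult)
      also have "log 2 (32::real) = 5" using log_pow_cancel[of 2 5] by simp
      finally have "g \<le> 5 + (p + q)" .
      moreover have "p * 1 \<le> p * q" "1 * q \<le> p * q" using pq by (intro mult_left_mono mult_right_mono; simp)+
      ultimately show ?thesis using pq unfolding \<Lambda>_def p_def[symmetric] q_def[symmetric] by linarith
    qed
    have \<Lambda>0: "0 \<le> \<Lambda>" using lg g1 by linarith
    have gS: "g ^ Suc l \<le> 7 ^ Suc l * \<Lambda> ^ Suc l"
      unfolding power_mult_distrib[symmetric] using lg g1 by (intro power_mono) auto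
    have "(real K + 1406) * (real m powr c * g ^ Suc l)
      \<le> (real K + 1406) * ((26 powr c * (real n powr c / \<mu> ^ d)) * (7 ^ Suc l * \<Lambda> ^ Suc l))"
      using mpc gS g1 \<mu> by (intro mult_left_mono mult_mono) auto
    also have "\<dots> = ((real K + 1406) * 26 powr c * 7 ^ Suc l) * ((real n powr c / \<mu> ^ d) * \<Lambda> ^ Suc l)"
      by (simp only: mult_ac)
    also have "\<dots> \<le> real K' * ((real n powr c / \<mu> ^ d) * \<Lambda> ^ Suc l)"
      unfolding K'_def using \<Lambda>0 \<mu> by (intro mult_right_mono) (auto simp: real_nat_ceiling_ge)
    also have "\<dots> = T' n \<epsilon>" by (simp only: T'_def \<mu>_def \<Lambda>_def mult_ac)
    finally show "T m + real (m * (176 * L + 502) + 200) \<le> T' n \<epsilon>" using 2 by linarith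
  qed
  have "approx_min_plus_solvable_in T'"
    unfolding approx_min_plus_solvable_in_def
  proof (rule exI, rule exI, intro allI impI)
    fix n A B \<epsilon>
    assume h: "1 \<le> n \<and> length A = n \<and> length B = n \<and> fp_value ` set A \<subseteq> Rplus \<and> fp_value ` set B \<subseteq> Rplus \<and> 0 < fp_real \<epsilon>"
    then have h': "1 \<le> n" "length A = n" "length B = n" "fp_value ` set A \<subseteq> Rplus" "fp_value ` set B \<subseteq> Rplus" "0 < fp_real \<epsilon>"
      by simp_all
    obtain m E :: nat where m: "m = (6 * E + 1) * (2 * n)" "1 \<le> m" "real E \<le> 2 / min 1 (fp_real \<epsilon>)"
      and run: "\<And>L. 4 * m \<le> 2 ^ L \<Longrightarrow> \<exists>t regs arrs.
      exec (approx_max_word (8 + 6 * w) A B \<epsilon>) (approx_prog P) (approx_input A B \<epsilon>) t (regs, arrs) \<and>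
      real t \<le> T m + real (m * (176 * L + 502) + 200) \<and> length (arrs 4) = length (arrs 5) \<and>
      is_approx_min_plus_conv (fp_real \<epsilon>) (map fp_value A) (map fp_value B) (map fp_value (zip (arrs 4) (arrs 5)))"
      using approx_prog_correct[OF P h'] by blast
    obtain L where L: "4 * m \<le> 2 ^ L" "T m + real (m * (176 * L + 502) + 200) \<le> T' n (fp_real \<epsilon>)"
      using time[OF h'(1,6) m] by blast
    obtain t regs arrs where
      "exec (approx_max_word (8 + 6 * w) A B \<epsilon>) (approx_prog P) (approx_input A B \<epsilon>) t (regs, arrs)"
      "real t \<le> T m + real (m * (176 * L + 502) + 200)" "length (arrs 4) = length (arrs 5)"
      "is_approx_min_plus_conv (fp_real \<epsilon>) (map fp_value A) (map fp_value B) (map fp_value (zip (arrs 4) (arrs 5)))"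
      using run[OF L(1)] by blast
    then show "\<exists>t regs arrs.
           exec (approx_max_word (8 + 6 * w) A B \<epsilon>) (approx_prog P) (approx_input A B \<epsilon>) t (regs, arrs) \<and>
           real t \<le> T' n (fp_real \<epsilon>) \<and>
           length (arrs 4) = length (arrs 5) \<and>
           is_approx_min_plus_conv (fp_real \<epsilon>) (map fp_value A) (map fp_value B)
             (map fp_value (zip (arrs 4) (arrs 5)))"
      using L(2) by (intro exI[of _ t] exI[of _ regs] exI[of _ arrs] conjI) simp_all
  qed
  moreover have "soft_O_eps T' (\<lambda>n \<epsilon>. real n powr c / min 1 \<epsilon> ^ d)"
    unfolding soft_O_eps_def T'_def by blast
  ultimately show ?thesis by blast
qed

theorem mainTheorem12:
  fixes c :: real
  assumes "c \<ge> 1"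
  shows "(\<exists>T d :: nat. approx_min_plus_solvable_in T \<and>
             soft_O_eps T (\<lambda>n \<epsilon>. real n powr c / min 1 \<epsilon> ^ d))
     \<longleftrightarrow> (\<exists>T. min_max_solvable_in T \<and> soft_O T (\<lambda>n. real n powr c))"
  using min_max_if_approx_min_plus[OF assms] approx_min_plus_if_min_max[OF assms] by blast

end
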